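(* For every $k \geq 0$, there exist graphs $G$ and $H$ such that $G \equiv_{\mathcal{H}_k} H$ and $G \not\equiv_{\mathcal{H}_{k+1}} H$.
   Context: All graphs are finite, simple and loopless. For a graph class $\mathcal{F}$, $G\equiv_{\mathcal{F}}H$ means $\hom(F,G)=\hom(F,H)$ for every $F\in\mathcal{F}$, where $\hom(F,G)$ is the number of homomorphisms $F\to G$. For $g,d\geq 0$, let $\mathcal{C}_{g,d}$ be the class of graphs $G$ having a set $S\subseteq V(G)$ with $|S|\leq d$ such that $G-S$ has Euler genus $\leq g$. For a graph $G$ and $X\subseteq V(G)$, the torso of $G$ on $X$ is the graph with vertex set $X$ whose edges are the edges of $G$ with both endpoints in $X$ together with all pairs $xy$ with $x,y\in N_G(C)$ for some connected component $C$ of $G-X$. For a class $\mathcal{C}$ and $s\geq0$, $\mathcal{C}^{\oplus s}$ is the class of graphs $G$ admitting a tree decomposition $(T,\beta)$ with $|\beta(t)\cap\beta(t')|\leq s$ for every $tt'\in E(T)$ and such that the torso of $G$ on $\beta(t)$ lies in $\mathcal{C}$ for every $t\in V(T)$. $\mathcal{H}_k \coloneqq \mathcal{C}_{k,k}^{\oplus k}$ is the class of graphs of vortex-free Hadwiger number at most $k$. *)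

theory Defs
  imports "Graph_Theory.Graph_Theory" "HOL-Combinatorics.Orbits" "HOL-Library.FuncSet"
begin

text \<open>
  A finite simple loopless graph is a \<^locale>\<open>pair_graph\<close>: a finite vertex set with a finite,
  symmetric, irreflexive set of arcs.  Every edge \<open>uv\<close> is thus present as the two arcs
  \<open>(u, v)\<close> and \<open>(v, u)\<close>.  The connected components of such a graph are its strongly connected
  components, \<^const>\<open>pre_digraph.sccs_verts\<close>.
\<close>

definition pair_induce :: "'a pair_pre_digraph \<Rightarrow> 'a set \<Rightarrow> 'a pair_pre_digraph" where
  "pair_induce G X = \<lparr> pverts = X, parcs = {e \<in> parcs G. fst e \<in> X \<and> snd e \<in> X} \<rparr>"

lemma with_proj_pair_induce: "with_proj (pair_induce G X) = with_proj G \<restriction> X"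
  by (simp add: pair_induce_def with_proj_def induce_subgraph_def)

definition comps :: "'a pair_pre_digraph \<Rightarrow> 'a set set" where
  "comps G = pre_digraph.sccs_verts (with_proj G)"


section \<open>Homomorphism counts\<close>

definition homs :: "'a pair_pre_digraph \<Rightarrow> 'b pair_pre_digraph \<Rightarrow> ('a \<Rightarrow> 'b) set" where
  "homs F G = {f \<in> pverts F \<rightarrow>\<^sub>E pverts G. \<forall>(u, v) \<in> parcs F. (f u, f v) \<in> parcs G}"

definition hom_indist ::
  "'a pair_pre_digraph set \<Rightarrow> 'b pair_pre_digraph \<Rightarrow> 'c pair_pre_digraph \<Rightarrow> bool" where
  "hom_indist \<F> G H \<longleftrightarrow> (\<forall>F \<in> \<F>. card (homs F G) = card (homs F H))"


section \<open>Euler genus\<close>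

text \<open>
  Embeddings in closed surfaces, orientable or not, are given by embedding schemes
  (Mohar and Thomassen, Graphs on Surfaces, Section 3.3): a rotation system \<open>\<pi>\<close>, which permutes
  the arcs so that its cycles are the cyclic orders of the arcs leaving each vertex, and a
  signature, given here by the set \<open>N\<close> of edges of sign \<open>-1\<close>.
\<close>

definition embedding_scheme ::
  "'a pair_pre_digraph \<Rightarrow> ('a \<times> 'a \<Rightarrow> 'a \<times> 'a) \<Rightarrow> 'a rel \<Rightarrow> bool" where
  "embedding_scheme G \<pi> N \<longleftrightarrow>
     \<pi> permutes parcs G \<and>
     (\<forall>v \<in> pverts G. out_arcs (with_proj G) v \<noteq> {} \<longrightarrow> cyclic_on \<pi> (out_arcs (with_proj G) v)) \<and>
     N \<subseteq> parcs G \<and> sym N"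

text \<open>
  Face tracing: in state \<open>(a, s)\<close> we are about to traverse the arc \<open>a\<close>, and \<open>s\<close> says whether we
  turn according to \<open>\<pi>\<close> or against it.  Traversing an edge of \<open>N\<close> changes \<open>s\<close>.
\<close>

definition face_succ ::
  "('a \<times> 'a \<Rightarrow> 'a \<times> 'a) \<Rightarrow> 'a rel \<Rightarrow> ('a \<times> 'a) \<times> bool \<Rightarrow> ('a \<times> 'a) \<times> bool" where
  "face_succ \<pi> N = (\<lambda>(a, s).
     let s' = (if a \<in> N then \<not> s else s)
     in ((if s' then \<pi> else inv \<pi>) (prod.swap a), s'))"

text \<open>
  Each facial walk is traced by exactly two orbits of \<^const>\<open>face_succ\<close>, one in each direction,
  so the number of orbits is halved.  An isolated vertex lies on a sphere with a single face,
  which no orbit sees.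
\<close>

definition num_faces ::
  "'a pair_pre_digraph \<Rightarrow> ('a \<times> 'a \<Rightarrow> 'a \<times> 'a) \<Rightarrow> 'a rel \<Rightarrow> nat" where
  "num_faces G \<pi> N =
     card (orbit (face_succ \<pi> N) ` (parcs G \<times> UNIV)) div 2 +
     card {v \<in> pverts G. out_arcs (with_proj G) v = {}}"

text \<open>
  The formula \<open>2 c - (V - E + F)\<close>, with \<open>c\<close> the number of components, is the sum over the components
  of the Euler genera \<open>2 - \<chi>\<close> of the surfaces they are embedded in, that is, the Euler genus
  of the connected sum of these surfaces.
\<close>

definition scheme_genus ::
  "'a pair_pre_digraph \<Rightarrow> ('a \<times> 'a \<Rightarrow> 'a \<times> 'a) \<Rightarrow> 'a rel \<Rightarrow> int" where
  "scheme_genus G \<pi> N =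
     2 * int (card (comps G)) -
     (int (card (pverts G)) - int (card (parcs G) div 2) + int (num_faces G \<pi> N))"

definition euler_genus :: "'a pair_pre_digraph \<Rightarrow> nat" where
  "euler_genus G = (LEAST g. \<exists>\<pi> N. embedding_scheme G \<pi> N \<and> scheme_genus G \<pi> N \<le> int g)"


section \<open>Tree decompositions and torsos\<close>

text \<open>
  \<^const>\<open>Digraph_Component.tree\<close> only excludes directed cycles, hence is of no use for symmetric arc sets,
  where every edge yields a directed cycle of length two.
\<close>

definition sym_tree :: "'a pair_pre_digraph \<Rightarrow> bool" where
  "sym_tree T \<longleftrightarrow> pair_graph T \<and> connected (with_proj T) \<and>
     \<not> (\<exists>p. pre_digraph.cycle (with_proj T) p \<and> 3 \<le> length p)"

definition tree_decomposition ::
  "'a pair_pre_digraph \<Rightarrow> 't pair_pre_digraph \<Rightarrow> ('t \<Rightarrow> 'a set) \<Rightarrow> bool" where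
  "tree_decomposition G T \<beta> \<longleftrightarrow>
     sym_tree T \<and>
     (\<Union>t \<in> pverts T. \<beta> t) = pverts G \<and>
     (\<forall>(u, v) \<in> parcs G. \<exists>t \<in> pverts T. u \<in> \<beta> t \<and> v \<in> \<beta> t) \<and>
     (\<forall>v \<in> pverts G. connected (with_proj (pair_induce T {t \<in> pverts T. v \<in> \<beta> t})))"

definition nbhd :: "'a pair_pre_digraph \<Rightarrow> 'a set \<Rightarrow> 'a set" where
  "nbhd G C = {x \<in> pverts G - C. \<exists>c \<in> C. (c, x) \<in> parcs G}"

definition torso :: "'a pair_pre_digraph \<Rightarrow> 'a set \<Rightarrow> 'a pair_pre_digraph" where
  "torso G X = \<lparr> pverts = X,
     parcs = {(x, y). x \<in> X \<and> y \<in> X \<and> (x, y) \<in> parcs G} \<union>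
             {(x, y). x \<noteq> y \<and>
                (\<exists>C \<in> comps (pair_induce G (pverts G - X)). x \<in> nbhd G C \<and> y \<in> nbhd G C)} \<rparr>"


section \<open>The graph classes\<close>

definition apex_genus_class :: "nat \<Rightarrow> nat \<Rightarrow> 'a pair_pre_digraph set" where
  "apex_genus_class g d = {G. pair_graph G \<and>
     (\<exists>S \<subseteq> pverts G. card S \<le> d \<and> euler_genus (pair_induce G (pverts G - S)) \<le> g)}"

text \<open>Trees are finite, so taking their nodes to be natural numbers is no restriction.\<close>

definition clique_sum_closure ::
  "'a pair_pre_digraph set \<Rightarrow> nat \<Rightarrow> 'a pair_pre_digraph set" where
  "clique_sum_closure \<C> s = {G. pair_graph G \<and>
     (\<exists>(T :: nat pair_pre_digraph) \<beta>. tree_decomposition G T \<beta> \<and>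
        (\<forall>(t, t') \<in> parcs T. card (\<beta> t \<inter> \<beta> t') \<le> s) \<and>
        (\<forall>t \<in> pverts T. torso G (\<beta> t) \<in> \<C>))}"

definition vf_hadwiger_class :: "nat \<Rightarrow> 'a pair_pre_digraph set" where
  "vf_hadwiger_class k = clique_sum_closure (apex_genus_class k k) k"


section \<open>Well-formedness\<close>

lemma pair_graph_pair_induce:
  assumes "pair_graph G" "X \<subseteq> pverts G"
  shows "pair_graph (pair_induce G X)"
proof -
  interpret pair_graph G by fact
  show ?thesis
    using assms(2) pair_finite_verts pair_finite_arcs
    by unfold_locales
      (auto simp: pair_induce_def symmetric_def sym_def dest: arcs_symmetric pair_no_loops
        intro: finite_subset)
qed

lemma in_comps_subset: "C \<in> comps G \<Longrightarrow> C \<subseteq> pverts G"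
  by (auto simp: comps_def pre_digraph.sccs_verts_def reachable_def dest: in_rtrancl_on_in_F(1))

lemma nbhd_comps_subset:
  assumes G: "pair_graph G" and X: "X \<subseteq> pverts G"
    and C: "C \<in> comps (pair_induce G (pverts G - X))"
  shows "nbhd G C \<subseteq> X"
proof
  fix x assume x: "x \<in> nbhd G C"
  interpret pair_graph G by fact
  let ?I = "pair_induce G (pverts G - X)"
  interpret I: pair_graph ?I by (rule pair_graph_pair_induce[OF G]) auto
  from x obtain c where c: "c \<in> C" "(c, x) \<in> parcs G" "x \<in> pverts G" "x \<notin> C"
    by (auto simp: nbhd_def)
  show "x \<in> X"
  proof (rule ccontr)
    assume "x \<notin> X"
    moreover have "c \<in> pverts G - X"
      using in_comps_subset[OF C] c(1) by (auto simp: pair_induce_def)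
    ultimately have "(c, x) \<in> parcs ?I" "(x, c) \<in> parcs ?I"
      using c by (auto simp: pair_induce_def dest: arcs_symmetric)
    then have "c \<rightarrow>\<^sup>*\<^bsub>with_proj ?I\<^esub> x" "x \<rightarrow>\<^sup>*\<^bsub>with_proj ?I\<^esub> c"
      by (auto intro: I.reachable_adjI)
    with C c show False
      unfolding comps_def pre_digraph.sccs_verts_def by blast
  qed
qed

lemma pair_graph_torso:
  assumes G: "pair_graph G" and X: "X \<subseteq> pverts G"
  shows "pair_graph (torso G X)"
proof -
  interpret pair_graph G by fact
  have sub: "parcs (torso G X) \<subseteq> X \<times> X"
    using nbhd_comps_subset[OF G X] by (auto simp: torso_def)
  have fin: "finite X"
    using X pair_finite_verts by (rule finite_subset)
  show ?thesis
  proof unfold_locales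
    show "finite (parcs (torso G X))"
      using sub fin by (metis finite_subset finite_cartesian_product)
  qed (use sub fin in \<open>auto simp: torso_def symmetric_def sym_def dest: arcs_symmetric pair_no_loops\<close>)
qed

end

theory Submission
  imports Defs "HOL-Library.Z2" "HOL-Library.Nat_Bijection"
begin

text \<open>
  The graphs are Cai--Fuerer--Immerman graphs over \<open>F = K_{k+3,n}\<close> with \<open>n\<close> large.  Deleting \<open>k + 1\<close>
  vertices from the smaller side of \<open>F\<close> leaves the planar graph \<open>K_{2,n}\<close>, so \<open>F \<in> H_{k+1}\<close>, and \<open>F\<close>
  itself tells the two graphs apart.

  If \<open>K\<close> tells them apart, then linear algebra over \<open>\<int>/2\<close> yields a homomorphism \<open>K \<rightarrow> F\<close> together with
  a chain map from \<open>F\<close> to \<open>K\<close> which sends vertices and edges of \<open>F\<close> to chains over them, and vertices to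
  odd sets.  Deleting at most \<open>k\<close> vertices from \<open>F\<close> leaves a connected graph, hence at each adhesion set of
  a tree decomposition of adhesion at most \<open>k\<close> exactly one side is odd, and the chain map can be pushed into
  the torso of some bag.  Removing at most \<open>k\<close> apices leaves such a chain map from \<open>K_{3,n'}\<close> to a
  graph of Euler genus at most \<open>k\<close>.  By the pigeonhole principle in \<open>\<int>/2\<close>-homology, two of the \<open>n'\<close>
  vertices span with the other side a theta graph all of whose cycles bound.  A parity argument in the style of
  van Kampen, evaluated at the rotations around one branch vertex of the theta graph, shows that
  no third vertex can be joined to its three paths.
\<close>

text \<open>The certificate is weaker than a minor model: the fibres over vertices of
  \<open>F\<close> are odd sets that may be disconnected, and after the passage to a torso the
  chains may contain edges inside a fibre and share them. Of the \<open>k + 3\<close> vertices, up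
  to \<open>k\<close> can be lost to apices; the three that survive are the middle vertices of the
  theta graph. Its two branch vertices and the third vertex on the other side complete a K_{3,3},
  which is the planar obstruction behind the final parity argument. Coefficients in Z/2 treat
  orientable and non-orientable surfaces alike: Euler genus at most \<open>k\<close> leaves at most
  \<open>2 ^ k\<close> homology classes. Two 4-cycles per vertex must agree in homology at the same
  time, whence \<open>4 ^ k\<close>. Dimensions are handled as cardinalities of finite sets of
  functions into Z/2.\<close>

section \<open>Linear algebra over \<open>\<int>/2\<close>\<close>

text \<open>By default, the field operations of \<^typ>\<open>bit\<close> are rewritten to bit operations, which do not simplify
  by the ring laws.\<close>

declare add_bit_eq_xor [simp del] mult_bit_eq_and [simp del]

lemma bit_add_self [simp]: "a + a = (0::bit)" 
  by (cases a) auto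

lemma bit_add_self_left [simp]: "a + (a + b) = (b::bit)"
  by (simp flip: add.assoc)

lemma bit_add_eq_0_iff [simp]: "a + b = 0 \<longleftrightarrow> a = (b::bit)"
  by (cases a; cases b) auto

text \<open>Gaussian elimination, one column at a time. A pivot \<open>i0\<close> clears its column
  and turns row \<open>i0\<close> into a zero row, so the row set can stay the same throughout the
  induction.\<close>

lemma fredholm_alternative_bit:
  fixes M :: "'i \<Rightarrow> 'j \<Rightarrow> bit"
  assumes "finite I" "finite J"
  shows "(\<exists>x. \<forall>i\<in>I. (\<Sum>j\<in>J. M i j * x j) = c i) \<or>
         (\<exists>y. (\<forall>j\<in>J. (\<Sum>i\<in>I. y i * M i j) = 0) \<and> (\<Sum>i\<in>I. y i * c i) = 1)"
  using assms(2)
proof (induction J arbitrary: M c rule: finite_induct)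
  case empty
  show ?case
  proof (cases "\<forall>i\<in>I. c i = 0")
    case True
    then show ?thesis by simp
  next
    case False
    then obtain i0 where i0: "i0 \<in> I" "c i0 = 1" by auto
    have "(\<Sum>i\<in>I. of_bool (i = i0) * c i) = (\<Sum>i\<in>I. if i = i0 then c i0 else 0)"
      by (intro sum.cong) auto
    also have "\<dots> = 1" using i0 assms(1) by simp
    finally show ?thesis by auto
  qed
next
  case (insert j J)
  show ?case
  proof (cases "\<exists>i0\<in>I. M i0 j = 1")
    case False
    then have z: "M i j = 0" if "i \<in> I" for i using that by auto
    from insert.IH[of M c] show ?thesis
    proof (elim disjE exE conjE)
      fix x assume "\<forall>i\<in>I. (\<Sum>j\<in>J. M i j * x j) = c i"
      then have "\<forall>i\<in>I. (\<Sum>j\<in>insert j J. M i j * x j) = c i"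
        using insert.hyps z by simp
      then show ?thesis by blast
    next
      fix y assume "\<forall>j\<in>J. (\<Sum>i\<in>I. y i * M i j) = 0" "(\<Sum>i\<in>I. y i * c i) = 1"
      then show ?thesis using z by (intro disjI2 exI[of _ y]) auto
    qed
  next
    case True
    then obtain i0 where i0: "i0 \<in> I" "M i0 j = 1" by blast
    define M' where "M' i l = M i l + M i j * M i0 l" for i l
    define c' where "c' i = c i + M i j * c i0" for i
    from insert.IH[of M' c'] show ?thesis
    proof (elim disjE exE conjE)
      fix x assume x: "\<forall>i\<in>I. (\<Sum>l\<in>J. M' i l * x l) = c' i"
      define x' where "x' = x(j := c i0 + (\<Sum>l\<in>J. M i0 l * x l))"
      have "(\<Sum>l\<in>insert j J. M i l * x' l) = c i" if "i \<in> I" for i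
      proof -
        have "(\<Sum>l\<in>insert j J. M i l * x' l) = M i j * x' j + (\<Sum>l\<in>J. M i l * x l)"
          using insert.hyps by (auto simp: x'_def intro!: sum.cong)
        also have "(\<Sum>l\<in>J. M i l * x l) = (\<Sum>l\<in>J. M' i l * x l) + M i j * (\<Sum>l\<in>J. M i0 l * x l)"
          by (simp add: M'_def distrib_right sum.distrib sum_distrib_left mult.assoc)
        also have "(\<Sum>l\<in>J. M' i l * x l) = c' i" using x that by auto
        finally show ?thesis by (simp add: x'_def c'_def algebra_simps)
      qed
      then show ?thesis by blast
    next
      fix y assume y: "\<forall>l\<in>J. (\<Sum>i\<in>I. y i * M' i l) = 0" "(\<Sum>i\<in>I. y i * c' i) = 1"
      define q where "q = (\<Sum>i\<in>I. y i * M i j)"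
      \<comment> \<open>\<open>q\<close> is what the multipliers leave in the pivot column; adding
        it to the multiplier of the pivot row cancels it.\<close>
      define y' where "y' = y(i0 := y i0 + q)"
      have *: "(\<Sum>i\<in>I. y' i * d i) = (\<Sum>i\<in>I. y i * d i) + q * d i0" for d
        using i0(1) assms(1) by (simp add: y'_def sum.remove[of I i0] distrib_right add_ac)
      have "(\<Sum>i\<in>I. y' i * M i l) = 0" if "l \<in> J" for l
      proof -
        have "(\<Sum>i\<in>I. y i * M' i l) = (\<Sum>i\<in>I. y i * M i l) + q * M i0 l"
          by (simp add: M'_def q_def distrib_left sum.distrib sum_distrib_right mult.assoc)
        then show ?thesis using y(1) that by (simp add: *)
      qed
      moreover have "(\<Sum>i\<in>I. y' i * M i j) = 0"
        by (simp add: * i0 q_def[symmetric])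
      moreover have "(\<Sum>i\<in>I. y' i * c i) = 1"
      proof -
        have "(\<Sum>i\<in>I. y i * c' i) = (\<Sum>i\<in>I. y i * c i) + q * c i0"
          by (simp add: c'_def q_def distrib_left sum.distrib sum_distrib_right mult.assoc)
        then show ?thesis using y(2) by (simp add: *)
      qed
      ultimately show ?thesis by (intro disjI2 exI[of _ y']) auto
    qed
  qed
qed

text \<open>The handshake lemma: off-diagonal terms cancel in pairs. The parity arguments below use
  it to discard the edges inside a set over which a boundary is summed.\<close>

lemma sum_sym_bit_eq_0:
  fixes x :: "'a \<Rightarrow> 'a \<Rightarrow> bit"
  assumes "finite S" "\<And>a b. x a b = x b a" "\<And>a. x a a = 0"
  shows "(\<Sum>a\<in>S. \<Sum>b\<in>S. x a b) = 0"
  using assms(1)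
proof (induction S rule: finite_induct)
  case (insert c S)
  have "(\<Sum>a\<in>S. x a c) = (\<Sum>a\<in>S. x c a)" using assms(2) by auto
  with insert show ?case by (simp add: sum.distrib assms(3))
qed simp

lemma of_nat_bit: "(of_nat n :: bit) = of_bool (odd n)"
  by (induction n) auto

lemma sum_bit_eq_card: 
  "finite S \<Longrightarrow> (\<Sum>v\<in>S. f v) = (of_bool (odd (card {v\<in>S. f v = 1})) :: bit)"
proof -
  assume S: "finite S"
  have "(\<Sum>v\<in>S. f v) = (\<Sum>v\<in>S. if f v = 1 then 1 else 0)"
    by (intro sum.cong) auto
  also have "\<dots> = of_nat (card {v\<in>S. f v = 1})"
    using S by (simp add: sum.inter_filter[symmetric])
  finally show ?thesis by (simp add: of_nat_bit)
qed

lemma odd_card_sym_diff: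
  assumes "finite A" "finite B"
  shows "odd (card (sym_diff A B)) \<longleftrightarrow> odd (card A) \<noteq> odd (card B)"
proof -
  have "card A = card (A - B) + card (A \<inter> B)" "card B = card (B - A) + card (A \<inter> B)"
    using assms by (metis card_Int_Diff add.commute, metis card_Int_Diff add.commute inf_commute)
  moreover have "card (sym_diff A B) = card (A - B) + card (B - A)"
    using assms by (intro card_Un_disjoint) auto
  ultimately show ?thesis by auto
qed

lemma sum_mult_of_bool_filter:
  assumes "finite S" "\<And>d. d \<in> S \<Longrightarrow> P d \<longleftrightarrow> Q d"
  shows "(\<Sum>d\<in>S. g d * of_bool (P d)) = (\<Sum>d\<in>{d\<in>S. Q d}. g d :: bit)"
  unfolding sum.inter_filter[OF assms(1)] using assms(2) by (intro sum.cong) auto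

section \<open>Cai--Fuerer--Immerman graphs\<close>

definition nb :: "'a pair_pre_digraph \<Rightarrow> 'a \<Rightarrow> 'a set" where
  "nb F v = {w. (v, w) \<in> parcs F}"

text \<open>A vertex and a finite set of vertices are packed into one number, so that the
  constructed graphs again have vertices in \<open>nat\<close>.\<close>

definition base :: "nat \<Rightarrow> nat" where
  "base n = fst (prod_decode n)"

definition lab :: "nat \<Rightarrow> nat set" where
  "lab n = set_decode (snd (prod_decode n))"

definition mkv :: "nat \<Rightarrow> nat set \<Rightarrow> nat" where
  "mkv v S = prod_encode (v, set_encode S)"

lemma base_mkv [simp]: "base (mkv v S) = v"
  and lab_mkv [simp]: "finite S \<Longrightarrow> lab (mkv v S) = S"
  by (simp_all add: base_def lab_def mkv_def)

lemma mkv_base_lab [simp]: "mkv (base n) (lab n) = n"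
  by (simp add: base_def lab_def mkv_def)

lemma base_lab_eqI: "base m = base n \<Longrightarrow> lab m = lab n \<Longrightarrow> m = n"
  by (metis mkv_base_lab)

lemma finite_lab [simp]: "finite (lab n)"
  by (simp add: lab_def)

text \<open>The Cai--Fuerer--Immerman graph over \<open>F\<close>, twisted at the vertices in \<open>U\<close>.  A vertex consists of
  \<open>v \<in> V(F)\<close> and a set \<open>S\<close> of edges at \<open>v\<close>, given by their other ends, and is encoded as \<open>mkv v S\<close>.\<close>

definition cfi :: "nat pair_pre_digraph \<Rightarrow> nat set \<Rightarrow> nat pair_pre_digraph" where
  "cfi F U = (let V = {n. base n \<in> pverts F \<and> lab n \<subseteq> nb F (base n) \<and>
                            (odd (card (lab n)) \<longleftrightarrow> base n \<in> U)}
              in \<lparr> pverts = V, parcs = {(m, n). m \<in> V \<and> n \<in> V \<and> (base m, base n) \<in> parcs F \<and>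
                                            (base n \<in> lab m \<longleftrightarrow> base m \<in> lab n)} \<rparr>)"

lemma pverts_cfi: "n \<in> pverts (cfi F U) \<longleftrightarrow>
    base n \<in> pverts F \<and> lab n \<subseteq> nb F (base n) \<and> (odd (card (lab n)) \<longleftrightarrow> base n \<in> U)"
  by (simp add: cfi_def Let_def)

lemma parcs_cfi: "(m, n) \<in> parcs (cfi F U) \<longleftrightarrow>
    m \<in> pverts (cfi F U) \<and> n \<in> pverts (cfi F U) \<and> (base m, base n) \<in> parcs F \<and>
    (base n \<in> lab m \<longleftrightarrow> base m \<in> lab n)"
  by (simp add: cfi_def Let_def)

lemma (in pair_graph) nb_subset: "nb G v \<subseteq> pverts G"
  by (auto simp: nb_def in_arcsD2)

lemma (in pair_graph) finite_nb: "finite (nb G v)"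
  by (rule finite_subset[OF nb_subset pair_finite_verts])

lemma pair_graph_cfi:
  assumes "pair_graph F"
  shows "pair_graph (cfi F U)"
proof -
  interpret pair_graph F by fact
  have fin: "finite (pverts (cfi F U))"
  proof (rule finite_subset)
    show "pverts (cfi F U) \<subseteq> (\<lambda>(v, S). mkv v S) ` (pverts F \<times> Pow (pverts F))"
    proof
      fix n assume "n \<in> pverts (cfi F U)"
      then have "(base n, lab n) \<in> pverts F \<times> Pow (pverts F)"
        using nb_subset[of "base n"] by (auto simp: pverts_cfi)
      then show "n \<in> (\<lambda>(v, S). mkv v S) ` (pverts F \<times> Pow (pverts F))"
        by (intro image_eqI[where x = "(base n, lab n)"]) auto
    qed
  qed (simp add: pair_finite_verts)
  show ?thesis
  proof unfold_locales
    show "finite (parcs (cfi F U))"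
      by (rule finite_subset[of _ "pverts (cfi F U) \<times> pverts (cfi F U)"])
        (auto simp: parcs_cfi fin)
    show "fst e \<noteq> snd e" if "e \<in> parcs (cfi F U)" for e
      using that pair_no_loops[of "(base (fst e), base (snd e))"]
      by (cases e) (auto simp: parcs_cfi)
  qed (use fin in \<open>auto simp: parcs_cfi symmetric_def sym_def dest: arcs_symmetric\<close>)
qed

lemma (in pair_graph) sum_parcs:
  "(\<Sum>e\<in>parcs G. g e) = (\<Sum>a\<in>pverts G. \<Sum>b\<in>pverts G. if (a, b) \<in> parcs G then g (a, b) else (0::'c::comm_monoid_add))"
proof -
  have "(\<Sum>a\<in>pverts G. \<Sum>b\<in>pverts G. if (a, b) \<in> parcs G then g (a, b) else 0) =
      (\<Sum>e\<in>pverts G \<times> pverts G. if e \<in> parcs G then g e else 0)"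
    using pair_finite_verts by (auto simp: sum.cartesian_product intro!: sum.cong)
  also have "\<dots> = (\<Sum>e\<in>(pverts G \<times> pverts G) \<inter> parcs G. g e)"
    using pair_finite_verts by (simp add: sum.inter_restrict)
  also have "(pverts G \<times> pverts G) \<inter> parcs G = parcs G"
    by (auto simp: in_arcsD1 in_arcsD2)
  finally show ?thesis by simp
qed

text \<open>Over a fixed \<open>\<phi>\<close>, lifts are the solutions of a linear system over Z/2
  whose right-hand side is the twist \<open>U\<close>. This is what makes homomorphism counts
  accessible to linear algebra.\<close>

definition lifts :: "'a pair_pre_digraph \<Rightarrow> nat pair_pre_digraph \<Rightarrow> nat set \<Rightarrow> ('a \<Rightarrow> nat) \<Rightarrow> ('a \<Rightarrow> nat) set" where
  "lifts K F U \<phi> = {f \<in> homs K (cfi F U). \<forall>a\<in>pverts K. base (f a) = \<phi> a}"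

lemma finite_homs:
  assumes "pair_graph K" "pair_graph G"
  shows "finite (homs K G)"
proof -
  interpret K: pair_graph K by fact
  interpret G: pair_graph G by fact
  have "finite (pverts K \<rightarrow>\<^sub>E pverts G)"
    by (intro finite_PiE) (auto simp: K.pair_finite_verts G.pair_finite_verts)
  then show ?thesis
    by (rule finite_subset[rotated]) (auto simp: homs_def)
qed

lemma homs_mem: "pair_graph K \<Longrightarrow> f \<in> homs K G \<Longrightarrow> a \<in> pverts K \<Longrightarrow> f a \<in> pverts G"
  by (auto simp: homs_def PiE_def)

lemma homs_arc: "f \<in> homs K G \<Longrightarrow> (a, b) \<in> parcs K \<Longrightarrow> (f a, f b) \<in> parcs G"
  by (auto simp: homs_def)

lemma card_homs_cfi:
  assumes K: "pair_graph K" and F: "pair_graph F"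
  shows "card (homs K (cfi F U)) = (\<Sum>\<phi>\<in>homs K F. card (lifts K F U \<phi>))"
proof -
  interpret K: pair_graph K by fact
  have "homs K (cfi F U) = (\<Union>\<phi>\<in>homs K F. lifts K F U \<phi>)"
  proof (intro equalityI subsetI)
    fix f assume f: "f \<in> homs K (cfi F U)"
    define \<phi> where "\<phi> = restrict (base \<circ> f) (pverts K)"
    have "\<phi> \<in> homs K F"
      using homs_mem[OF K f] homs_arc[OF f] 
      by (auto simp: homs_def \<phi>_def pverts_cfi parcs_cfi K.in_arcsD1 K.in_arcsD2)
    moreover have "f \<in> lifts K F U \<phi>"
      using f by (simp add: lifts_def \<phi>_def)
    ultimately show "f \<in> (\<Union>\<phi>\<in>homs K F. lifts K F U \<phi>)" by blast
  qed (auto simp: lifts_def)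
  also have "card \<dots> = (\<Sum>\<phi>\<in>homs K F. card (lifts K F U \<phi>))"
  proof (rule card_UN_disjoint)
    show "finite (homs K F)" by (rule finite_homs[OF K F])
    show "\<forall>\<phi>\<in>homs K F. finite (lifts K F U \<phi>)"
      using finite_homs[OF K pair_graph_cfi[OF F]] by (auto simp: lifts_def)
    show "\<forall>\<phi>\<in>homs K F. \<forall>\<psi>\<in>homs K F. \<phi> \<noteq> \<psi> \<longrightarrow> lifts K F U \<phi> \<inter> lifts K F U \<psi> = {}"
    proof (intro ballI impI equals0I)
      fix \<phi> \<psi> f assume *: "\<phi> \<in> homs K F" "\<psi> \<in> homs K F" "\<phi> \<noteq> \<psi>" "f \<in> lifts K F U \<phi> \<inter> lifts K F U \<psi>"
      have "\<phi> = \<psi>"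
        by (rule PiE_ext[of _ "pverts K" "\<lambda>_. pverts F" ]) (use * in \<open>auto simp: homs_def lifts_def\<close>)
      with * show False by simp
    qed
  qed
  finally show ?thesis .
qed

lemma lifts_iff:
  assumes K: "pair_graph K" and \<phi>: "\<phi> \<in> homs K F"
  shows "f \<in> lifts K F U \<phi> \<longleftrightarrow> f \<in> extensional (pverts K) \<and>
    (\<forall>a\<in>pverts K. base (f a) = \<phi> a \<and> lab (f a) \<subseteq> nb F (\<phi> a) \<and> (odd (card (lab (f a))) \<longleftrightarrow> \<phi> a \<in> U)) \<and>
    (\<forall>(a, b)\<in>parcs K. \<phi> b \<in> lab (f a) \<longleftrightarrow> \<phi> a \<in> lab (f b))" (is "?L \<longleftrightarrow> ?R")
proof
  interpret K: pair_graph K by fact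
  assume ?L
  then have f: "f \<in> homs K (cfi F U)" and b: "\<And>a. a \<in> pverts K \<Longrightarrow> base (f a) = \<phi> a"
    by (auto simp: lifts_def)
  have "f a \<in> pverts (cfi F U)" if "a \<in> pverts K" for a
    using homs_mem[OF K f that] .
  moreover have "(f a, f b) \<in> parcs (cfi F U)" if "(a, b) \<in> parcs K" for a b
    using homs_arc[OF f that] .
  moreover have "f \<in> extensional (pverts K)" using f by (auto simp: homs_def PiE_def)
  ultimately show ?R using b by (fastforce simp: pverts_cfi parcs_cfi K.in_arcsD1 K.in_arcsD2)
next
  interpret K: pair_graph K by fact
  assume R: ?R
  have v: "f a \<in> pverts (cfi F U)" if "a \<in> pverts K" for a
    using R that homs_mem[OF K \<phi> that] by (auto simp: pverts_cfi)
  have "(f a, f b) \<in> parcs (cfi F U)" if "(a, b) \<in> parcs K" for a b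
    using R that homs_arc[OF \<phi> that] v K.in_arcsD1[OF that] K.in_arcsD2[OF that] by (auto simp: parcs_cfi)
  with v R show ?L by (auto simp: lifts_def homs_def PiE_def)
qed

text \<open>Adding a fixed solution \<open>f1\<close>, that is, taking symmetric differences of
  labels, is injective and adds the right-hand sides.\<close>

lemma card_lifts_shift:
  assumes K: "pair_graph K" and F: "pair_graph F" and \<phi>: "\<phi> \<in> homs K F" and f1: "f1 \<in> lifts K F W \<phi>"
  shows "card (lifts K F U \<phi>) \<le> card (lifts K F (sym_diff U W) \<phi>)"
proof -
  interpret K: pair_graph K by fact
  define sh where "sh f = restrict (\<lambda>a. mkv (\<phi> a) (sym_diff (lab (f a)) (lab (f1 a)))) (pverts K)" for f
  have "inj_on sh (lifts K F U \<phi>)"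
  proof (rule inj_onI)
    fix f g assume fg: "f \<in> lifts K F U \<phi>" "g \<in> lifts K F U \<phi>" "sh f = sh g"
    have "f a = g a" if a: "a \<in> pverts K" for a
    proof (rule base_lab_eqI)
      show "base (f a) = base (g a)" using fg a by (auto simp: lifts_def)
      have "lab (sh f a) = lab (sh g a)" using fg by simp
      then show "lab (f a) = lab (g a)" using a by (auto simp: sh_def)
    qed
    then show "f = g"
      using fg by (auto simp: lifts_iff[OF K \<phi>] intro: extensionalityI[of _ "pverts K"])
  qed
  moreover have "sh ` lifts K F U \<phi> \<subseteq> lifts K F (sym_diff U W) \<phi>"
  proof
    fix g assume "g \<in> sh ` lifts K F U \<phi>"
    then obtain f where f: "f \<in> lifts K F U \<phi>" and g: "g = sh f" by blast
    have "lab (sh f a) = sym_diff (lab (f a)) (lab (f1 a))" if "a \<in> pverts K" for a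
      using that by (simp add: sh_def)
    moreover have "base (sh f a) = \<phi> a" if "a \<in> pverts K" for a
      using that by (simp add: sh_def)
    moreover have "sh f \<in> extensional (pverts K)" by (simp add: sh_def)
    moreover have "sym_diff (lab (f a)) (lab (f1 a)) \<subseteq> nb F (\<phi> a) \<and>
        (odd (card (sym_diff (lab (f a)) (lab (f1 a)))) \<longleftrightarrow> \<phi> a \<in> sym_diff U W)" if "a \<in> pverts K" for a
      using f f1 that unfolding lifts_iff[OF K \<phi>] by (subst odd_card_sym_diff) auto
    moreover have "\<phi> b \<in> sym_diff (lab (f a)) (lab (f1 a)) \<longleftrightarrow> \<phi> a \<in> sym_diff (lab (f b)) (lab (f1 b))"
      if "(a, b) \<in> parcs K" for a b
      using f f1 that unfolding lifts_iff[OF K \<phi>] by blast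
    ultimately show "g \<in> lifts K F (sym_diff U W) \<phi>"
      unfolding g lifts_iff[OF K \<phi>] by (auto simp: K.in_arcsD1 K.in_arcsD2)
  qed
  moreover have "finite (lifts K F (sym_diff U W) \<phi>)"
    using finite_homs[OF K pair_graph_cfi[OF F]] by (auto simp: lifts_def)
  ultimately show ?thesis by (metis card_image card_mono)
qed

text \<open>Shifting by a lift for \<open>U\<close> maps lifts for \<open>U\<close> to untwisted
  ones and conversely: a solvable inhomogeneous system has as many solutions as the homogeneous
  one.\<close>

lemma card_lifts_eq:
  assumes "pair_graph K" "pair_graph F" "\<phi> \<in> homs K F" "lifts K F U \<phi> \<noteq> {}"
  shows "card (lifts K F U \<phi>) = card (lifts K F {} \<phi>)"
proof -
  obtain f1 where "f1 \<in> lifts K F U \<phi>" using assms by blast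
  from card_lifts_shift[OF assms(1-3) this, of U] card_lifts_shift[OF assms(1-3) this, of "{}"]
  show ?thesis by simp
qed

lemma finite_lifts:
  assumes "pair_graph K" "pair_graph F"
  shows "finite (lifts K F U \<phi>)"
  using finite_homs[OF assms(1) pair_graph_cfi[OF assms(2)]] by (auto simp: lifts_def)

text \<open>By \<open>card_lifts_eq\<close> no \<open>\<phi>\<close> has more twisted than untwisted
  lifts. The identity has the untwisted lift with empty labels, but a twisted one would be a
  subgraph of \<open>F\<close> with \<open>v0\<close> as its only vertex of odd degree.\<close>

lemma card_homs_cfi_self_less:
  assumes F: "pair_graph F" and v0: "v0 \<in> pverts F"
  shows "card (homs F (cfi F {v0})) < card (homs F (cfi F {}))"
  unfolding card_homs_cfi[OF F F]
proof (rule sum_strict_mono_ex1)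
  interpret pair_graph F by fact
  define i where "i = restrict id (pverts F)"
  have i: "i \<in> homs F F" by (auto simp: homs_def i_def in_arcsD1 in_arcsD2)
  have ia: "i a = a" if "a \<in> pverts F" for a using that by (simp add: i_def)
  show "finite (homs F F)" by (rule finite_homs[OF F F])
  show "\<forall>\<phi>\<in>homs F F. card (lifts F F {v0} \<phi>) \<le> card (lifts F F {} \<phi>)"
  proof
    fix \<phi> assume "\<phi> \<in> homs F F"
    then show "card (lifts F F {v0} \<phi>) \<le> card (lifts F F {} \<phi>)"
      using card_lifts_eq[OF F F, of \<phi> "{v0}"] by (cases "lifts F F {v0} \<phi> = {}") auto
  qed
  have "restrict (\<lambda>a. mkv a {}) (pverts F) \<in> lifts F F {} i"
    by (auto simp: lifts_iff[OF F i] ia in_arcsD1 in_arcsD2)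
  then have "card (lifts F F {} i) > 0"
    using finite_lifts[OF F F] by (auto simp: card_gt_0_iff)
  moreover have "lifts F F {v0} i = {}"
  proof (rule equals0I)
    fix f assume "f \<in> lifts F F {v0} i"
    then have f: "\<And>a. a \<in> pverts F \<Longrightarrow> lab (f a) \<subseteq> nb F a \<and> (odd (card (lab (f a))) \<longleftrightarrow> a = v0)"
      "\<And>a b. (a, b) \<in> parcs F \<Longrightarrow> b \<in> lab (f a) \<longleftrightarrow> a \<in> lab (f b)"
      by (auto simp: lifts_iff[OF F i] ia in_arcsD1 in_arcsD2)
    define x :: "nat \<Rightarrow> nat \<Rightarrow> bit" where "x a b = of_bool ((a, b) \<in> parcs F \<and> b \<in> lab (f a))" for a b
    have sym: "x a b = x b a" for a b
      using f(2) arcs_symmetric by (auto simp: x_def)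
    have diag: "x a a = 0" for a
      using pair_no_loops[of "(a, a)"] by (auto simp: x_def)
    have "(\<Sum>b\<in>pverts F. x a b) = of_bool (a = v0)" if a: "a \<in> pverts F" for a
    proof -
      have "{b \<in> pverts F. x a b = 1} = lab (f a)"
        using f(1)[OF a] nb_subset[of a] by (auto simp: x_def nb_def)
      then show ?thesis using f(1)[OF a] by (simp add: sum_bit_eq_card[OF pair_finite_verts])
    qed
    then have "(\<Sum>a\<in>pverts F. \<Sum>b\<in>pverts F. x a b) = 1"
      using v0 pair_finite_verts by (simp add: of_bool_def)
    moreover have "(\<Sum>a\<in>pverts F. \<Sum>b\<in>pverts F. x a b) = 0"
      by (intro sum_sym_bit_eq_0 sym diag pair_finite_verts)
    ultimately show False by simp
  qed
  ultimately show "\<exists>\<phi>\<in>homs F F. card (lifts F F {v0} \<phi>) < card (lifts F F {} \<phi>)" by (intro bexI[OF _ i]) simp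
qed


text \<open>If the counts differ, then by \<open>card_lifts_eq\<close> some \<open>\<phi>\<close>
  has no twisted lift at all. In the unsolvable system the unknown \<open>x (a, v)\<close> says
  whether \<open>v\<close> is in the label of \<open>a\<close>; there is an equation for each vertex
  and each arc of \<open>K\<close>. Fredholm multipliers \<open>y\<close> of the vertex equations
  and \<open>z\<close> of the edge equations are the dual object: the column of
  \<open>(a, v)\<close> says that the edges from \<open>a\<close> into the fibre over
  \<open>v\<close> have boundary \<open>y a\<close> at \<open>a\<close>.\<close>

theorem cfi_certificate:
  assumes K: "pair_graph K" and F: "pair_graph F"
    and neq: "card (homs K (cfi F {v0})) \<noteq> card (homs K (cfi F {}))"
  obtains \<phi> y z where "\<phi> \<in> homs K F" "\<And>a b. z a b = z b a" "\<And>a b. z a b \<noteq> 0 \<Longrightarrow> (a, b) \<in> parcs K"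
    "\<And>a v. a \<in> pverts K \<Longrightarrow> (\<phi> a, v) \<in> parcs F \<Longrightarrow> (\<Sum>b\<in>{b\<in>pverts K. \<phi> b = v}. z a b) = (y a :: bit)"
    "(\<Sum>a\<in>{a\<in>pverts K. \<phi> a = v0}. y a) = 1"
proof -
  interpret K: pair_graph K by fact
  interpret F: pair_graph F by fact
  note fin [simp] = K.pair_finite_verts K.pair_finite_arcs
  from neq obtain \<phi> where \<phi>: "\<phi> \<in> homs K F" and "card (lifts K F {v0} \<phi>) \<noteq> card (lifts K F {} \<phi>)"
    unfolding card_homs_cfi[OF K F] by (meson sum.cong)
  then have no: "lifts K F {v0} \<phi> = {}"
    using card_lifts_eq[OF K F \<phi>] by blast
  define I where "I = pverts K <+> parcs K"
  define J where "J = (SIGMA a:pverts K. nb F (\<phi> a))"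
  define M :: "'a + 'a \<times> 'a \<Rightarrow> 'a \<times> nat \<Rightarrow> bit" where
    "M i j = (case i of Inl a \<Rightarrow> of_bool (fst j = a)
       | Inr e \<Rightarrow> of_bool (j = (fst e, \<phi> (snd e))) + of_bool (j = (snd e, \<phi> (fst e))))" for i j
  define c :: "'a + 'a \<times> 'a \<Rightarrow> bit" where "c i = (case i of Inl a \<Rightarrow> of_bool (\<phi> a = v0) | Inr e \<Rightarrow> 0)" for i
  have finI: "finite I" by (simp add: I_def)
  have finJ: "finite J" using F.finite_nb by (simp add: J_def)
  have J_arc: "(a, \<phi> b) \<in> J" "(b, \<phi> a) \<in> J" if "(a, b) \<in> parcs K" for a b
    using that homs_arc[OF \<phi> that] K.in_arcsD1[OF that] K.in_arcsD2[OF that] F.arcs_symmetric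
    by (auto simp: J_def nb_def)
  have pick: "(\<Sum>j\<in>J. of_bool (j = j0) * x j) = x j0" if "j0 \<in> J" for j0 and x :: "_ \<Rightarrow> bit"
  proof -
    have "(\<Sum>j\<in>J. of_bool (j = j0) * x j) = (\<Sum>j\<in>J. if j = j0 then x j0 else 0)"
      by (intro sum.cong) auto
    then show ?thesis using that finJ by simp
  qed
  from fredholm_alternative_bit[OF finI finJ, of M c]
  show ?thesis
  proof (elim disjE exE conjE)
    fix x assume x: "\<forall>i\<in>I. (\<Sum>j\<in>J. M i j * x j) = c i"
    define f where "f = restrict (\<lambda>a. mkv (\<phi> a) {v \<in> nb F (\<phi> a). x (a, v) = 1}) (pverts K)"
    have lab: "lab (f a) = {v \<in> nb F (\<phi> a). x (a, v) = 1}" if "a \<in> pverts K" for a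
      using that F.finite_nb by (simp add: f_def)
    have "odd (card (lab (f a))) \<longleftrightarrow> \<phi> a \<in> {v0}" if a: "a \<in> pverts K" for a
    proof -
      have "(\<Sum>j\<in>J. M (Inl a) j * x j) = (\<Sum>(b, v)\<in>J. of_bool (b = a) * x (b, v))"
        by (intro sum.cong) (auto simp: M_def)
      also have "\<dots> = (\<Sum>b\<in>pverts K. \<Sum>v\<in>nb F (\<phi> b). of_bool (b = a) * x (b, v))"
        unfolding J_def using F.finite_nb by (subst sum.Sigma) auto
      also have "\<dots> = (\<Sum>b\<in>pverts K. if b = a then \<Sum>v\<in>nb F (\<phi> a). x (a, v) else 0)"
        by (intro sum.cong) auto
      also have "\<dots> = (\<Sum>v\<in>nb F (\<phi> a). x (a, v))" using a by simp
      also have "\<dots> = of_bool (odd (card (lab (f a))))"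
        by (simp add: lab[OF a] sum_bit_eq_card[OF F.finite_nb])
      finally show ?thesis using x a by (auto simp: I_def c_def Plus_def)
    qed
    moreover have "\<phi> b \<in> lab (f a) \<longleftrightarrow> \<phi> a \<in> lab (f b)" if ab: "(a, b) \<in> parcs K" for a b
    proof -
      have "Inr (a, b) \<in> I" using ab by (auto simp: I_def)
      then have "0 = (\<Sum>j\<in>J. M (Inr (a, b)) j * x j)" using x by (simp add: c_def)
      also have "\<dots> = x (a, \<phi> b) + x (b, \<phi> a)"
        using pick[OF J_arc(1)[OF ab]] pick[OF J_arc(2)[OF ab]]
        by (simp add: M_def distrib_right sum.distrib)
      finally have "x (a, \<phi> b) = x (b, \<phi> a)" by (metis bit_add_eq_0_iff)
      then show ?thesis
        using J_arc[OF ab] by (auto simp: lab K.in_arcsD1[OF ab] K.in_arcsD2[OF ab] J_def)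
    qed
    moreover have "f \<in> extensional (pverts K)" by (simp add: f_def)
    moreover have "base (f a) = \<phi> a" "lab (f a) \<subseteq> nb F (\<phi> a)" if "a \<in> pverts K" for a
      using that by (auto simp: lab) (simp add: f_def)
    ultimately have "f \<in> lifts K F {v0} \<phi>" by (auto simp: lifts_iff[OF K \<phi>])
    with no show ?thesis by blast
  next
    fix Y assume Y: "\<forall>j\<in>J. (\<Sum>i\<in>I. Y i * M i j) = 0" "(\<Sum>i\<in>I. Y i * c i) = 1"
    define y where "y a = Y (Inl a)" for a
    define w where "w a b = (if (a, b) \<in> parcs K then Y (Inr (a, b)) else 0)" for a b
    \<comment> \<open>Both arcs of an edge give the same equation, so the multiplier of the edge is
      the sum of the two.\<close>
    define z where "z a b = w a b + w b a" for a b
    have sumI: "(\<Sum>i\<in>I. g i) = (\<Sum>a\<in>pverts K. g (Inl a)) + (\<Sum>e\<in>parcs K. g (Inr e))" for g :: "_ \<Rightarrow> bit"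
      unfolding I_def by (simp add: sum.Plus comp_def)
    have "(\<Sum>b\<in>{b\<in>pverts K. \<phi> b = v}. z a b) = y a"
      if a: "a \<in> pverts K" and v: "(\<phi> a, v) \<in> parcs F" for a v
    proof -
      have "0 = (\<Sum>i\<in>I. Y i * M i (a, v))" using Y(1) a v by (auto simp: J_def nb_def)
      also have "\<dots> = (\<Sum>b\<in>pverts K. Y (Inl b) * of_bool (a = b)) +
          (\<Sum>e\<in>parcs K. Y (Inr e) * of_bool ((a, v) = (fst e, \<phi> (snd e)))) +
          (\<Sum>e\<in>parcs K. Y (Inr e) * of_bool ((a, v) = (snd e, \<phi> (fst e))))"
        unfolding sumI by (simp add: M_def distrib_left sum.distrib add.assoc)
      also have "(\<Sum>b\<in>pverts K. Y (Inl b) * of_bool (a = b)) = (\<Sum>b\<in>pverts K. if a = b then y a else 0)"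
        by (intro sum.cong) (auto simp: y_def)
      also have "\<dots> = y a" using a by simp
      also have "(\<Sum>e\<in>parcs K. Y (Inr e) * of_bool ((a, v) = (fst e, \<phi> (snd e)))) =
          (\<Sum>c\<in>pverts K. \<Sum>d\<in>pverts K. w c d * of_bool ((a, v) = (c, \<phi> d)))"
        unfolding K.sum_parcs by (intro sum.cong) (auto simp: w_def)
      also have "\<dots> = (\<Sum>c\<in>pverts K. if c = a then \<Sum>d\<in>pverts K. w a d * of_bool (v = \<phi> d) else 0)"
        by (intro sum.cong) auto
      also have "\<dots> = (\<Sum>d\<in>{d\<in>pverts K. \<phi> d = v}. w a d)"
        using a by (simp del: sum_mult_of_bool_eq) (rule sum_mult_of_bool_filter, auto)
      also have "(\<Sum>e\<in>parcs K. Y (Inr e) * of_bool ((a, v) = (snd e, \<phi> (fst e)))) =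
          (\<Sum>c\<in>pverts K. \<Sum>d\<in>pverts K. w c d * of_bool ((a, v) = (d, \<phi> c)))"
        unfolding K.sum_parcs by (intro sum.cong) (auto simp: w_def)
      also have "\<dots> = (\<Sum>c\<in>pverts K. w c a * of_bool (v = \<phi> c))"
      proof (intro sum.cong refl)
        fix c
        have "(\<Sum>d\<in>pverts K. w c d * of_bool ((a, v) = (d, \<phi> c))) =
            (\<Sum>d\<in>pverts K. if d = a then w c a * of_bool (v = \<phi> c) else 0)"
          by (intro sum.cong) auto
        then show "(\<Sum>d\<in>pverts K. w c d * of_bool ((a, v) = (d, \<phi> c))) = w c a * of_bool (v = \<phi> c)"
          using a by simp
      qed
      also have "\<dots> = (\<Sum>d\<in>{d\<in>pverts K. \<phi> d = v}. w d a)"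
        by (rule sum_mult_of_bool_filter) auto
      finally have "y a + (\<Sum>d\<in>{d\<in>pverts K. \<phi> d = v}. z a d) = 0"
        by (simp add: z_def sum.distrib add.assoc)
      then show ?thesis by simp
    qed
    moreover have "(\<Sum>a\<in>{a\<in>pverts K. \<phi> a = v0}. y a) = 1"
    proof -
      have "1 = (\<Sum>a\<in>pverts K. y a * of_bool (\<phi> a = v0))"
        using Y(2) by (simp add: sumI c_def y_def)
      also have "\<dots> = (\<Sum>a\<in>{a\<in>pverts K. \<phi> a = v0}. y a)"
        by (rule sum_mult_of_bool_filter) auto
      finally show ?thesis by simp
    qed
    moreover have "z a b = z b a" for a b by (simp add: z_def add.commute)
    moreover have "(a, b) \<in> parcs K" if "z a b \<noteq> 0" for a b
      using that K.arcs_symmetric by (auto simp: z_def w_def split: if_splits)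
    ultimately show ?thesis using that[OF \<phi>] by blast
  qed
qed

section \<open>Components and torsos\<close>

lemma (in pair_graph) reachable_iff_rtrancl:
  assumes "a \<in> pverts G"
  shows "a \<rightarrow>\<^sup>*\<^bsub>with_proj G\<^esub> b \<longleftrightarrow> (a, b) \<in> (parcs G)\<^sup>*"
proof
  assume "a \<rightarrow>\<^sup>*\<^bsub>with_proj G\<^esub> b"
  then show "(a, b) \<in> (parcs G)\<^sup>*"
    by (auto simp: reachable_def dest: rtrancl_on_rtranclI)
next
  assume r: "(a, b) \<in> (parcs G)\<^sup>*"
  then have "b \<in> pverts G"
    using assms by (induction rule: rtrancl_induct) (auto simp: in_arcsD2)
  with r assms show "a \<rightarrow>\<^sup>*\<^bsub>with_proj G\<^esub> b"
    by (auto simp: reachable_def in_arcsD2 intro!: rtrancl_consistent_rtrancl_on)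
qed

lemma (in pair_graph) rtrancl_in_verts: "(a, b) \<in> (parcs G)\<^sup>* \<Longrightarrow> a \<in> pverts G \<Longrightarrow> b \<in> pverts G"
  by (induction rule: rtrancl_induct) (auto simp: in_arcsD2)

lemma (in pair_graph) sym_rtrancl_parcs: "(a, b) \<in> (parcs G)\<^sup>* \<Longrightarrow> (b, a) \<in> (parcs G)\<^sup>*"
  using arcs_symmetric by (meson sym_def sym_rtrancl)

lemma connected_iff_rtrancl:
  assumes "pair_graph G"
  shows "connected (with_proj G) \<longleftrightarrow> pverts G \<noteq> {} \<and> (\<forall>a\<in>pverts G. \<forall>b\<in>pverts G. (a, b) \<in> (parcs G)\<^sup>*)"
proof -
  interpret pair_graph G by fact
  have "parcs (mk_symmetric (with_proj G)) = parcs G"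
    using arcs_symmetric by (force simp: parcs_mk_symmetric)
  then have "mk_symmetric (with_proj G) = G"
    by (intro pair_pre_digraph.equality) auto
  then show ?thesis
    by (auto simp: connected_def strongly_connected_def reachable_iff_rtrancl)
qed

lemma comps_eq:
  assumes "pair_graph G"
  shows "comps G = (\<lambda>u. {v. (u, v) \<in> (parcs G)\<^sup>*}) ` pverts G"
proof -
  interpret pair_graph G by fact
  have "S \<in> comps G \<longleftrightarrow> S \<in> (\<lambda>u. {v. (u, v) \<in> (parcs G)\<^sup>*}) ` pverts G" for S
  proof
    assume S: "S \<in> comps G"
    then have "S \<subseteq> pverts G" by (rule in_comps_subset)
    with S obtain u where u: "u \<in> S" "u \<in> pverts G"
      unfolding comps_def pre_digraph.sccs_verts_def by auto
    have "S = {v. (u, v) \<in> (parcs G)\<^sup>*}"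
    proof (intro equalityI subsetI)
      fix v assume v: "v \<in> S"
      with S u have "u \<rightarrow>\<^sup>*\<^bsub>with_proj G\<^esub> v"
        unfolding comps_def pre_digraph.sccs_verts_def by auto
      with u show "v \<in> {v. (u, v) \<in> (parcs G)\<^sup>*}" by (simp add: reachable_iff_rtrancl)
    next
      fix v assume "v \<in> {v. (u, v) \<in> (parcs G)\<^sup>*}"
      then have r: "(u, v) \<in> (parcs G)\<^sup>*" by simp
      then have "u \<rightarrow>\<^sup>*\<^bsub>with_proj G\<^esub> v" "v \<rightarrow>\<^sup>*\<^bsub>with_proj G\<^esub> u"
        using u rtrancl_in_verts[OF r] sym_rtrancl_parcs[OF r] by (auto simp: reachable_iff_rtrancl)
      with S u show "v \<in> S"
        unfolding comps_def pre_digraph.sccs_verts_def by blast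
    qed
    with u show "S \<in> (\<lambda>u. {v. (u, v) \<in> (parcs G)\<^sup>*}) ` pverts G" by blast
  next
    assume "S \<in> (\<lambda>u. {v. (u, v) \<in> (parcs G)\<^sup>*}) ` pverts G"
    then obtain u where u: "u \<in> pverts G" and S: "S = {v. (u, v) \<in> (parcs G)\<^sup>*}" by blast
    have sub: "S \<subseteq> pverts G" using u S rtrancl_in_verts by auto
    have "a \<rightarrow>\<^sup>*\<^bsub>with_proj G\<^esub> b" if "a \<in> S" "b \<in> S" for a b
      using that sub sym_rtrancl_parcs rtrancl_trans[of a u "parcs G" b] unfolding S
      by (subst reachable_iff_rtrancl) auto
    moreover have "\<not> a \<rightarrow>\<^sup>*\<^bsub>with_proj G\<^esub> b" if "a \<in> S" "b \<notin> S" for a b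
      using that sub rtrancl_trans[of u a "parcs G" b] unfolding S
      by (subst reachable_iff_rtrancl) auto
    moreover have "u \<in> S" by (simp add: S)
    ultimately show "S \<in> comps G"
      unfolding comps_def pre_digraph.sccs_verts_def by auto
  qed
  then show ?thesis by blast
qed

lemma comps_disjoint:
  assumes "pair_graph G" "C \<in> comps G" "D \<in> comps G" "C \<noteq> D"
  shows "C \<inter> D = {}"
proof -
  interpret pair_graph G by fact
  show ?thesis
  proof (rule ccontr)
    assume "C \<inter> D \<noteq> {}"
    then obtain x where x: "x \<in> C" "x \<in> D" by blast
    have "E = {v. (x, v) \<in> (parcs G)\<^sup>*}" if "E \<in> comps G" "x \<in> E" for E
      using that sym_rtrancl_parcs unfolding comps_eq[OF assms(1)] 
      by (auto intro: rtrancl_trans)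
    with x assms show False by metis
  qed
qed

lemma Union_comps:
  assumes "pair_graph G"
  shows "\<Union>(comps G) = pverts G"
proof -
  interpret pair_graph G by fact
  show ?thesis unfolding comps_eq[OF assms] using rtrancl_in_verts by auto
qed

lemma pverts_pair_induce [simp]: "pverts (pair_induce G X) = X"
  and parcs_pair_induce: "parcs (pair_induce G X) = parcs G \<inter> X \<times> X"
  by (auto simp: pair_induce_def)

lemma finite_comps: "pair_graph G \<Longrightarrow> finite (comps G)"
  using pair_graph.axioms(1)[of G] by (simp add: comps_eq pair_digraph_def pair_fin_digraph_def pair_fin_digraph_axioms_def)

lemma parcs_torso:
  "(a, b) \<in> parcs (torso G X) \<longleftrightarrow> a \<in> X \<and> b \<in> X \<and> (a, b) \<in> parcs G \<or>
     a \<noteq> b \<and> (\<exists>C\<in>comps (pair_induce G (pverts G - X)). a \<in> nbhd G C \<and> b \<in> nbhd G C)"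
  and pverts_torso [simp]: "pverts (torso G X) = X"
  by (auto simp: torso_def)

section \<open>Chain representations of complete bipartite graphs\<close>

text \<open>A \<open>\<int>/2\<close>-chain representation of the complete bipartite graph on \<open>A \<union> B\<close> in \<open>L\<close>: a vertex \<open>v\<close>
  is represented by the odd set of vertices \<open>a\<close> of the fibre of \<open>\<phi>\<close> over \<open>v\<close> with \<open>y a = 1\<close>, and
  an edge \<open>uv\<close> by the edge set \<open>s u v\<close> within the union of the fibres, whose boundary is the sum of
  the chains representing \<open>u\<close> and \<open>v\<close>.\<close>

definition chain_rep :: "'v set \<Rightarrow> 'v set \<Rightarrow> 'a pair_pre_digraph \<Rightarrow> ('a \<Rightarrow> 'v) \<Rightarrow> ('a \<Rightarrow> bit) \<Rightarrow>
    ('v \<Rightarrow> 'v \<Rightarrow> 'a \<Rightarrow> 'a \<Rightarrow> bit) \<Rightarrow> bool" where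
  "chain_rep A B L \<phi> y s \<longleftrightarrow>
    (\<forall>u\<in>A. \<forall>v\<in>B. (\<forall>a b. s u v a b = s u v b a) \<and>
      (\<forall>a b. s u v a b \<noteq> 0 \<longrightarrow> (a, b) \<in> parcs L \<and> \<phi> a \<in> {u, v} \<and> \<phi> b \<in> {u, v}) \<and>
      (\<forall>a\<in>pverts L. \<phi> a \<in> {u, v} \<longrightarrow> (\<Sum>b\<in>pverts L. s u v a b) = y a)) \<and>
    (\<forall>v\<in>A \<union> B. (\<Sum>a\<in>{a\<in>pverts L. \<phi> a = v}. y a) = 1)"

lemma chain_repD:
  assumes "chain_rep A B L \<phi> y s"
  shows "u \<in> A \<Longrightarrow> v \<in> B \<Longrightarrow> s u v a b = s u v b a"
    and "u \<in> A \<Longrightarrow> v \<in> B \<Longrightarrow> s u v a b = 1 \<Longrightarrow> (a, b) \<in> parcs L \<and> \<phi> a \<in> {u, v} \<and> \<phi> b \<in> {u, v}"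
    and "u \<in> A \<Longrightarrow> v \<in> B \<Longrightarrow> a \<in> pverts L \<Longrightarrow> \<phi> a \<in> {u, v} \<Longrightarrow> (\<Sum>b\<in>pverts L. s u v a b) = y a"
    and "v \<in> A \<union> B \<Longrightarrow> (\<Sum>a\<in>{a\<in>pverts L. \<phi> a = v}. y a) = 1"
  using assms unfolding chain_rep_def by (blast, metis bit.distinct(2), blast, blast)

text \<open>A chain with prescribed boundary \<open>d\<close> in a clique: the star from any \<open>m \<in> M\<close> to the support of \<open>d\<close>.\<close>

lemma clique_chain:
  fixes d :: "'a \<Rightarrow> bit"
  assumes "finite M" "(\<Sum>a\<in>M. d a) = 0"
  obtains t where "\<And>a b. t a b = t b a" "\<And>a b. t a b = 1 \<Longrightarrow> a \<in> M \<and> b \<in> M \<and> a \<noteq> b"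
    "\<And>a. a \<in> M \<Longrightarrow> (\<Sum>b\<in>M. t a b) = d a"
proof (cases "M = {}")
  case True
  then show ?thesis using that[of "\<lambda>_ _. 0"] by auto
next
  case False
  then obtain m where m: "m \<in> M" by blast
  define t where "t a b = (if a \<in> M \<and> b \<in> M \<and> a \<noteq> b then
    (if a = m then d b else if b = m then d a else 0) else 0)" for a b
  show ?thesis
  proof (rule that[of t])
    show "(\<Sum>b\<in>M. t a b) = d a" if a: "a \<in> M" for a
    proof (cases "a = m")
      case True
      have "(\<Sum>b\<in>M. t a b) = (\<Sum>b\<in>M - {m}. d b)"
        using True m assms(1) by (intro sum.mono_neutral_cong_right) (auto simp: t_def)
      then show ?thesis using assms m True by (simp add: sum.remove)
    next
      case False
      have "(\<Sum>b\<in>M. t a b) = (\<Sum>b\<in>M. if b = m then d a else 0)"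
        using a m False by (intro sum.cong) (auto simp: t_def)
      then show ?thesis using m assms(1) by simp
    qed
  qed (auto simp: t_def split: if_splits)
qed

text \<open>In each component \<open>C\<close> of \<open>G - R\<close>, the fibres over the vertices not in \<open>\<phi> ` nbhd G C\<close> all have the
  same parity \<open>P C\<close>.  The new chain over \<open>u\<close> loses its part in \<open>C\<close> and gains, if the parities require it,
  the vertex \<open>x C u\<close> of \<open>nbhd G C\<close>.  This changes the parity of all fibres by \<open>P C\<close>, and in total by the
  parity of the fibre over \<open>v0\<close> in \<open>G - R\<close>.\<close>

lemma chain_rep_torso:
  fixes G :: "'a pair_pre_digraph"
  assumes G: "pair_graph G" and R: "R \<subseteq> pverts G" and rep: "chain_rep A B G \<phi> y s"
    and AB: "A \<inter> B = {}"
    and X: "\<And>C. C \<in> comps (pair_induce G (pverts G - R)) \<Longrightarrow> nbhd G C \<subseteq> X" "finite X"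
      "card X < card A" "card X < card B"
    and v0: "v0 \<in> A \<union> B" "v0 \<notin> \<phi> ` X" and ev: "(\<Sum>a\<in>{a\<in>pverts G - R. \<phi> a = v0}. y a) = 0"
  shows "\<exists>y' s'. chain_rep A B (torso G R) \<phi> y' s'"
proof -
  interpret pair_graph G by fact
  note fin = pair_finite_verts
  let ?I = "pair_induce G (pverts G - R)"
  have I: "pair_graph ?I" by (rule pair_graph_pair_induce[OF G]) auto
  define CC where "CC = comps ?I"
  have finCC: "finite CC" using finite_comps[OF I] by (simp add: CC_def)
  have UCC: "\<Union>CC = pverts G - R" using Union_comps[OF I] by (simp add: CC_def)
  have CCsub: "C \<subseteq> pverts G" "C \<inter> R = {}" if "C \<in> CC" for C using UCC that by auto
  have finC: "finite C" if "C \<in> CC" for C using CCsub[OF that] fin finite_subset by blast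
  have dis: "\<forall>C\<in>CC. \<forall>D\<in>CC. C \<noteq> D \<longrightarrow> C \<inter> D = {}" using comps_disjoint[OF I] by (auto simp: CC_def)
  have nR: "nbhd G C \<subseteq> R" if "C \<in> CC" for C using nbhd_comps_subset[OF G R] that by (auto simp: CC_def)
  have nX: "nbhd G C \<subseteq> X" if "C \<in> CC" for C using X(1) that by (auto simp: CC_def)
  have finR: "finite R" using R fin finite_subset by blast
  have finN: "finite (nbhd G C)" if "C \<in> CC" for C using nR[OF that] finR finite_subset by blast
  note sym = chain_repD(1)[OF rep] and supp = chain_repD(2)[OF rep] and bd = chain_repD(3)[OF rep]
    and fib = chain_repD(4)[OF rep]
  have s_ne: "s u v a b = 0" if "u \<in> A" "v \<in> B" "\<not> ((a, b) \<in> parcs G \<and> \<phi> a \<in> {u, v} \<and> \<phi> b \<in> {u, v})" for u v a b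
    using supp[OF that(1,2), of a b] that(3) by (cases "s u v a b") auto
  have diag: "s u v a a = 0" if "u \<in> A" "v \<in> B" for u v a
    using s_ne[OF that] pair_no_loops[of "(a, a)"] by auto
  have sumCC: "(\<Sum>C\<in>CC. \<Sum>c\<in>C. g c) = (\<Sum>c\<in>pverts G - R. g c)" for g :: "'a \<Rightarrow> bit"
    unfolding UCC[symmetric] using dis finC by (simp add: sum.Union_disjoint)
  define Y where "Y C u = (\<Sum>c\<in>{c\<in>C. \<phi> c = u}. y c)" for C u
  define D where "D C u v a = (\<Sum>c\<in>C. s u v a c)" for C u v a
  define N where "N C u v = {a \<in> nbhd G C. \<phi> a \<in> {u, v}}" for C u v
  have out: "b \<in> C \<or> b \<in> nbhd G C" if "c \<in> C" "(c, b) \<in> parcs G" for C b c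
    using that by (auto simp: nbhd_def in_arcsD2)
  have Ysum: "Y C u = (\<Sum>c\<in>C. if \<phi> c = u then y c else 0)" if "C \<in> CC" for C u
    using finC[OF that] by (simp add: Y_def sum.inter_filter)
  have sumY: "(\<Sum>C\<in>CC. Y C u) = (\<Sum>a\<in>{a\<in>pverts G - R. \<phi> a = u}. y a)" for u
  proof -
    have "(\<Sum>C\<in>CC. Y C u) = (\<Sum>C\<in>CC. \<Sum>c\<in>C. if \<phi> c = u then y c else 0)"
      by (simp add: Ysum)
    also have "\<dots> = (\<Sum>a\<in>{a\<in>pverts G - R. \<phi> a = u}. y a)"
      unfolding sumCC by (rule sum.inter_filter[symmetric]) (simp add: fin)
    finally show ?thesis .
  qed
  \<comment> \<open>The boundary of the chain over \<open>uv\<close> is summed over the vertices in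
    \<open>C\<close>. Edges inside \<open>C\<close> cancel in pairs; those from \<open>C\<close> to
    its neighbourhood remain.\<close>
  have YD: "Y C u + Y C v = (\<Sum>a\<in>N C u v. D C u v a)" if C: "C \<in> CC" and u: "u \<in> A" and v: "v \<in> B" for C u v
  proof -
    have uv: "u \<noteq> v" using AB u v by auto
    have "Y C u + Y C v = (\<Sum>c\<in>C. if \<phi> c \<in> {u, v} then y c else 0)"
      unfolding Ysum[OF C] sum.distrib[symmetric] using uv by (intro sum.cong) auto
    also have "\<dots> = (\<Sum>c\<in>C. \<Sum>b\<in>pverts G. s u v c b)"
      using bd[OF u v] CCsub[OF C] s_ne[OF u v] by (intro sum.cong) (auto intro!: sum.neutral)
    also have "\<dots> = (\<Sum>c\<in>C. (\<Sum>b\<in>C. s u v c b) + (\<Sum>b\<in>N C u v. s u v c b))"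
    proof (intro sum.cong refl)
      fix c assume c: "c \<in> C"
      have dj: "C \<inter> N C u v = {}" by (auto simp: N_def nbhd_def)
      have "(\<Sum>b\<in>pverts G. s u v c b) = (\<Sum>b\<in>C \<union> N C u v. s u v c b)"
      proof (rule sum.mono_neutral_right)
        show "\<forall>b\<in>pverts G - (C \<union> N C u v). s u v c b = 0"
        proof (rule ballI, rule ccontr)
          fix b assume b: "b \<in> pverts G - (C \<union> N C u v)" "s u v c b \<noteq> 0"
          then have "(c, b) \<in> parcs G" "\<phi> b \<in> {u, v}" using supp[OF u v, of c b] by auto
          with out[OF c, of b] b show False by (auto simp: N_def)
        qed
      qed (use fin CCsub(1)[OF C] nR[OF C] R in \<open>auto simp: N_def\<close>)
      also have "\<dots> = (\<Sum>b\<in>C. s u v c b) + (\<Sum>b\<in>N C u v. s u v c b)"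
        using finC[OF C] finN[OF C] dj by (intro sum.union_disjoint) (auto simp: N_def)
      finally show "(\<Sum>b\<in>pverts G. s u v c b) = (\<Sum>b\<in>C. s u v c b) + (\<Sum>b\<in>N C u v. s u v c b)" .
    qed
    also have "\<dots> = (\<Sum>c\<in>C. \<Sum>b\<in>C. s u v c b) + (\<Sum>c\<in>C. \<Sum>b\<in>N C u v. s u v c b)"
      by (simp add: sum.distrib)
    also have "(\<Sum>c\<in>C. \<Sum>b\<in>C. s u v c b) = 0"
      by (intro sum_sym_bit_eq_0 finC[OF C] sym[OF u v] diag[OF u v])
    also have "(\<Sum>c\<in>C. \<Sum>b\<in>N C u v. s u v c b) = (\<Sum>a\<in>N C u v. D C u v a)"
      unfolding D_def by (subst sum.swap) (simp add: sym[OF u v])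
    finally show ?thesis by simp
  qed
  define P where "P C = Y C v0" for C
  have finA: "finite A" and finB: "finite B" using X(3,4) card.infinite by fastforce+
  \<comment> \<open>The neighbourhood of \<open>C\<close> meets too few fibres to exhaust
    \<open>A\<close> or \<open>B\<close>. Missed vertices on opposite sides have equal parity by
    \<open>YD\<close>, and the complete bipartite graph on all missed vertices, \<open>v0\<close>
    among them, is connected.\<close>
  have YP: "Y C u = P C" if C: "C \<in> CC" and u: "u \<in> A \<union> B" "u \<notin> \<phi> ` nbhd G C" for C u
  proof -
    have eq: "Y C a = Y C b" if "a \<in> A" "b \<in> B" "a \<notin> \<phi> ` nbhd G C" "b \<notin> \<phi> ` nbhd G C" for a b
    proof -
      have "N C a b = {}" using that by (auto simp: N_def)
      then show ?thesis using YD[OF C that(1,2)] by simp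
    qed
    have "card (\<phi> ` nbhd G C) \<le> card X"
      using nX[OF C] X(2) by (meson card_image_le card_mono finite_subset order_trans)
    then have "\<not> A \<subseteq> \<phi> ` nbhd G C" "\<not> B \<subseteq> \<phi> ` nbhd G C"
      using X(3,4) finN[OF C] by (meson card_mono finite_imageI leD order_trans)+
    then obtain a0 b0 where "a0 \<in> A" "b0 \<in> B" "a0 \<notin> \<phi> ` nbhd G C" "b0 \<notin> \<phi> ` nbhd G C" by blast
    moreover have "v0 \<notin> \<phi> ` nbhd G C" using v0 nX[OF C] by blast
    ultimately show ?thesis using eq u v0(1) unfolding P_def by (metis UnE)
  qed
  \<comment> \<open>The correction for the fibre over \<open>u\<close>. By \<open>YP\<close> it
    vanishes when the neighbourhood of \<open>C\<close> misses that fibre, so a vertex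
    \<open>x C u\<close> exists whenever it is nonzero.\<close>
  define q where "q C u = P C + Y C u" for C u
  define x where "x C u = (SOME x. x \<in> nbhd G C \<and> \<phi> x = u)" for C u
  have x: "x C u \<in> nbhd G C" "\<phi> (x C u) = u" if "u \<in> \<phi> ` nbhd G C" for C u
    using that someI_ex[of "\<lambda>x. x \<in> nbhd G C \<and> \<phi> x = u"] by (auto simp: x_def)
  define E where "E C a = (if \<phi> a \<in> \<phi> ` nbhd G C \<and> a = x C (\<phi> a) then q C (\<phi> a) else 0)" for C a
  have E0: "E C a = 0" if "a \<notin> nbhd G C" for C a
    using that x(1)[of "\<phi> a" C] by (auto simp: E_def)
  have Esum: "(\<Sum>a\<in>{a\<in>S. \<phi> a = u}. E C a) = q C u"
    if C: "C \<in> CC" and u: "u \<in> A \<union> B" and S: "finite S" "nbhd G C \<subseteq> S" for C u S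
  proof (cases "u \<in> \<phi> ` nbhd G C")
    case True
    then have "(\<Sum>a\<in>{a\<in>S. \<phi> a = u}. E C a) = (\<Sum>a\<in>{a\<in>S. \<phi> a = u}. if a = x C u then q C u else 0)"
      by (intro sum.cong) (auto simp: E_def)
    also have "\<dots> = q C u" using S x[OF True] by auto
    finally show ?thesis .
  next
    case False
    then show ?thesis using YP[OF C u] by (auto simp: q_def E_def intro!: sum.neutral)
  qed
  define y' where "y' a = y a + (\<Sum>C\<in>CC. E C a)" for a
  \<comment> \<open>The boundary that the new chain over \<open>uv\<close> still lacks at the
    neighbourhood of \<open>C\<close>: lost edges to \<open>C\<close> plus corrected fibre vertices.
    Its sum is 0 by \<open>d0\<close>, so \<open>clique_chain\<close> supplies it on a clique of the
    torso.\<close>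
  define d where "d C u v a = D C u v a + E C a" for C u v a
  have d0: "(\<Sum>a\<in>N C u v. d C u v a) = 0" if C: "C \<in> CC" and u: "u \<in> A" and v: "v \<in> B" for C u v
  proof -
    have uv: "u \<noteq> v" using AB u v by auto
    have "(\<Sum>a\<in>N C u v. E C a) = (\<Sum>a\<in>{a\<in>nbhd G C. \<phi> a = u}. E C a) + (\<Sum>a\<in>{a\<in>nbhd G C. \<phi> a = v}. E C a)"
      using finN[OF C] uv by (subst sum.union_disjoint[symmetric]) (auto simp: N_def intro!: sum.cong)
    also have "\<dots> = q C u + q C v" using Esum[OF C] finN[OF C] u v by auto
    also have "\<dots> = Y C u + Y C v" by (simp add: q_def algebra_simps)
    finally show ?thesis using YD[OF C u v] by (simp add: d_def sum.distrib)
  qed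
  define Q where "Q C u v t \<longleftrightarrow> (\<forall>a b. t a b = t b a) \<and>
      (\<forall>a b. t a b = 1 \<longrightarrow> a \<in> N C u v \<and> b \<in> N C u v \<and> a \<noteq> b) \<and>
      (\<forall>a\<in>N C u v. (\<Sum>b\<in>N C u v. t a b) = d C u v a)" for C u v t
  define t where "t C u v = (SOME t. Q C u v t)" for C u v
  have Q: "Q C u v (t C u v)" if "C \<in> CC" "u \<in> A" "v \<in> B" for C u v
    unfolding t_def
  proof (rule someI_ex[of "Q C u v"])
    have "finite (N C u v)" using finN[OF that(1)] by (simp add: N_def)
    from clique_chain[OF this d0[OF that]] show "\<exists>t. Q C u v t" unfolding Q_def by metis
  qed
  have t: "\<And>C u v a b. C \<in> CC \<Longrightarrow> u \<in> A \<Longrightarrow> v \<in> B \<Longrightarrow> t C u v a b = t C u v b a"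
    "\<And>C u v a b. C \<in> CC \<Longrightarrow> u \<in> A \<Longrightarrow> v \<in> B \<Longrightarrow> t C u v a b = 1 \<Longrightarrow> a \<in> N C u v \<and> b \<in> N C u v \<and> a \<noteq> b"
    "\<And>C u v a. C \<in> CC \<Longrightarrow> u \<in> A \<Longrightarrow> v \<in> B \<Longrightarrow> a \<in> N C u v \<Longrightarrow> (\<Sum>b\<in>N C u v. t C u v a b) = d C u v a"
    using Q unfolding Q_def by blast+
  define s' where "s' u v a b = (if a \<in> R \<and> b \<in> R then s u v a b else 0) + (\<Sum>C\<in>CC. t C u v a b)" for u v a b
  have symm: "s' u v a b = s' u v b a" if u: "u \<in> A" and v: "v \<in> B" for u v a b
    using sym[OF u v] t(1)[OF _ u v] by (auto simp: s'_def)
  have supp': "(a, b) \<in> parcs (torso G R) \<and> \<phi> a \<in> {u, v} \<and> \<phi> b \<in> {u, v}"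
    if u: "u \<in> A" and v: "v \<in> B" and nz: "s' u v a b \<noteq> 0" for u v a b
  proof -
    have "(\<Sum>C\<in>CC. t C u v a b) = 0" if "\<not> (\<exists>C\<in>CC. t C u v a b = 1)"
      using that by (intro sum.neutral) auto
    then have "a \<in> R \<and> b \<in> R \<and> s u v a b = 1" if "\<not> (\<exists>C\<in>CC. t C u v a b = 1)"
      using nz that by (auto simp: s'_def split: if_splits)
    then consider "a \<in> R" "b \<in> R" "s u v a b = 1" | C where "C \<in> CC" "t C u v a b = 1"
      by blast
    then show ?thesis
    proof cases
      case 1
      then show ?thesis using supp[OF u v 1(3)] by (auto simp: parcs_torso)
    next
      case 2
      then show ?thesis using t(2)[OF 2(1) u v 2(2)] by (auto simp: parcs_torso N_def CC_def)
    qed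
  qed
  have bd': "(\<Sum>b\<in>R. s' u v a b) = y' a"
    if u: "u \<in> A" and v: "v \<in> B" and a: "a \<in> R" and \<phi>a: "\<phi> a \<in> {u, v}" for u v a
  proof -
    have T: "(\<Sum>b\<in>R. t C u v a b) = (if a \<in> nbhd G C then d C u v a else 0)" if C: "C \<in> CC" for C
    proof (cases "a \<in> nbhd G C")
      case True
      then have aN: "a \<in> N C u v" using \<phi>a by (simp add: N_def)
      have "(\<Sum>b\<in>R. t C u v a b) = (\<Sum>b\<in>N C u v. t C u v a b)"
        using finR nR[OF C] t(2)[OF C u v, of a] by (intro sum.mono_neutral_right) (auto simp: N_def dest!: t(2)[OF C u v])
      then show ?thesis using t(3)[OF C u v aN] True by simp
    next
      case False
      then have "t C u v a b = 0" for b
        using t(2)[OF C u v, of a b] by (cases "t C u v a b") (auto simp: N_def)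
      then show ?thesis using False by simp
    qed
    have D0: "D C u v a = 0" if "C \<in> CC" "a \<notin> nbhd G C" for C
    proof -
      have "(a, c) \<notin> parcs G" if "c \<in> C" for c
        using that \<open>a \<notin> nbhd G C\<close> out[of c C a] arcs_symmetric[of a c] CCsub(2)[OF \<open>C \<in> CC\<close>] a by blast
      then show ?thesis unfolding D_def using s_ne[OF u v] by (intro sum.neutral) auto
    qed
    have "(\<Sum>b\<in>R. s' u v a b) = (\<Sum>b\<in>R. s u v a b) + (\<Sum>b\<in>R. \<Sum>C\<in>CC. t C u v a b)"
      using a by (simp add: s'_def sum.distrib)
    also have "(\<Sum>b\<in>R. \<Sum>C\<in>CC. t C u v a b) = (\<Sum>C\<in>CC. D C u v a + E C a)"
      by (subst sum.swap) (auto simp: T D0 E0 d_def intro!: sum.cong)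
    also have "\<dots> = (\<Sum>c\<in>pverts G - R. s u v a c) + (\<Sum>C\<in>CC. E C a)"
      by (simp add: sum.distrib D_def sumCC)
    also have "(\<Sum>b\<in>R. s u v a b) + \<dots> = (\<Sum>b\<in>pverts G. s u v a b) + (\<Sum>C\<in>CC. E C a)"
      using R fin by (simp add: sum.subset_diff[of R "pverts G"] add_ac)
    also have "(\<Sum>b\<in>pverts G. s u v a b) = y a" using bd[OF u v _ \<phi>a] a R by auto
    finally show ?thesis by (simp add: y'_def)
  qed
  have fib': "(\<Sum>a\<in>{a\<in>R. \<phi> a = u}. y' a) = 1" if u: "u \<in> A \<union> B" for u
  proof -
    have "(\<Sum>a\<in>{a\<in>R. \<phi> a = u}. y' a) = (\<Sum>a\<in>{a\<in>R. \<phi> a = u}. y a) + (\<Sum>C\<in>CC. q C u)"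
      unfolding y'_def sum.distrib by (subst sum.swap) (use Esum[OF _ u finR] nR in auto)
    also have "(\<Sum>C\<in>CC. q C u) = (\<Sum>C\<in>CC. P C) + (\<Sum>C\<in>CC. Y C u)"
      by (simp add: q_def sum.distrib)
    also have "(\<Sum>C\<in>CC. P C) = 0"
      using ev sumY by (simp add: P_def)
    also have "(\<Sum>C\<in>CC. Y C u) = (\<Sum>a\<in>{a\<in>pverts G - R. \<phi> a = u}. y a)"
      by (rule sumY)
    also have "(\<Sum>a\<in>{a\<in>R. \<phi> a = u}. y a) + (0 + \<dots>) = (\<Sum>a\<in>{a\<in>pverts G. \<phi> a = u}. y a)"
      using R fin finR by (simp, subst sum.union_disjoint[symmetric]) (auto intro!: sum.cong)
    also have "\<dots> = 1" by (rule fib[OF u])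
    finally show ?thesis .
  qed
  have "chain_rep A B (torso G R) \<phi> y' s'"
    unfolding chain_rep_def pverts_torso using symm supp' bd' fib' by blast
  then show ?thesis by blast
qed

lemma torso_pverts:
  assumes "pair_graph G"
  shows "torso G (pverts G) = G"
proof -
  interpret pair_graph G by fact
  have "comps (pair_induce G {}) = {}"
    using comps_eq[OF pair_graph_pair_induce[OF assms, of "{}"]] by simp
  then show ?thesis
    by (intro pair_pre_digraph.equality) (auto simp: torso_def in_arcsD1 in_arcsD2)
qed

section \<open>Tree decompositions\<close>

text \<open>A torso edge created by a component \<open>C\<close> of \<open>G - R\<close> can be
  replaced by a path through \<open>C\<close>. So what is connected outside \<open>Y\<close> in the
  torso on \<open>R\<close> is connected outside \<open>Y\<close> in \<open>G\<close> as well and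
  keeps its neighbours in \<open>Y\<close>. This lets an induction pass to torsos and still end in a
  torso of the original graph.\<close>

lemma torso_torso_subset:
  assumes G: "pair_graph G" and YR: "Y \<subseteq> R" and R: "R \<subseteq> pverts G"
  shows "parcs (torso (torso G R) Y) \<subseteq> parcs (torso G Y)"
proof -
  interpret pair_graph G by fact
  let ?T = "torso G R"
  have T: "pair_graph ?T" by (rule pair_graph_torso[OF G R])
  let ?V = "pverts G"
  define EY where "EY = parcs G \<inter> (?V - Y) \<times> (?V - Y)"
  have IY: "pair_graph (pair_induce G (?V - Y))" and IR: "pair_graph (pair_induce G (?V - R))"
    by (rule pair_graph_pair_induce[OF G], blast)+
  have IT: "pair_graph (pair_induce ?T (R - Y))"
    by (rule pair_graph_pair_induce[OF T]) auto
  have symEY: "(b, a) \<in> EY\<^sup>*" if "(a, b) \<in> EY\<^sup>*" for a b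
    using pair_graph.sym_rtrancl_parcs[OF IY] that by (simp add: parcs_pair_induce EY_def)
  have CR: "(c, d) \<in> EY\<^sup>*" "c \<in> ?V - Y" if C: "C \<in> comps (pair_induce G (?V - R))" "c \<in> C" "d \<in> C" for C c d
  proof -
    from C obtain u where u: "C = {v. (u, v) \<in> (parcs G \<inter> (?V - R) \<times> (?V - R))\<^sup>*}"
      by (auto simp: comps_eq[OF IR] parcs_pair_induce)
    have "(parcs G \<inter> (?V - R) \<times> (?V - R))\<^sup>* \<subseteq> EY\<^sup>*"
      by (rule rtrancl_mono) (use YR in \<open>auto simp: EY_def\<close>)
    with C u have "(u, c) \<in> EY\<^sup>*" "(u, d) \<in> EY\<^sup>*" by auto
    then show "(c, d) \<in> EY\<^sup>*" using symEY by (meson rtrancl_trans)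
    show "c \<in> ?V - Y" using in_comps_subset[OF C(1)] C(2) YR by auto
  qed
  have stepT: "\<exists>c. (d, c) \<in> EY\<^sup>* \<and> (c, e) \<in> parcs G" if de: "(d, e) \<in> parcs ?T" "d \<notin> Y" for d e
  proof -
    have dR: "d \<in> R" using de(1) pair_graph.axioms(1)[OF T]
      by (metis T pair_wf_digraph.in_arcsD1 pverts_torso pair_digraph_def pair_fin_digraph_def)
    from de(1) consider "(d, e) \<in> parcs G"
      | C where "C \<in> comps (pair_induce G (?V - R))" "d \<in> nbhd G C" "e \<in> nbhd G C"
      by (auto simp: parcs_torso)
    then show ?thesis
    proof cases
      case 1
      then show ?thesis by blast
    next
      case 2
      then obtain c c' where c: "c \<in> C" "(c, d) \<in> parcs G" "c' \<in> C" "(c', e) \<in> parcs G"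
        by (auto simp: nbhd_def)
      have "(d, c) \<in> EY"
        using c CR(2)[OF 2(1) c(1) c(1)] de(2) dR R arcs_symmetric by (auto simp: EY_def)
      moreover have "(c, c') \<in> EY\<^sup>*" by (rule CR(1)[OF 2(1) c(1,3)])
      ultimately show ?thesis using c(4) by (meson converse_rtrancl_into_rtrancl)
    qed
  qed
  have inNb: "x \<in> nbhd G {v. (u, v) \<in> EY\<^sup>*}" if "(u, c) \<in> EY\<^sup>*" "(c, x) \<in> parcs G" "x \<in> Y" for u c x
  proof -
    have "(u, x) \<notin> EY\<^sup>*"
    proof
      assume "(u, x) \<in> EY\<^sup>*"
      \<comment> \<open>Only the reflexive pair of \<open>EY\<^sup>*\<close> can end in
        \<open>Y\<close>; it would force \<open>c = x\<close> and make the arc a loop.\<close>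
      moreover have "u \<noteq> x"
      proof
        assume "u = x"
        then have "c = x" using that(1,3) by (metis (no_types, lifting) DiffD2 EY_def IntD2 SigmaD1 converse_rtranclE)
        then show False using that(2) pair_no_loops by fastforce
      qed
      ultimately show False using that(3) by (auto simp: EY_def elim: rtranclE)
    qed
    then show ?thesis using that in_arcsD2 by (auto simp: nbhd_def)
  qed
  have cls: "{v. (u, v) \<in> EY\<^sup>*} \<in> comps (pair_induce G (?V - Y))" if "u \<in> ?V - Y" for u
    using that by (auto simp: comps_eq[OF IY] parcs_pair_induce EY_def)
  show ?thesis
  proof (intro subrelI)
    fix x y assume xy: "(x, y) \<in> parcs (torso ?T Y)"
    then consider "x \<in> Y" "y \<in> Y" "(x, y) \<in> parcs G"
      | C where "x \<noteq> y" "x \<in> Y" "y \<in> Y" "C \<in> comps (pair_induce G (?V - R))" "x \<in> nbhd G C" "y \<in> nbhd G C"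
      | D where "x \<noteq> y" "D \<in> comps (pair_induce ?T (R - Y))" "x \<in> nbhd ?T D" "y \<in> nbhd ?T D"
      by (auto simp: parcs_torso[of _ _ ?T] parcs_torso[of _ _ G])
    then show "(x, y) \<in> parcs (torso G Y)"
    proof cases
      case 1
      then show ?thesis by (simp add: parcs_torso)
    next
      case 2
      then obtain c c' where c: "c \<in> C" "(c, x) \<in> parcs G" "c' \<in> C" "(c', y) \<in> parcs G"
        by (auto simp: nbhd_def)
      have "x \<in> nbhd G {v. (c, v) \<in> EY\<^sup>*}" "y \<in> nbhd G {v. (c, v) \<in> EY\<^sup>*}"
        using inNb[of c c x] inNb[OF CR(1)[OF 2(4) c(1,3)] c(4)] c 2 by auto
      then show ?thesis using cls[OF CR(2)[OF 2(4) c(1) c(1)]] 2(1) by (auto simp: parcs_torso)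
    next
      case 3
      from 3(2) obtain u where u: "u \<in> R - Y" and D: "D = {v. (u, v) \<in> (parcs ?T \<inter> (R - Y) \<times> (R - Y))\<^sup>*}"
        by (auto simp: comps_eq[OF IT] parcs_pair_induce)
      have DY: "(u, v) \<in> EY\<^sup>*" if "(u, v) \<in> (parcs ?T \<inter> (R - Y) \<times> (R - Y))\<^sup>*" for v
        using that
      proof (induction rule: rtrancl_induct)
        case (step v w)
        then obtain c where c: "(v, c) \<in> EY\<^sup>*" "(c, w) \<in> parcs G" using stepT[of v w] by blast
        have "c \<in> ?V - Y"
          using c(1) step(2) R by (auto simp: EY_def elim: rtranclE)
        then have "(c, w) \<in> EY" using c(2) step(2) R by (auto simp: EY_def)
        with step.IH c(1) show ?case by (meson rtrancl.rtrancl_into_rtrancl rtrancl_trans)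
      qed simp
      have sub: "nbhd ?T D \<subseteq> Y"
        using nbhd_comps_subset[OF T, of Y D] YR 3(2) by simp
      have "z \<in> nbhd G {v. (u, v) \<in> EY\<^sup>*}" if z: "z \<in> nbhd ?T D" for z
      proof -
        from z obtain d where d: "d \<in> D" "(d, z) \<in> parcs ?T" by (auto simp: nbhd_def)
        have "d \<notin> Y" using d(1) u unfolding D by (auto elim: rtranclE)
        with stepT[OF d(2)] obtain c where c: "(d, c) \<in> EY\<^sup>*" "(c, z) \<in> parcs G" by blast
        have "(u, d) \<in> EY\<^sup>*" using DY d(1) D by auto
        with c have "(u, c) \<in> EY\<^sup>*" by (meson rtrancl_trans)
        with c sub z show ?thesis by (intro inNb) auto
      qed
      then show ?thesis using 3 cls[of u] u R by (auto simp: parcs_torso)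
    qed
  qed
qed

lemma pawalk_verts_snoc: "pcas u p v \<Longrightarrow> pawalk_verts u (p @ [(v, w)]) = pawalk_verts u p @ [w]"
  by (induction p arbitrary: u) auto

text \<open>The end of a longest path is a leaf: a second neighbour would extend the path or, lying
  on it, close a cycle of length at least three.\<close>

lemma sym_tree_leaf:
  assumes T: "sym_tree T" and card: "2 \<le> card (pverts T)"
  obtains l m where "l \<in> pverts T" "m \<in> pverts T" "l \<noteq> m" "\<And>w. (l, w) \<in> parcs T \<longleftrightarrow> w = m"
proof -
  have pg: "pair_graph T" and con: "connected (with_proj T)"
    and acyc: "\<And>p. pre_digraph.cycle (with_proj T) p \<Longrightarrow> length p < 3"
    using T by (auto simp: sym_tree_def not_le[symmetric])
  interpret pair_graph T by (rule pg)
  obtain a b where ab: "a \<in> pverts T" "b \<in> pverts T" "a \<noteq> b"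
    using card by (metis card_le_Suc0_iff_eq numeral_2_eq_2 not_less_eq_eq pair_finite_verts)
  have "(a, b) \<in> (parcs T)\<^sup>*" using con ab connected_iff_rtrancl[OF pg] by blast
  with ab obtain c where ac: "(a, c) \<in> parcs T" by (auto elim: converse_rtranclE)
  have "apath a [(a, c)] c"
    using ac pair_no_loops[of "(a, c)"] in_arcsD2 by (auto simp: apath_simps)
  define P where "P n \<longleftrightarrow> (\<exists>u p v. apath u p v \<and> length p = n)" for n
  have "P 1" unfolding P_def using \<open>apath a [(a, c)] c\<close> by force
  moreover have "\<forall>n. P n \<longrightarrow> n \<le> card (pverts T)" unfolding P_def using length_apath by blast
  ultimately obtain n where n: "P n" "\<And>n'. P n' \<Longrightarrow> n' \<le> n"
    using Nat.ex_has_greatest_nat[of P 1 "card (pverts T)"] by blast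
  from n(1) obtain u p v where p: "apath u p v" "length p = n" unfolding P_def by blast
  have "1 \<le> n" using n(2) \<open>P 1\<close> by blast
  then have "p \<noteq> []" using p(2) by auto
  then obtain q e where q: "p = q @ [e]" by (metis append_butlast_last_id)
  have wp: "awalk u p v" "distinct (awalk_verts u p)" using p(1) by (auto simp: apath_def)
  obtain m where e: "e = (m, v)" and mv: "(m, v) \<in> parcs T"
    using wp(1) unfolding q by (cases e) (auto simp: awalk_simps)
  have nbrs: "w = m" if vw: "(v, w) \<in> parcs T" for w
  proof (rule ccontr)
    assume wm: "w \<noteq> m"
    have wv: "w \<noteq> v" using pair_no_loops vw by fastforce
    show False
    proof (cases "w \<in> set (awalk_verts u p)")
      case False
      have "awalk u (p @ [(v, w)]) w" using wp(1) vw by (auto simp: awalk_simps in_arcsD2)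
      moreover have "awalk_verts u (p @ [(v, w)]) = awalk_verts u p @ [w]"
        using wp(1) by (auto simp: awalk_def pawalk_verts_snoc)
      ultimately have "apath u (p @ [(v, w)]) w" using wp(2) False by (auto simp: apath_def)
      then have "P (Suc n)" unfolding P_def using p(2) by force
      then show False using n(2) by fastforce
    next
      case True
      from awalk_decomp[OF wp(1) True] obtain p1 p2 where d: "p = p1 @ p2" "awalk u p1 w" "awalk w p2 v" by blast
      have "distinct (awalk_verts w p2)"
        using wp(2) wp(1) d by (auto simp: awalk_verts_append2 d(1))
      have cyc: "awalk w (p2 @ [(v, w)]) w" using d(3) vw by (auto simp: awalk_simps in_arcsD2)
      have "awalk_verts w (p2 @ [(v, w)]) = awalk_verts w p2 @ [w]"
        using d(3) by (auto simp: awalk_def pawalk_verts_snoc)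
      moreover obtain zs where "awalk_verts w p2 = w # zs" using d(3) by (cases p2) auto
      ultimately have "distinct (tl (awalk_verts w (p2 @ [(v, w)])))"
        using \<open>distinct (awalk_verts w p2)\<close> by auto
      with cyc have "cycle (p2 @ [(v, w)])" by (auto simp: cycle_def)
      then have "length (p2 @ [(v, w)]) < 3" by (rule acyc)
      then have "length p2 \<le> 1" by simp
      then consider "p2 = []" | f where "p2 = [f]" by (cases p2) auto
      then show False
      proof cases
        case 1
        then show False using d(3) wv by (auto simp: awalk_simps)
      next
        case 2
        then have "f = (m, v)" using d(1) q e by simp
        then show False using 2 d(3) wm by (auto simp: awalk_simps)
      qed
    qed
  qed
  show ?thesis
  proof (rule that[of v m])
    show "v \<in> pverts T" "m \<in> pverts T" using mv in_arcsD1 in_arcsD2 by auto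
    show "v \<noteq> m" using mv pair_no_loops by fastforce
    show "(v, w) \<in> parcs T \<longleftrightarrow> w = m" for w using nbrs mv arcs_symmetric by blast
  qed
qed

text \<open>The retraction of \<open>l\<close> to its only neighbour turns walks into walks. It is
  applied to the whole tree and to the nodes whose bags contain a given vertex.\<close>

lemma rtrancl_delete_leaf:
  assumes "(x, y) \<in> (E \<inter> S \<times> S)\<^sup>*" "x \<noteq> l" "sym E" "\<And>w. (l, w) \<in> E \<longleftrightarrow> w = m" "l \<noteq> m"
  shows "(x, if y = l then m else y) \<in> (E \<inter> (S - {l}) \<times> (S - {l}))\<^sup>*"
  using assms(1)
proof (induction rule: rtrancl_induct)
  case base
  then show ?case using assms(2) by simp
next
  case (step y z)
  have yz: "(y, z) \<in> E" "y \<in> S" "z \<in> S" and zy: "(z, y) \<in> E" using step(2) assms(3) by (auto dest: symD)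
  show ?case
  proof (cases "y = l \<or> z = l")
    case True
    then have "y = l \<and> z = m \<or> y = m \<and> z = l" using yz(1) zy assms(4)[of z] assms(4)[of y] by blast
    then have "(if z = l then m else z) = (if y = l then m else y)" using assms(5) by auto
    then show ?thesis using step.IH by simp
  next
    case False
    then have "(y, z) \<in> E \<inter> (S - {l}) \<times> (S - {l})" using yz by auto
    moreover have "(x, y) \<in> (E \<inter> (S - {l}) \<times> (S - {l}))\<^sup>*" using step.IH False by simp
    ultimately have "(x, z) \<in> (E \<inter> (S - {l}) \<times> (S - {l}))\<^sup>*" by (rule rtrancl.rtrancl_into_rtrancl[rotated])
    then show ?thesis using False by simp
  qed
qed

lemma sym_tree_delete_leaf:
  assumes T: "sym_tree T" and l: "l \<in> pverts T" "m \<in> pverts T" "l \<noteq> m" "\<And>w. (l, w) \<in> parcs T \<longleftrightarrow> w = m"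
  shows "sym_tree (pair_induce T (pverts T - {l}))"
proof -
  have pg: "pair_graph T" and con: "connected (with_proj T)"
    and acyc: "\<And>p. pre_digraph.cycle (with_proj T) p \<Longrightarrow> \<not> 3 \<le> length p"
    using T by (auto simp: sym_tree_def)
  interpret pair_graph T by (rule pg)
  let ?T = "pair_induce T (pverts T - {l})"
  have pg': "pair_graph ?T" by (rule pair_graph_pair_induce[OF pg]) auto
  have symT: "sym (parcs T)" using arcs_symmetric by (auto simp: sym_def)
  have "parcs T \<inter> pverts T \<times> pverts T = parcs T" by (auto simp: in_arcsD1 in_arcsD2)
  then have "(a, b) \<in> (parcs ?T)\<^sup>*" if "a \<in> pverts T - {l}" "b \<in> pverts T - {l}" for a b
    using rtrancl_delete_leaf[of a b "parcs T" "pverts T" l m] that con l symT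
    by (auto simp: connected_iff_rtrancl[OF pg] parcs_pair_induce)
  then have "connected (with_proj ?T)" using l by (auto simp: connected_iff_rtrancl[OF pg'])
  moreover have "pre_digraph.cycle (with_proj T) p" if "pre_digraph.cycle (with_proj ?T) p" for p
    using that unfolding pre_digraph.cycle_def pre_digraph.awalk_def
    by (auto simp: cas_with_proj_eq awalk_verts_with_proj_eq parcs_pair_induce)
  ultimately show ?thesis using pg' acyc by (auto simp: sym_tree_def)
qed

lemma chain_rep_mono:
  assumes "chain_rep A B L \<phi> y s" "pverts L = pverts L'" "parcs L \<subseteq> parcs L'"
  shows "chain_rep A B L' \<phi> y s"
  unfolding chain_rep_def
proof (intro conjI ballI allI impI)
  fix u v assume uv: "u \<in> A" "v \<in> B"
  show "s u v a b = s u v b a" for a b by (rule chain_repD(1)[OF assms(1) uv])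
  show "(a, b) \<in> parcs L'" "\<phi> a \<in> {u, v}" "\<phi> b \<in> {u, v}" if "s u v a b \<noteq> 0" for a b
    using chain_repD(2)[OF assms(1) uv, of a b] that assms(3) by auto
  show "(\<Sum>b\<in>pverts L'. s u v a b) = y a" if "a \<in> pverts L'" "\<phi> a \<in> {u, v}" for a
    using chain_repD(3)[OF assms(1) uv, of a] that assms(2) by simp
next
  fix v assume "v \<in> A \<union> B"
  then show "(\<Sum>a\<in>{a\<in>pverts L'. \<phi> a = v}. y a) = 1"
    using chain_repD(4)[OF assms(1)] assms(2) by simp
qed

text \<open>Over a vertex \<open>v0\<close> which the adhesion set at a leaf does not meet, the fibre has odd size, so
  exactly one side of the adhesion set is even and can be cut off.\<close>

theorem chain_rep_tree_decomposition:
  fixes G :: "'a pair_pre_digraph" and T :: "'t pair_pre_digraph"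
  assumes "pair_graph G" "tree_decomposition G T \<beta>" "\<And>t t'. (t, t') \<in> parcs T \<Longrightarrow> card (\<beta> t \<inter> \<beta> t') \<le> k"
    "chain_rep A B G \<phi> y s" "A \<inter> B = {}" "k < card A" "k < card B"
  shows "\<exists>t\<in>pverts T. \<exists>y' s'. chain_rep A B (torso G (\<beta> t)) \<phi> y' s'"
  using assms(1-4)
\<comment> \<open>\<open>G\<close> is generalised because cutting off a leaf bag replaces the graph
  by its torso on the other bags.\<close>
proof (induction "card (pverts T)" arbitrary: G T y s rule: less_induct)
  case less
  note G = \<open>pair_graph G\<close> and td = \<open>tree_decomposition G T \<beta>\<close> and rep = \<open>chain_rep A B G \<phi> y s\<close>
  interpret G: pair_graph G by (rule G)
  have T: "sym_tree T" and cov: "(\<Union>t \<in> pverts T. \<beta> t) = pverts G"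
    and arc: "\<And>u v. (u, v) \<in> parcs G \<Longrightarrow> \<exists>t \<in> pverts T. u \<in> \<beta> t \<and> v \<in> \<beta> t"
    and conn: "\<And>v. v \<in> pverts G \<Longrightarrow> connected (with_proj (pair_induce T {t \<in> pverts T. v \<in> \<beta> t}))"
    using td by (auto simp: tree_decomposition_def)
  have pgT: "pair_graph T" using T by (simp add: sym_tree_def)
  interpret T: pair_graph T by (rule pgT)
  have ne: "pverts T \<noteq> {}" using T by (auto simp: sym_tree_def connected_iff_rtrancl[OF pgT])
  show ?case
  proof (cases "2 \<le> card (pverts T)")
    case False
    then have "card (pverts T) = 1"
      using ne by (metis One_nat_def T.pair_finite_verts card_0_eq le_less_linear less_2_cases_iff)
    then obtain t where "pverts T = {t}" by (auto simp: card_1_singleton_iff)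
    moreover from this cov have "\<beta> t = pverts G" by simp
    ultimately show ?thesis using rep by (auto simp: torso_pverts[OF G])
  next
    case True
    from sym_tree_leaf[OF T True] obtain l m where
      l: "l \<in> pverts T" "m \<in> pverts T" "l \<noteq> m" "\<And>w. (l, w) \<in> parcs T \<longleftrightarrow> w = m" by metis
    define T' where "T' = pair_induce T (pverts T - {l})"
    define R where "R = (\<Union>t\<in>pverts T'. \<beta> t)"
    define X where "X = \<beta> l \<inter> \<beta> m"
    have symT: "sym (parcs T)" using T.arcs_symmetric by (auto simp: sym_def)
    have vT': "pverts T' = pverts T - {l}" by (simp add: T'_def)
    have mR: "\<beta> m \<subseteq> R" using l by (auto simp: R_def vT')
    have lG: "\<beta> l \<subseteq> pverts G" using cov l by auto
    have RG: "R \<subseteq> pverts G" using cov by (auto simp: R_def vT')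
    have VR: "pverts G = R \<union> \<beta> l" using cov l by (auto simp: R_def vT')
    have finX: "finite X" using finite_subset[OF lG G.pair_finite_verts] by (simp add: X_def)
    have cardX: "card X \<le> k" using less.prems(3)[of l m] l by (simp add: X_def)
    define S where "S v = {t \<in> pverts T. v \<in> \<beta> t}" for v
    have pgS: "pair_graph (pair_induce T (S v))" for v
      by (rule pair_graph_pair_induce[OF pgT]) (auto simp: S_def)
    have S: "(t, t') \<in> (parcs T \<inter> S v \<times> S v)\<^sup>*" if "v \<in> pverts G" "t \<in> S v" "t' \<in> S v" for v t t'
      using conn[OF that(1), folded S_def] that by (auto simp: connected_iff_rtrancl[OF pgS] parcs_pair_induce)
    have RX: "R \<inter> \<beta> l \<subseteq> X"
    proof
      fix v assume v: "v \<in> R \<inter> \<beta> l"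
      then obtain t where t: "t \<in> pverts T" "t \<noteq> l" "v \<in> \<beta> t" by (auto simp: R_def vT')
      have "(l, t) \<in> (parcs T \<inter> S v \<times> S v)\<^sup>*" using v t l lG by (intro S) (auto simp: S_def)
      with t(2) obtain t1 where "(l, t1) \<in> parcs T" "t1 \<in> S v" by (auto elim: converse_rtranclE)
      then show "v \<in> X" using v l by (auto simp: S_def X_def)
    qed
    have arcRl: "u \<in> R \<and> v \<in> R \<or> u \<in> \<beta> l \<and> v \<in> \<beta> l" if "(u, v) \<in> parcs G" for u v
      using arc[OF that] l by (auto simp: R_def vT')
    have nbR: "nbhd G C \<subseteq> X" if C: "C \<in> comps (pair_induce G (pverts G - R))" for C
    proof
      fix x assume x: "x \<in> nbhd G C"
      then obtain c where c: "c \<in> C" "(c, x) \<in> parcs G" by (auto simp: nbhd_def)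
      have "c \<notin> R" using in_comps_subset[OF C] c by auto
      moreover have "x \<in> R" using nbhd_comps_subset[OF G RG C] x by auto
      ultimately show "x \<in> X" using arcRl[OF c(2)] RX by auto
    qed
    have nbl: "nbhd G C \<subseteq> X" if C: "C \<in> comps (pair_induce G (pverts G - \<beta> l))" for C
    proof
      fix x assume x: "x \<in> nbhd G C"
      then obtain c where c: "c \<in> C" "(c, x) \<in> parcs G" by (auto simp: nbhd_def)
      have "c \<notin> \<beta> l" using in_comps_subset[OF C] c by auto
      moreover have "x \<in> \<beta> l" using nbhd_comps_subset[OF G lG C] x by auto
      ultimately show "x \<in> X" using arcRl[OF c(2)] RX by auto
    qed
    have cX: "card X < card A" "card X < card B" using cardX assms(6,7) by auto
    obtain v0 where v0: "v0 \<in> A" "v0 \<notin> \<phi> ` X"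
      using cX(1) card_image_le[OF finX, of \<phi>] finX by (metis card_mono finite_imageI leD order_trans subsetI)
    define par where "par W = (\<Sum>a\<in>{a\<in>W. \<phi> a = v0}. y a)" for W
    have "par (pverts G) = par (pverts G - R) + par (pverts G - \<beta> l)"
    proof -
      have "{a\<in>pverts G. \<phi> a = v0} = {a\<in>pverts G - R. \<phi> a = v0} \<union> {a\<in>pverts G - \<beta> l. \<phi> a = v0}"
        using RX v0(2) by auto
      then show ?thesis
        unfolding par_def using G.pair_finite_verts VR by (simp, subst sum.union_disjoint) auto
    qed
    moreover have "par (pverts G) = 1" using chain_repD(4)[OF rep] v0 by (auto simp: par_def)
    ultimately consider "par (pverts G - \<beta> l) = 0" | "par (pverts G - R) = 0"
      by (cases "par (pverts G - R)") auto
    then show ?thesis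
    proof cases
      case 1
      have "\<exists>y' s'. chain_rep A B (torso G (\<beta> l)) \<phi> y' s'"
        by (rule chain_rep_torso[OF G lG rep assms(5) nbl finX cX _ v0(2)]) (use 1 v0 in \<open>auto simp: par_def\<close>)
      then show ?thesis using l by blast
    next
      case 2
      have "\<exists>y' s'. chain_rep A B (torso G R) \<phi> y' s'"
        by (rule chain_rep_torso[OF G RG rep assms(5) nbR finX cX _ v0(2)]) (use 2 v0 in \<open>auto simp: par_def\<close>)
      then obtain y' s' where rep': "chain_rep A B (torso G R) \<phi> y' s'" by blast
      have T': "sym_tree T'" unfolding T'_def by (rule sym_tree_delete_leaf[OF T l])
      \<comment> \<open>The edges that the torso adds join vertices of \<open>X\<close>, and
        \<open>X\<close> lies in the bag of \<open>m\<close>, which is kept.\<close>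
      have "tree_decomposition (torso G R) T' \<beta>"
        unfolding tree_decomposition_def
      proof (intro conjI T' ballI)
        show "(\<Union>t\<in>pverts T'. \<beta> t) = pverts (torso G R)" by (simp add: R_def)
        have "\<exists>t\<in>pverts T'. u \<in> \<beta> t \<and> v \<in> \<beta> t" if "(u, v) \<in> parcs (torso G R)" for u v
        proof -
          from that consider "u \<in> X" "v \<in> X" | "u \<in> R" "v \<in> R" "(u, v) \<in> parcs G"
            using nbR by (auto simp: parcs_torso)
          then show ?thesis
          proof cases
            case 1
            then show ?thesis using l by (intro bexI[of _ m]) (auto simp: X_def vT')
          next
            case 2
            from arc[OF 2(3)] obtain t where t: "t \<in> pverts T" "u \<in> \<beta> t" "v \<in> \<beta> t" by blast
            show ?thesis
            proof (cases "t = l")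
              case True
              then have "u \<in> X" "v \<in> X" using RX 2 t by auto
              then show ?thesis using l by (intro bexI[of _ m]) (auto simp: X_def vT')
            next
              case False
              then show ?thesis using t by (auto simp: vT')
            qed
          qed
        qed
        then show "case e of (u, v) \<Rightarrow> \<exists>t\<in>pverts T'. u \<in> \<beta> t \<and> v \<in> \<beta> t" if "e \<in> parcs (torso G R)" for e
          using that by (cases e) auto
        fix v assume "v \<in> pverts (torso G R)"
        then have v: "v \<in> R" by simp
        have eq: "{t \<in> pverts T'. v \<in> \<beta> t} = S v - {l}" by (auto simp: S_def vT')
        have pgS': "pair_graph (pair_induce T' (S v - {l}))"
          by (rule pair_graph_pair_induce) (use T' in \<open>auto simp: sym_tree_def S_def vT'\<close>)
        have "parcs T' \<inter> (S v - {l}) \<times> (S v - {l}) = parcs T \<inter> (S v - {l}) \<times> (S v - {l})"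
          by (auto simp: T'_def parcs_pair_induce S_def)
        moreover have "(t, t') \<in> (parcs T \<inter> (S v - {l}) \<times> (S v - {l}))\<^sup>*" if "t \<in> S v - {l}" "t' \<in> S v - {l}" for t t'
          using rtrancl_delete_leaf[OF S, of v t t' l m] that v RG symT l by auto
        moreover have "S v - {l} \<noteq> {}" using v by (auto simp: R_def S_def vT')
        ultimately show "connected (with_proj (pair_induce T' {t \<in> pverts T'. v \<in> \<beta> t}))"
          unfolding eq by (simp add: connected_iff_rtrancl[OF pgS'] parcs_pair_induce)
      qed
      moreover have "card (pverts T') < card (pverts T)"
        unfolding vT' by (rule card_Diff1_less[OF T.pair_finite_verts l(1)])
      moreover have "card (\<beta> t \<inter> \<beta> t') \<le> k" if "(t, t') \<in> parcs T'" for t t'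
        using less.prems(3) that by (auto simp: T'_def parcs_pair_induce)
      ultimately obtain t y'' s'' where t: "t \<in> pverts T'" "chain_rep A B (torso (torso G R) (\<beta> t)) \<phi> y'' s''"
        using less.hyps[OF _ pair_graph_torso[OF G RG] _ _ rep'] by blast
      have "\<beta> t \<subseteq> R" using t(1) by (auto simp: R_def)
      then have "chain_rep A B (torso G (\<beta> t)) \<phi> y'' s''"
        using chain_rep_mono[OF t(2) _ torso_torso_subset[OF G _ RG]] by simp
      then show ?thesis using t(1) by (auto simp: vT')
    qed
  qed
qed

section \<open>Homology of embedded graphs\<close>

lemma cyclic_on_image_eq:
  assumes "cyclic_on f S"
  shows "f ` S = S"
proof (intro equalityI subsetI)
  fix x assume "x \<in> f ` S"
  then show "x \<in> S" using cyclic_on_inI[OF assms] by blast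
next
  fix x assume x: "x \<in> S"
  then have "x \<in> orbit f x" using assms by (simp add: orbit_cyclic_eq3)
  then show "x \<in> f ` S"
  proof cases
    case base
    then show ?thesis using x by force
  next
    case (step y)
    then show ?thesis using x assms by (auto simp: orbit_cyclic_eq3)
  qed
qed

lemma cyclic_on_mod:
  fixes h :: "nat \<Rightarrow> 'a"
  assumes n: "0 < n" and step: "\<And>i. i < n \<Longrightarrow> f (h i) = h (Suc i mod n)"
  shows "cyclic_on f (h ` {..<n})"
proof -
  have pow: "(f ^^ i) (h 0) = h (i mod n)" for i
    by (induction i) (use n step in \<open>auto simp: mod_Suc_eq\<close>)
  have "orbit f (h 0) = h ` {..<n}"
  proof (intro equalityI subsetI)
    fix x assume "x \<in> orbit f (h 0)"
    then show "x \<in> h ` {..<n}" using n by (auto simp: orbit_altdef pow)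
  next
    fix x assume "x \<in> h ` {..<n}"
    then obtain i where i: "i < n" "x = h i" by auto
    then have "x = (f ^^ (i + n)) (h 0)" "0 < i + n" using n by (auto simp: pow)
    then show "x \<in> orbit f (h 0)" unfolding orbit_altdef by blast
  qed
  then show ?thesis using n by (auto simp: cyclic_on_def intro!: bexI[of _ "h 0"])
qed

lemma ex_cyclic_on:
  assumes "finite S" "S \<noteq> {}"
  shows "\<exists>f. cyclic_on f S"
proof -
  obtain h where h: "bij_betw h {..<card S} S"
    using ex_bij_betw_nat_finite[OF assms(1)] by (auto simp: atLeast0LessThan)
  have "cyclic_on (\<lambda>x. h (Suc (the_inv_into {..<card S} h x) mod card S)) (h ` {..<card S})"
    using h assms by (intro cyclic_on_mod) (auto simp: bij_betw_def the_inv_into_f_f card_gt_0_iff)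
  then show ?thesis using h by (auto simp: bij_betw_def)
qed

text \<open>Arbitrary cyclic orders at the vertices will do. This ensures that the
  \<open>LEAST\<close> in \<open>euler_genus\<close> is attained, so that a bound on it provides a
  scheme.\<close>

lemma ex_embedding_scheme:
  assumes "pair_graph G"
  shows "\<exists>\<pi>. embedding_scheme G \<pi> {}"
proof -
  interpret pair_graph G by fact
  let ?O = "\<lambda>v. out_arcs (with_proj G) v"
  have O: "?O v = {e \<in> parcs G. fst e = v}" for v by (auto simp: out_arcs_def)
  have finO: "finite (?O v)" for v using pair_finite_arcs by (simp add: O)
  define F where "F v = (SOME f. cyclic_on f (?O v))" for v
  have F: "cyclic_on (F v) (?O v)" if "?O v \<noteq> {}" for v
    unfolding F_def by (rule someI_ex[of "\<lambda>f. cyclic_on f (?O v)"]) (rule ex_cyclic_on[OF finO that])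
  define \<pi> where "\<pi> e = (if e \<in> parcs G then F (fst e) e else e)" for e
  have cyc: "cyclic_on \<pi> (?O v)" if "?O v \<noteq> {}" for v
    using F[OF that] by (rule cyclic_cong[THEN iffD1, rotated]) (auto simp: \<pi>_def O)
  have im: "\<pi> ` parcs G = parcs G"
  proof -
    have "parcs G = (\<Union>v\<in>fst ` parcs G. ?O v)" by (auto simp: O)
    moreover have "\<pi> ` ?O v = ?O v" if "v \<in> fst ` parcs G" for v
      using that by (intro cyclic_on_image_eq cyc) (auto simp: O)
    ultimately show ?thesis by (metis (no_types, lifting) SUP_cong image_UN)
  qed
  have "\<pi> permutes parcs G"
  proof (rule bij_imp_permutes)
    show "bij_betw \<pi> (parcs G) (parcs G)"
      using im pair_finite_arcs by (simp add: bij_betw_def eq_card_imp_inj_on)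
  qed (simp add: \<pi>_def)
  with cyc show ?thesis by (auto simp: embedding_scheme_def sym_def)
qed

lemma euler_genus_leE:
  assumes "pair_graph G" "euler_genus G \<le> k"
  obtains \<pi> N where "embedding_scheme G \<pi> N" "scheme_genus G \<pi> N \<le> int k"
proof -
  let ?P = "\<lambda>g. \<exists>\<pi> N. embedding_scheme G \<pi> N \<and> scheme_genus G \<pi> N \<le> int g"
  obtain \<pi> where "embedding_scheme G \<pi> {}" using ex_embedding_scheme[OF assms(1)] by blast
  moreover have "scheme_genus G \<pi> {} \<le> int (nat (scheme_genus G \<pi> {}))" by simp
  ultimately have "\<exists>g. ?P g" by blast
  then have "?P (euler_genus G)" unfolding euler_genus_def by (rule LeastI_ex)
  with assms(2) show ?thesis using that by force
qed

section \<open>Rank and nullity by counting\<close>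

lemma card_fibres:
  assumes "finite S" "\<And>w. w \<in> f ` S \<Longrightarrow> card {x\<in>S. f x = w} = m"
  shows "card S = card (f ` S) * m"
proof -
  have "card S = (\<Sum>w\<in>f ` S. \<Sum>x\<in>{x\<in>S. f x = w}. 1)"
    unfolding card_eq_sum by (rule sum.image_gen[OF assms(1)])
  also have "\<dots> = (\<Sum>w\<in>f ` S. m)" using assms(2) by (intro sum.cong) auto
  finally show ?thesis by simp
qed

text \<open>Rank-nullity with cardinalities in place of dimensions: each fibre is a translate of the
  kernel, and translation by \<open>x0\<close> is an involution.\<close>

lemma card_bit_hom:
  fixes f :: "('a \<Rightarrow> bit) \<Rightarrow> 'b \<Rightarrow> bit"
  assumes S: "finite S" and cl: "\<And>x y. x \<in> S \<Longrightarrow> y \<in> S \<Longrightarrow> (\<lambda>i. x i + y i) \<in> S"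
    and hom: "\<And>x y. x \<in> S \<Longrightarrow> y \<in> S \<Longrightarrow> f (\<lambda>i. x i + y i) = (\<lambda>j. f x j + f y j)"
  shows "card S = card (f ` S) * card {x\<in>S. f x = (\<lambda>_. 0)}"
proof (rule card_fibres[OF S])
  fix w assume "w \<in> f ` S"
  then obtain x0 where x0: "x0 \<in> S" "w = f x0" by blast
  have "bij_betw (\<lambda>x i. x i + x0 i) {x\<in>S. f x = w} {x\<in>S. f x = (\<lambda>_. 0)}"
    by (rule bij_betw_byWitness[where f' = "\<lambda>x i. x i + x0 i"])
      (use x0 cl hom in \<open>auto simp: add.assoc\<close>)
  then show "card {x\<in>S. f x = w} = card {x\<in>S. f x = (\<lambda>_. 0)}" by (rule bij_betw_same_card)
qed

section \<open>Chains, cycles and boundaries of an embedded graph\<close>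

locale embedded_graph = pair_graph G for G :: "'a::linorder pair_pre_digraph" +
  fixes \<pi> :: "'a \<times> 'a \<Rightarrow> 'a \<times> 'a" and N :: "'a rel"
  assumes scheme: "embedding_scheme G \<pi> N"
begin

abbreviation "E \<equiv> parcs G"
abbreviation "V \<equiv> pverts G"

lemma perm: "\<pi> permutes E"
  and cyc: "v \<in> V \<Longrightarrow> {e\<in>E. fst e = v} \<noteq> {} \<Longrightarrow> cyclic_on \<pi> {e\<in>E. fst e = v}"
  using scheme by (auto simp: embedding_scheme_def out_arcs_def)

lemma swap_N: "prod.swap a \<in> N \<longleftrightarrow> a \<in> N"
  using scheme by (cases a) (auto simp: embedding_scheme_def dest: symD)

lemma swap_E [simp]: "prod.swap a \<in> E \<longleftrightarrow> a \<in> E"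
  using arcs_symmetric by (cases a) auto

lemma pi_E [simp]: "\<pi> a \<in> E \<longleftrightarrow> a \<in> E"
  using perm by (simp add: permutes_in_image)

lemma inv_pi_E [simp]: "inv \<pi> a \<in> E \<longleftrightarrow> a \<in> E"
  using permutes_inv[OF perm] by (simp add: permutes_in_image)

lemma fst_pi [simp]: "a \<in> E \<Longrightarrow> fst (\<pi> a) = fst a"
proof -
  assume a: "a \<in> E"
  have "cyclic_on \<pi> {e\<in>E. fst e = fst a}" by (rule cyc[OF arc_fst_in_verts[OF a]]) (use a in blast)
  from cyclic_on_inI[OF this, of a] a show ?thesis by simp
qed

definition edge_chains :: "('a \<times> 'a \<Rightarrow> bit) set" where
  "edge_chains = {z. (\<forall>a. a \<notin> E \<longrightarrow> z a = 0) \<and> (\<forall>a. z (prod.swap a) = z a)}"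

lemma edge_chains_0: "z \<in> edge_chains \<Longrightarrow> a \<notin> E \<Longrightarrow> z a = 0"
  and edge_chains_swap: "z \<in> edge_chains \<Longrightarrow> z (prod.swap a) = z a"
  unfolding edge_chains_def by blast+

definition cycles :: "('a \<times> 'a \<Rightarrow> bit) set" where
  "cycles = {z \<in> edge_chains. \<forall>v\<in>V. (\<Sum>w\<in>V. z (v, w)) = 0}"

text \<open>The state \<open>(a, s)\<close> of face tracing lies on the same face as the state \<open>reversal (a, s)\<close>,
  which traverses the arc in the opposite direction.\<close>

definition reversal :: "('a \<times> 'a) \<times> bool \<Rightarrow> ('a \<times> 'a) \<times> bool" where
  "reversal = (\<lambda>(a, s). (prod.swap a, if a \<in> N then s else \<not> s))"

text \<open>These are the 2-chains: a value for each face, stored on states as a function invariant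
  under tracing in both directions. The states \<open>(a, True)\<close> and
  \<open>(a, False)\<close> are the two sides of \<open>a\<close>, so \<open>bdry\<close> is the
  usual boundary.\<close>

definition face_chains :: "(('a \<times> 'a) \<times> bool \<Rightarrow> bit) set" where
  "face_chains = {R. (\<forall>a s. a \<notin> E \<longrightarrow> R (a, s) = 0) \<and>
     (\<forall>x\<in>E \<times> UNIV. R (face_succ \<pi> N x) = R x \<and> R (reversal x) = R x)}"

definition bdry :: "(('a \<times> 'a) \<times> bool \<Rightarrow> bit) \<Rightarrow> 'a \<times> 'a \<Rightarrow> bit" where
  "bdry R a = R (a, True) + R (a, False)"

lemma face_chains_0: "R \<in> face_chains \<Longrightarrow> a \<notin> E \<Longrightarrow> R (a, s) = 0"
  unfolding face_chains_def by blast

lemma face_chains_reversal: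
  assumes "R \<in> face_chains" "a \<in> E"
  shows "R (prod.swap a, s) = R (a, if a \<in> N then s else \<not> s)"
proof -
  have "R (reversal (a, if a \<in> N then s else \<not> s)) = R (a, if a \<in> N then s else \<not> s)"
    using assms by (simp add: face_chains_def)
  then show ?thesis by (auto simp: reversal_def split: if_splits)
qed

text \<open>Arcs consecutive in the rotation share a corner, so a 2-chain agrees on the sides of
  \<open>b\<close> and \<open>\<pi> b\<close> that face each other. Every tour around a vertex
  relies on this.\<close>

lemma face_chains_pi:
  assumes R: "R \<in> face_chains" and b: "b \<in> E"
  shows "R (\<pi> b, True) = R (b, False)"
proof -
  \<comment> \<open>Chosen so that after the arc \<open>prod.swap b\<close>, whatever its sign,
    tracing turns according to \<open>\<pi>\<close>.\<close>
  define s where "s \<longleftrightarrow> prod.swap b \<notin> N"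
  have "R (face_succ \<pi> N (prod.swap b, s)) = R (prod.swap b, s)"
    using R b by (simp add: face_chains_def)
  moreover have "face_succ \<pi> N (prod.swap b, s) = (\<pi> b, True)"
    by (simp add: face_succ_def s_def)
  moreover have "R (prod.swap b, s) = R (b, False)"
    using face_chains_reversal[OF R b, of s] by (auto simp: s_def swap_N split: if_splits)
  ultimately show ?thesis by simp
qed

lemma bdry_swap: "R \<in> face_chains \<Longrightarrow> a \<in> E \<Longrightarrow> bdry R (prod.swap a) = bdry R a"
  by (auto simp: bdry_def face_chains_reversal add.commute)

lemma face_chains_add: "R \<in> face_chains \<Longrightarrow> R' \<in> face_chains \<Longrightarrow> (\<lambda>x. R x + R' x) \<in> face_chains"
  by (auto simp: face_chains_def)

lemma bdry_add: "bdry (\<lambda>x. R x + R' x) = (\<lambda>a. bdry R a + bdry R' a)"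
  by (auto simp: bdry_def fun_eq_iff algebra_simps)

lemma sum_out:
  assumes "\<And>a. a \<notin> E \<Longrightarrow> z a = (0 :: bit)"
  shows "(\<Sum>w\<in>V. z (v, w)) = (\<Sum>e\<in>{e\<in>E. fst e = v}. z e)"
proof -
  have "(\<Sum>w\<in>V. z (v, w)) = (\<Sum>e\<in>Pair v ` V. z e)"
    by (subst sum.reindex) (auto simp: inj_on_def)
  also have "\<dots> = (\<Sum>e\<in>{e\<in>E. fst e = v}. z e)"
    using pair_finite_verts assms by (intro sum.mono_neutral_right) (auto simp: in_arcsD2)
  finally show ?thesis .
qed

text \<open>A tour around \<open>v\<close> meets each corner from its two arcs, once as a
  \<open>True\<close> side and once as a \<open>False\<close> side; hence the two sums over the arcs
  at \<open>v\<close> coincide.\<close>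

lemma bdry_in_cycles:
  assumes R: "R \<in> face_chains"
  shows "bdry R \<in> cycles"
proof -
  have zero: "bdry R a = 0" if "a \<notin> E" for a using face_chains_0[OF R that] by (simp add: bdry_def)
  have "bdry R (prod.swap a) = bdry R a" for a
    using bdry_swap[OF R, of a] zero[of a] zero[of "prod.swap a"] by (cases "a \<in> E") auto
  moreover have "(\<Sum>w\<in>V. bdry R (v, w)) = 0" if v: "v \<in> V" for v
  proof (cases "{e\<in>E. fst e = v} = {}")
    case True
    have "(\<Sum>w\<in>V. bdry R (v, w)) = (\<Sum>e\<in>{e\<in>E. fst e = v}. bdry R e)" by (rule sum_out[OF zero])
    then show ?thesis unfolding True by simp
  next
    case False
    let ?O = "{e\<in>E. fst e = v}"
    have "\<pi> ` ?O = ?O" by (rule cyclic_on_image_eq[OF cyc[OF v False]])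
    moreover have "inj_on \<pi> ?O" using permutes_inj[OF perm] by (rule inj_on_subset) simp
    ultimately have "(\<Sum>e\<in>?O. R (e, True)) = (\<Sum>e\<in>?O. R (\<pi> e, True))"
      by (metis (no_types, lifting) sum.reindex_cong)
    also have "\<dots> = (\<Sum>e\<in>?O. R (e, False))" using face_chains_pi[OF R] by auto
    finally show ?thesis using sum_out[of "bdry R" v, OF zero] by (simp add: bdry_def sum.distrib)
  qed
  ultimately show ?thesis using zero by (auto simp: cycles_def edge_chains_def)
qed

section \<open>An upper bound for the number of cycles\<close>

lemma edge_chains_half:
  obtains H where "H \<subseteq> E" "card H = card E div 2" "E = H \<union> prod.swap ` H"
proof
  \<comment> \<open>The linear order on vertices, part of the locale, selects one arc of each
    edge.\<close>
  let ?H = "{e\<in>E. fst e < snd e}"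
  show un: "E = ?H \<union> prod.swap ` ?H"
  proof (intro equalityI subsetI)
    fix e assume e: "e \<in> E"
    then have "fst e \<noteq> snd e" using pair_no_loops by blast
    then consider "fst e < snd e" | "snd e < fst e" by fastforce
    then show "e \<in> ?H \<union> prod.swap ` ?H"
    proof cases
      case 2
      then have "prod.swap e \<in> ?H" using e by simp
      then have "prod.swap (prod.swap e) \<in> prod.swap ` ?H" by (rule imageI)
      then show ?thesis by simp
    qed (use e in auto)
  qed (auto dest: arcs_symmetric)
  have "card E = card ?H + card (prod.swap ` ?H)"
  proof (subst un, rule card_Un_disjoint)
    show "?H \<inter> prod.swap ` ?H = {}" by auto
  qed (simp_all add: pair_finite_arcs)
  also have "card (prod.swap ` ?H) = card ?H" by (simp add: card_image)
  finally show "card ?H = card E div 2" by simp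
qed simp

lemma edge_chains_card: "finite edge_chains" "card edge_chains \<le> 2 ^ (card E div 2)"
proof -
  obtain H where H: "H \<subseteq> E" "card H = card E div 2" "E = H \<union> prod.swap ` H" by (rule edge_chains_half)
  have finH: "finite H" using H(1) pair_finite_arcs finite_subset by blast
  define \<iota> where "\<iota> z = {a\<in>H. z a = 1}" for z :: "'a \<times> 'a \<Rightarrow> bit"
  have "inj_on \<iota> edge_chains"
  proof (rule inj_onI)
    fix z z' assume z: "z \<in> edge_chains" "z' \<in> edge_chains" "\<iota> z = \<iota> z'"
    have eqH: "z a = z' a" if "a \<in> H" for a
    proof -
      have "z a = 1 \<longleftrightarrow> z' a = 1" using z(3) that unfolding \<iota>_def by blast
      then show ?thesis by (cases "z a"; cases "z' a") auto
    qed
    show "z = z'"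
    proof
      fix a
      consider "a \<in> H" | b where "b \<in> H" "a = prod.swap b" | "a \<notin> E" using H(3) by blast
      then show "z a = z' a"
        using eqH edge_chains_0[OF z(1)] edge_chains_0[OF z(2)] edge_chains_swap[OF z(1)] edge_chains_swap[OF z(2)]
        by cases simp_all
    qed
  qed
  moreover have "\<iota> ` edge_chains \<subseteq> Pow H" by (auto simp: \<iota>_def)
  moreover have "finite (Pow H)" "card (Pow H) = 2 ^ (card E div 2)" using finH H(2) by (simp_all add: card_Pow)
  ultimately show "finite edge_chains" "card edge_chains \<le> 2 ^ (card E div 2)"
    by (meson finite_imageD finite_subset, metis card_inj_on_le)
qed

text \<open>The boundary map on 1-chains. The value 0 off \<open>V\<close> makes
  \<open>cycles\<close> its kernel as a map into functions.\<close>

definition vbd :: "('a \<times> 'a \<Rightarrow> bit) \<Rightarrow> 'a \<Rightarrow> bit" where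
  "vbd z v = (if v \<in> V then \<Sum>w\<in>V. z (v, w) else 0)"

lemma edge_chains_add: "z \<in> edge_chains \<Longrightarrow> z' \<in> edge_chains \<Longrightarrow> (\<lambda>a. z a + z' a) \<in> edge_chains"
  by (auto simp: edge_chains_def)

lemma vbd_add: "vbd (\<lambda>a. z a + z' a) = (\<lambda>v. vbd z v + vbd z' v)"
  by (auto simp: vbd_def sum.distrib fun_eq_iff)

lemma path_chain:
  assumes "(u, v) \<in> E\<^sup>*" "u \<in> V"
  shows "\<exists>z\<in>edge_chains. vbd z = (\<lambda>w. of_bool (w = u) + of_bool (w = v))"
  using assms(1)
proof (induction rule: rtrancl_induct)
  case base
  have "(\<lambda>_. 0) \<in> edge_chains" by (simp add: edge_chains_def)
  moreover have "vbd (\<lambda>_. 0) = (\<lambda>w. of_bool (w = u) + of_bool (w = u))" by (auto simp: vbd_def fun_eq_iff)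
  ultimately show ?case by blast
next
  case (step v x)
  then obtain z where z: "z \<in> edge_chains" "vbd z = (\<lambda>w. of_bool (w = u) + of_bool (w = v))" by blast
  define e where "e a = (of_bool (a = (v, x) \<or> a = (x, v)) :: bit)" for a
  have vx: "v \<noteq> x" "v \<in> V" "x \<in> V" using step(2) pair_no_loops in_arcsD1 in_arcsD2 by fastforce+
  have "e \<in> edge_chains" using step(2) arcs_symmetric by (auto simp: edge_chains_def e_def)
  moreover have "vbd e = (\<lambda>w. of_bool (w = v) + of_bool (w = x))"
  proof
    fix w
    have "(\<Sum>b\<in>V. e (w, b)) = (\<Sum>b\<in>V. if b = x then of_bool (w = v) else 0) + (\<Sum>b\<in>V. if b = v then of_bool (w = x) else 0)"
      unfolding sum.distrib[symmetric] using vx by (intro sum.cong) (auto simp: e_def)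
    also have "\<dots> = of_bool (w = v) + of_bool (w = x)" using vx pair_finite_verts by simp
    finally show "vbd e w = of_bool (w = v) + of_bool (w = x)" using vx by (auto simp: vbd_def)
  qed
  ultimately have "vbd (\<lambda>a. z a + e a) = (\<lambda>w. of_bool (w = u) + of_bool (w = x))"
    using z by (simp add: vbd_add fun_eq_iff add.assoc)
  with z(1) \<open>e \<in> edge_chains\<close> show ?case using edge_chains_add by blast
qed

text \<open>With one root chosen per component, paths to the roots show that every vertex set is a
  boundary up to a set of roots. So the boundary map has rank at least the number of vertices minus
  the number of components.\<close>

lemma card_vbd_image: "2 ^ card V \<le> card (vbd ` edge_chains) * 2 ^ card (comps G)"
proof -
  have finc: "finite (comps G)" using finite_comps pair_graph by blast
  define r where "r C = (SOME v. v \<in> C)" for C :: "'a set"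
  have r: "r C \<in> C" if "C \<in> comps G" for C
  proof -
    have "C \<noteq> {}" using that comps_eq[OF pair_graph] by auto
    then show ?thesis unfolding r_def by (simp add: some_in_eq)
  qed
  have rinj: "C = D" if "C \<in> comps G" "D \<in> comps G" "r C = r D" for C D
    using comps_disjoint[OF pair_graph that(1,2)] r[OF that(1)] r[OF that(2)] that(3) by auto
  define \<rho> where "\<rho> U v = (of_bool (\<exists>C\<in>U. v = r C) :: bit)" for U v
  define \<Psi> where "\<Psi> = (\<lambda>(d, U). {v\<in>V. d v + \<rho> U v = 1})"
  have "\<exists>z\<in>edge_chains. \<exists>U\<subseteq>comps G. \<forall>v\<in>V. vbd z v + \<rho> U v = of_bool (v \<in> W)" if "W \<subseteq> V" for W
  proof -
    have "finite W" using that pair_finite_verts finite_subset by blast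
    then show ?thesis using that
    proof (induction W rule: finite_induct)
      case empty
      have "(\<lambda>_. 0) \<in> edge_chains" by (simp add: edge_chains_def)
      moreover have "vbd (\<lambda>_. 0) v + \<rho> {} v = of_bool (v \<in> {})" for v by (auto simp: vbd_def \<rho>_def)
      ultimately show ?case by blast
    next
      case (insert w W)
      then obtain z U where z: "z \<in> edge_chains" "U \<subseteq> comps G" "\<forall>v\<in>V. vbd z v + \<rho> U v = of_bool (v \<in> W)" by auto
      obtain C where C: "C \<in> comps G" "w \<in> C" using Union_comps[OF pair_graph] insert.prems by auto
      have "(w, r C) \<in> E\<^sup>*"
        using C r[OF C(1)] sym_rtrancl_parcs unfolding comps_eq[OF pair_graph] by (auto intro: rtrancl_trans)
      from path_chain[OF this] insert.prems obtain z' where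
        z': "z' \<in> edge_chains" "vbd z' = (\<lambda>v. of_bool (v = w) + of_bool (v = r C))" by auto
      have U: "\<rho> (sym_diff U {C}) v = \<rho> U v + of_bool (v = r C)" for v
      proof -
        have "(\<exists>D\<in>sym_diff U {C}. v = r D) \<longleftrightarrow> (\<exists>D\<in>U. v = r D) \<noteq> (v = r C)"
        proof (cases "v = r C")
          case True
          have "D = C" if "D \<in> U" "v = r D" for D using rinj[OF _ C(1)] that z(2) True by auto
          with True show ?thesis by blast
        next
          case False
          then show ?thesis by blast
        qed
        then show ?thesis by (auto simp: \<rho>_def)
      qed
      have "vbd (\<lambda>a. z a + z' a) v + \<rho> (sym_diff U {C}) v = of_bool (v \<in> insert w W)" if "v \<in> V" for v
      proof -
        have "vbd (\<lambda>a. z a + z' a) v + \<rho> (sym_diff U {C}) v = (vbd z v + \<rho> U v) + of_bool (v = w)"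
          by (simp add: vbd_add z'(2) U add_ac)
        then show ?thesis using z(3) that insert.hyps by auto
      qed
      moreover have "sym_diff U {C} \<subseteq> comps G" using z(2) C by auto
      ultimately show ?case using edge_chains_add[OF z(1) z'(1)] by blast
    qed
  qed
  then have "Pow V \<subseteq> \<Psi> ` (vbd ` edge_chains \<times> Pow (comps G))"
  proof (intro subsetI)
    fix W assume "W \<in> Pow V"
    then have WV: "W \<subseteq> V" by simp
    obtain z U where z: "z \<in> edge_chains" "U \<subseteq> comps G" "\<forall>v\<in>V. vbd z v + \<rho> U v = of_bool (v \<in> W)"
      using \<open>\<And>W. W \<subseteq> V \<Longrightarrow> _\<close>[OF WV] by blast
    then have "W = \<Psi> (vbd z, U)" using WV by (auto simp: \<Psi>_def simp del: bit_add_eq_0_iff)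
    with z show "W \<in> \<Psi> ` (vbd ` edge_chains \<times> Pow (comps G))" by blast
  qed
  moreover have fin: "finite (vbd ` edge_chains \<times> Pow (comps G))" using edge_chains_card finc by simp
  ultimately have "card (Pow V) \<le> card (vbd ` edge_chains \<times> Pow (comps G))"
    by (meson card_image_le card_mono finite_imageI order_trans)
  then show ?thesis using finc pair_finite_verts by (simp add: card_Pow card_cartesian_product)
qed

lemma card_cycles: "card cycles * 2 ^ card V \<le> 2 ^ (card E div 2 + card (comps G))"
proof -
  have "cycles = {z\<in>edge_chains. vbd z = (\<lambda>_. 0)}"
    by (auto simp: cycles_def vbd_def fun_eq_iff)
  then have "card edge_chains = card (vbd ` edge_chains) * card cycles"
    using card_bit_hom[OF edge_chains_card(1), of vbd] edge_chains_add vbd_add by simp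
  then have "card cycles * 2 ^ card V \<le> card edge_chains * 2 ^ card (comps G)"
    using card_vbd_image mult_le_mono2[OF card_vbd_image, of "card cycles"] by (simp add: mult_ac)
  also have "\<dots> \<le> 2 ^ (card E div 2) * 2 ^ card (comps G)" using edge_chains_card(2) by simp
  finally show ?thesis by (simp add: power_add)
qed

section \<open>A lower bound for the number of boundaries\<close>

definition boundaries :: "('a \<times> 'a \<Rightarrow> bit) set" where
  "boundaries = bdry ` face_chains"

abbreviation "succ \<equiv> face_succ \<pi> N"
abbreviation "States \<equiv> E \<times> (UNIV :: bool set)"

lemma succ_in: "x \<in> States \<Longrightarrow> succ x \<in> States"
  by (cases x) (simp add: face_succ_def Let_def)

lemma reversal_in: "x \<in> States \<Longrightarrow> reversal x \<in> States"
  by (cases x) (simp add: reversal_def)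

lemma reversal_reversal: "reversal (reversal x) = x"
  by (cases x) (simp add: reversal_def swap_N)

text \<open>Reversal conjugates face tracing to its inverse. Therefore \<open>succ\<close> is
  injective on states, and the reversed walk traces the same face.\<close>

lemma succ_reversal_succ: "x \<in> States \<Longrightarrow> succ (reversal (succ x)) = reversal x"
proof -
  assume x: "x \<in> States"
  obtain a s where as: "x = (a, s)" by (cases x)
  define s' where "s' = (if a \<in> N then \<not> s else s)"
  define b where "b = (if s' then \<pi> else inv \<pi>) (prod.swap a)"
  have sx: "succ x = (b, s')" by (simp add: face_succ_def as s'_def b_def)
  have rx: "reversal x = (prod.swap a, \<not> s')" by (auto simp: reversal_def as s'_def)
  have "reversal (b, s') = (prod.swap b, \<not> (if b \<in> N then \<not> s' else s'))" by (auto simp: reversal_def)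
  then have "succ (reversal (b, s')) = ((if \<not> s' then \<pi> else inv \<pi>) b, \<not> s')"
    by (auto simp: face_succ_def Let_def swap_N)
  also have "\<dots> = (prod.swap a, \<not> s')"
    using permutes_inverses[OF perm] by (simp add: b_def)
  finally show ?thesis by (simp add: sx rx)
qed

lemma finite_States: "finite States" using pair_finite_arcs by simp

lemma self_in_orbit: 
  assumes x: "x \<in> States"
  shows "x \<in> orbit succ x"
proof -
  have inj: "inj_on succ States"
  proof (rule inj_on_inverseI[where g = "reversal \<circ> succ \<circ> reversal"])
    show "(reversal \<circ> succ \<circ> reversal) (succ x) = x" if "x \<in> States" for x
      using that by (simp add: succ_reversal_succ reversal_reversal)
  qed
  \<comment> \<open>\<open>orbit\<close> begins with the first iterate, so membership of
    \<open>x\<close> itself needs a permutation; \<open>f\<close> extends \<open>succ\<close> to one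
    by the identity.\<close>
  define f where "f y = (if y \<in> States then succ y else y)" for y
  have "f permutes States"
  proof (rule bij_imp_permutes)
    have "succ ` States = States" using succ_in by (intro endo_inj_surj[OF finite_States _ inj]) blast
    then have "bij_betw succ States States" using inj by (simp add: bij_betw_def)
    then show "bij_betw f States States"
      using bij_betw_cong[of States f succ States] by (simp add: f_def)
  qed (simp add: f_def)
  then have "permutation f" using finite_States unfolding permutation_permutes by blast
  then have "x \<in> orbit f x" by (rule permutation_self_in_orbit)
  also have "orbit f x = orbit succ x"
    by (rule orbit_cong0[OF x]) (use succ_in in \<open>auto simp: f_def\<close>)
  finally show ?thesis .
qed

lemma orbit_succ: "x \<in> States \<Longrightarrow> orbit succ (succ x) = orbit succ x"
  by (rule self_in_orbit_step[OF self_in_orbit])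

lemma orbit_eq: "y \<in> States \<Longrightarrow> x \<in> orbit succ y \<Longrightarrow> orbit succ x = orbit succ y"
  using orbit_cyclic_eq3[OF cyclic_on_singleI[OF self_in_orbit refl]] .

definition face :: "('a \<times> 'a) \<times> bool \<Rightarrow> (('a \<times> 'a) \<times> bool) set" where
  "face x = orbit succ x \<union> orbit succ (reversal x)"

lemma face_succ_eq: "x \<in> States \<Longrightarrow> face (succ x) = face x"
  using orbit_succ[OF reversal_in[OF succ_in[of x]]]
  by (simp add: face_def orbit_succ succ_reversal_succ)

lemma face_reversal: "face (reversal x) = face x"
  by (auto simp: face_def reversal_reversal)

text \<open>A face is a union of at most two orbits, so the halved orbit count in
  \<open>num_faces\<close> does not exceed the number of faces seen by states.\<close>

lemma card_orbits_le: "card (orbit succ ` States) \<le> 2 * card (face ` States)"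
proof -
  have fin: "finite (face ` States)" using finite_States by simp
  define p where "p q = (SOME x. x \<in> States \<and> face x = q)" for q
  have p: "p q \<in> States" "face (p q) = q" if "q \<in> face ` States" for q
    using someI_ex[of "\<lambda>x. x \<in> States \<and> face x = q"] that by (auto simp: p_def)
  have "orbit succ ` States \<subseteq> (\<Union>q\<in>face ` States. {orbit succ (p q), orbit succ (reversal (p q))})"
  proof
    fix c assume "c \<in> orbit succ ` States"
    then obtain x where x: "x \<in> States" "c = orbit succ x" by blast
    let ?q = "face x"
    have q: "?q \<in> face ` States" using x by blast
    have "x \<in> face (p ?q)" using p(2)[OF q] self_in_orbit[OF x(1)] by (simp add: face_def)
    then consider "x \<in> orbit succ (p ?q)" | "x \<in> orbit succ (reversal (p ?q))" by (auto simp: face_def)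
    then have "c = orbit succ (p ?q) \<or> c = orbit succ (reversal (p ?q))"
      using x(2) orbit_eq[OF p(1)[OF q]] orbit_eq[OF reversal_in[OF p(1)[OF q]]] by blast
    with q show "c \<in> (\<Union>q\<in>face ` States. {orbit succ (p q), orbit succ (reversal (p q))})" by blast
  qed
  then have "card (orbit succ ` States) \<le> card (\<Union>q\<in>face ` States. {orbit succ (p q), orbit succ (reversal (p q))})"
    using fin by (intro card_mono) auto
  also have "\<dots> \<le> (\<Sum>q\<in>face ` States. card {orbit succ (p q), orbit succ (reversal (p q))})"
    by (rule card_UN_le[OF fin])
  also have "\<dots> \<le> (\<Sum>q\<in>face ` States. 2)" by (intro sum_mono) (auto simp: card_insert_if)
  finally show ?thesis by simp
qed

lemma finite_face_chains: "finite face_chains"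
proof -
  have "inj_on (\<lambda>R. {x\<in>States. R x = 1}) face_chains"
  proof (rule inj_onI)
    fix R R' assume R: "R \<in> face_chains" "R' \<in> face_chains" "{x\<in>States. R x = 1} = {x\<in>States. R' x = 1}"
    show "R = R'"
    proof
      fix x
      show "R x = R' x"
      proof (cases "x \<in> States")
        case True
        with R(3) have "R x = 1 \<longleftrightarrow> R' x = 1" by blast
        then show ?thesis by (cases "R x"; cases "R' x") auto
      next
        case False
        then show ?thesis using R(1,2) by (cases x) (auto simp: face_chains_def)
      qed
    qed
  qed
  moreover have "(\<lambda>R. {x\<in>States. R x = 1}) ` face_chains \<subseteq> Pow States" by blast
  ultimately show ?thesis using finite_States by (meson finite_Pow_iff finite_imageD finite_subset)
qed

lemma card_face_chains: "2 ^ (card (orbit succ ` States) div 2) \<le> card face_chains"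
proof -
  have fin: "finite (face ` States)" using finite_States by simp
  define \<iota> where "\<iota> U x = (of_bool (x \<in> States \<and> face x \<in> U) :: bit)" for U x
  have "inj_on \<iota> (Pow (face ` States))"
  proof (rule inj_onI)
    fix U U' assume U: "U \<in> Pow (face ` States)" "U' \<in> Pow (face ` States)" "\<iota> U = \<iota> U'"
    have "face x \<in> U \<longleftrightarrow> face x \<in> U'" if "x \<in> States" for x
    proof -
      have "(of_bool (face x \<in> U) :: bit) = of_bool (face x \<in> U')"
        using fun_cong[OF U(3), of x] that by (simp only: \<iota>_def simp_thms)
      then show ?thesis by (simp only: of_bool_eq_iff)
    qed
    then show "U = U'" using U(1,2) by blast
  qed
  moreover have "\<iota> U \<in> face_chains" for U
  proof -
    have "\<iota> U (succ x) = \<iota> U x" "\<iota> U (reversal x) = \<iota> U x" if "x \<in> States" for x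
      using succ_in[OF that] reversal_in[OF that] that
      by (simp_all only: \<iota>_def face_succ_eq[OF that] face_reversal simp_thms)
    moreover have "\<iota> U (a, s) = 0" if "a \<notin> E" for a s using that by (simp add: \<iota>_def)
    ultimately show ?thesis unfolding face_chains_def by blast
  qed
  then have "\<iota> ` Pow (face ` States) \<subseteq> face_chains" by blast
  ultimately have "card (Pow (face ` States)) \<le> card face_chains"
    using finite_face_chains by (rule card_inj_on_le)
  moreover have "(2::nat) ^ (card (orbit succ ` States) div 2) \<le> 2 ^ card (face ` States)"
    using card_orbits_le by (intro power_increasing) auto
  moreover have "card (Pow (face ` States)) = 2 ^ card (face ` States)" by (rule card_Pow[OF fin])
  ultimately show ?thesis by linarith
qed

definition isolated :: "'a set" where
  "isolated = {v\<in>V. out_arcs (with_proj G) v = {}}"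

text \<open>Zero boundary means equal values on both sides of each arc, hence a constant value
  around each vertex and along each edge. The kernel thus has at most one degree of freedom per
  component with an edge; isolated vertices use up the remaining components.\<close>

lemma card_bdry_kernel:
  "card {R\<in>face_chains. bdry R = (\<lambda>_. 0)} * 2 ^ card isolated \<le> 2 ^ card (comps G)"
proof -
  have finc: "finite (comps G)" using finite_comps pair_graph by blast
  let ?K = "{R\<in>face_chains. bdry R = (\<lambda>_. 0)}"
  define CE where "CE = {C\<in>comps G. \<exists>a\<in>E. fst a \<in> C}"
  define \<iota> where "\<iota> R = {C\<in>CE. \<exists>a\<in>E. fst a \<in> C \<and> R (a, True) = 1}" for R :: "('a \<times> 'a) \<times> bool \<Rightarrow> bit"
  have const: "R (a, s) = R (b, t)" if R: "R \<in> ?K" and ab: "a \<in> E" "b \<in> E" "(fst a, fst b) \<in> E\<^sup>*" for R a b s t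
  proof -
    have RF: "R \<in> face_chains" using R by simp
    have TF: "R (a, s) = R (a, t)" for a s t
    proof -
      have "bdry R a = 0" using R by simp
      then show ?thesis by (cases s; cases t) (simp_all add: bdry_def)
    qed
    have "R (\<pi> a, True) = R (a, True)" if "a \<in> E" for a
      using face_chains_pi[OF RF that] TF[of a False True] by simp
    then have orb: "R (b, True) = R (a, True)" if "b \<in> orbit \<pi> a" "a \<in> E" for a b
    proof -
      have "b \<in> E \<and> R (b, True) = R (a, True)"
        using that by induction (auto simp: \<open>\<And>a. a \<in> E \<Longrightarrow> R (\<pi> a, True) = R (a, True)\<close>)
      then show ?thesis by simp
    qed
    have same: "R (a, True) = R (b, True)" if "a \<in> E" "b \<in> E" "fst a = fst b" for a b
    proof -
      have "fst a \<in> V" using that(1) by (rule arc_fst_in_verts)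
      then have "orbit \<pi> a = {e\<in>E. fst e = fst a}" using that(1) by (intro orbit_cyclic_eq3[OF cyc]) blast+
      then show ?thesis using orb[of b a] that by auto
    qed
    have "\<forall>b\<in>E. fst b = w \<longrightarrow> R (a, True) = R (b, True)" if "(fst a, w) \<in> E\<^sup>*" for w
      using that
    proof (induction rule: rtrancl_induct)
      case base
      show ?case by (intro ballI impI, rule same[OF ab(1)]) simp_all
    next
      case (step v w)
      have "R (a, True) = R ((v, w), True)" using step by auto
      also have "\<dots> = R ((w, v), True)"
        using face_chains_reversal[OF RF step(2), of True] TF[of "(v, w)"] by simp
      finally show ?case using same[of "(w, v)"] step(2) arcs_symmetric by fastforce
    qed
    then have "R (a, True) = R (b, True)" using ab by blast
    then show ?thesis using TF by metis
  qed
  have "inj_on \<iota> ?K"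
  proof (rule inj_onI)
    fix R R' assume R: "R \<in> ?K" "R' \<in> ?K" "\<iota> R = \<iota> R'"
    show "R = R'"
    proof
      fix x :: "('a \<times> 'a) \<times> bool"
      obtain a s where x: "x = (a, s)" by (cases x)
      show "R x = R' x"
      proof (cases "a \<in> E")
        case False
        then show ?thesis using R(1,2) face_chains_0[of R a s] face_chains_0[of R' a s] by (simp add: x)
      next
        case True
        obtain C where C: "C \<in> comps G" "fst a \<in> C"
          using Union_comps[OF pair_graph] arc_fst_in_verts[OF True] by auto
        have reach: "(fst a, fst b) \<in> E\<^sup>*" if "fst b \<in> C" for b :: "'a \<times> 'a"
        proof -
          obtain u where "C = {v. (u, v) \<in> E\<^sup>*}" using C(1) unfolding comps_eq[OF pair_graph] by blast
          then have "(u, fst a) \<in> E\<^sup>*" "(u, fst b) \<in> E\<^sup>*" using C(2) that by auto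
          then show ?thesis using sym_rtrancl_parcs rtrancl_trans by metis
        qed
        have "C \<in> \<iota> Q \<longleftrightarrow> Q (a, s) = 1" if Q: "Q \<in> ?K" for Q
        proof
          assume "C \<in> \<iota> Q"
          then obtain b where b: "b \<in> E" "fst b \<in> C" "Q (b, True) = 1" by (auto simp: \<iota>_def)
          then show "Q (a, s) = 1" using const[OF Q True b(1) reach[OF b(2)], of s True] by simp
        next
          assume "Q (a, s) = 1"
          then have "Q (a, True) = 1" using const[OF Q True True, of s True] by simp
          then show "C \<in> \<iota> Q" using C True by (auto simp: \<iota>_def CE_def)
        qed
        from this[OF R(1)] this[OF R(2)] R(3) have "R (a, s) = 1 \<longleftrightarrow> R' (a, s) = 1" by simp
        then show ?thesis by (cases "R (a, s)"; cases "R' (a, s)") (auto simp: x)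
      qed
    qed
  qed
  moreover have "\<iota> ` ?K \<subseteq> Pow CE" by (auto simp: \<iota>_def)
  moreover have finCE: "finite CE" using finc by (simp add: CE_def)
  ultimately have K: "card ?K \<le> 2 ^ card CE" using card_inj_on_le[of \<iota> ?K "Pow CE"] by (simp add: card_Pow)
  have iso: "card isolated \<le> card (comps G - CE)"
  proof (rule card_inj_on_le[where f = "\<lambda>v. {v}"])
    show "(\<lambda>v. {v}) ` isolated \<subseteq> comps G - CE"
    proof
      fix C assume "C \<in> (\<lambda>v. {v}) ` isolated"
      then obtain v where v: "v \<in> V" "C = {v}" "\<And>w. (v, w) \<notin> E"
        by (auto simp: isolated_def out_arcs_def)
      have "{w. (v, w) \<in> E\<^sup>*} = {v}" using v(3) by (auto elim: converse_rtranclE)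
      then have "C \<in> comps G" using v unfolding comps_eq[OF pair_graph] by auto
      moreover have "C \<notin> CE" using v by (auto simp: CE_def)
      ultimately show "C \<in> comps G - CE" by simp
    qed
  qed (use finc in auto)
  have "CE \<subseteq> comps G" by (auto simp: CE_def)
  then have "card CE + card isolated \<le> card (comps G)"
    using iso card_mono[OF finc \<open>CE \<subseteq> comps G\<close>] card_Diff_subset[OF finCE \<open>CE \<subseteq> comps G\<close>] by linarith
  have "card ?K * 2 ^ card isolated \<le> 2 ^ card CE * 2 ^ card isolated" using K by simp
  also have "\<dots> = 2 ^ (card CE + card isolated)" by (simp add: power_add)
  also have "\<dots> \<le> 2 ^ card (comps G)" using \<open>card CE + card isolated \<le> card (comps G)\<close> by simp
  finally show ?thesis .
qed

text \<open>Rank-nullity for \<open>bdry\<close>. The faces that \<open>num_faces\<close> adds for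
  isolated vertices carry no 2-chain and are balanced by the extra factor in
  \<open>card_bdry_kernel\<close>.\<close>

lemma card_boundaries: "2 ^ num_faces G \<pi> N \<le> card boundaries * 2 ^ card (comps G)"
proof -
  have nf: "num_faces G \<pi> N = card (orbit succ ` States) div 2 + card isolated"
    by (simp add: num_faces_def isolated_def)
  let ?K = "{R\<in>face_chains. bdry R = (\<lambda>_. 0)}"
  have "card face_chains = card boundaries * card ?K"
    unfolding boundaries_def
    by (rule card_bit_hom[OF finite_face_chains]) (auto simp: face_chains_add bdry_add)
  have "2 ^ num_faces G \<pi> N \<le> card face_chains * 2 ^ card isolated"
    using card_face_chains by (simp add: nf power_add)
  also have "\<dots> = card boundaries * (card ?K * 2 ^ card isolated)"
    using \<open>card face_chains = card boundaries * card ?K\<close> by simp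
  also have "\<dots> \<le> card boundaries * 2 ^ card (comps G)" using card_bdry_kernel by simp
  finally show ?thesis .
qed

text \<open>The first homology group with coefficients in \<open>\<int>/2\<close> is \<^term>\<open>cycles\<close> modulo \<^term>\<open>boundaries\<close>.\<close>

lemma card_cycles_le:
  assumes "scheme_genus G \<pi> N \<le> int k"
  shows "card cycles \<le> 2 ^ k * card boundaries"
proof -
  let ?c = "card (comps G)" and ?m = "card E div 2"
  \<comment> \<open>With E edges, F faces and c components, cycles have dimension at most E - V + c
    and boundaries at least F - c. The difference is the scheme genus, written here without
    subtraction.\<close>
  have g: "?m + ?c + ?c \<le> k + card V + num_faces G \<pi> N"
    using assms by (simp add: scheme_genus_def)
  have "card cycles * (2 ^ card V * 2 ^ ?c) \<le> 2 ^ (?m + ?c) * 2 ^ ?c"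
    using card_cycles by (simp add: mult.assoc[symmetric])
  also have "\<dots> = 2 ^ (?m + ?c + ?c)" by (simp add: power_add)
  also have "\<dots> \<le> 2 ^ (k + card V + num_faces G \<pi> N)" by (rule power_increasing[OF g]) simp
  also have "\<dots> = 2 ^ (k + card V) * 2 ^ num_faces G \<pi> N" by (simp add: power_add)
  also have "\<dots> \<le> 2 ^ (k + card V) * (card boundaries * 2 ^ ?c)"
    by (rule mult_le_mono2[OF card_boundaries])
  also have "\<dots> = 2 ^ k * card boundaries * (2 ^ card V * 2 ^ ?c)" by (simp add: power_add)
  finally show ?thesis by (simp only: mult_le_cancel2) simp
qed

text \<open>There are at most \<open>2 ^ k\<close> cosets of \<open>boundaries\<close> in
  \<open>cycles\<close>, hence at most \<open>4 ^ k\<close> pairs of cosets for \<open>g i\<close>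
  and \<open>h i\<close>.\<close>

lemma pigeonhole_homology:
  assumes genus: "scheme_genus G \<pi> N \<le> int k" and gh: "\<And>i. i \<in> I \<Longrightarrow> g i \<in> cycles" "\<And>i. i \<in> I \<Longrightarrow> h i \<in> cycles"
    and I: "4 ^ k < card I"
  obtains i j where "i \<in> I" "j \<in> I" "i \<noteq> j" "(\<lambda>a. g i a + g j a) \<in> boundaries" "(\<lambda>a. h i a + h j a) \<in> boundaries"
proof -
  define q where "q z = (\<lambda>b a. z a + b a) ` boundaries" for z :: "'a \<times> 'a \<Rightarrow> bit"
  have finB: "finite boundaries" using finite_face_chains by (simp add: boundaries_def)
  have finZ: "finite cycles" using edge_chains_card(1) by (simp add: cycles_def)
  have Badd: "(\<lambda>a. x a + y a) \<in> boundaries" if xy: "x \<in> boundaries" "y \<in> boundaries" for x y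
  proof -
    obtain R R' where "x = bdry R" "y = bdry R'" "R \<in> face_chains" "R' \<in> face_chains"
      using xy by (auto simp: boundaries_def)
    then show ?thesis using face_chains_add[of R R'] by (auto simp: boundaries_def bdry_add[symmetric])
  qed
  have B0: "(\<lambda>_. 0) \<in> boundaries"
    unfolding boundaries_def by (rule image_eqI[of _ _ "\<lambda>_. 0"]) (auto simp: bdry_def face_chains_def)
  have BZ: "boundaries \<subseteq> cycles" using bdry_in_cycles by (auto simp: boundaries_def)
  have Zadd: "(\<lambda>a. x a + y a) \<in> cycles" if "x \<in> cycles" "y \<in> cycles" for x y
    using that by (auto simp: cycles_def edge_chains_add sum.distrib)
  have q_self: "z \<in> q z" for z using B0 by (auto simp: q_def intro!: image_eqI[of _ _ "\<lambda>_. 0"])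
  have qD: "(\<lambda>a. x a + z a) \<in> boundaries" if "x \<in> q z" for x z
    using that by (auto simp: q_def add.commute add.left_commute)
  have qI: "q x = q z" if xz: "(\<lambda>a. x a + z a) \<in> boundaries" for x z
  proof -
    have "q x \<subseteq> q z" if xz: "(\<lambda>a. x a + z a) \<in> boundaries" for x z
    proof
      fix w assume "w \<in> q x"
      then obtain b where b: "b \<in> boundaries" "w = (\<lambda>a. x a + b a)" by (auto simp: q_def)
      have "w = (\<lambda>a. z a + ((x a + z a) + b a))" using b(2) by (simp add: fun_eq_iff add_ac)
      moreover have "(\<lambda>a. (x a + z a) + b a) \<in> boundaries" using Badd[OF xz b(1)] .
      ultimately show "w \<in> q z" unfolding q_def by (rule image_eqI)
    qed
    from this[OF xz] this[of z x] xz show ?thesis by (simp add: add.commute)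
  qed
  have "card cycles = card (q ` cycles) * card boundaries"
  proof (rule card_fibres[OF finZ])
    fix w assume "w \<in> q ` cycles"
    then obtain z where z: "z \<in> cycles" "w = q z" by blast
    have "{x\<in>cycles. q x = w} = q z"
    proof (intro equalityI subsetI)
      fix x assume "x \<in> {x\<in>cycles. q x = w}"
      then show "x \<in> q z" using q_self[of x] z by simp
    next
      fix x assume x: "x \<in> q z"
      then have "x \<in> cycles" using z(1) BZ Zadd by (auto simp: q_def)
      then show "x \<in> {x\<in>cycles. q x = w}" using qI[OF qD[OF x]] z by simp
    qed
    also have "card (q z) = card boundaries"
      unfolding q_def by (rule card_image) (auto simp: inj_on_def fun_eq_iff)
    finally show "card {x\<in>cycles. q x = w} = card boundaries" .
  qed
  then have "card (q ` cycles) * card boundaries \<le> 2 ^ k * card boundaries"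
    using card_cycles_le[OF genus] by simp
  moreover have "card boundaries > 0" using B0 finB by (auto simp: card_gt_0_iff)
  ultimately have cq: "card (q ` cycles) \<le> 2 ^ k" by simp
  let ?f = "\<lambda>i. (q (g i), q (h i))"
  have "?f ` I \<subseteq> q ` cycles \<times> q ` cycles" using gh by auto
  then have "card (?f ` I) \<le> card (q ` cycles \<times> q ` cycles)"
    using finZ by (intro card_mono) simp_all
  then have "card (?f ` I) \<le> card (q ` cycles) * card (q ` cycles)"
    by (simp only: card_cartesian_product)
  also have "\<dots> \<le> 2 ^ k * 2 ^ k" by (rule mult_le_mono[OF cq cq])
  also have "\<dots> = 4 ^ k" by (simp add: power_mult_distrib[symmetric])
  finally have "card (?f ` I) < card I" using I by simp
  then have "\<not> inj_on ?f I" using card_image[of ?f I] by linarith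
  then obtain i j where ij: "i \<in> I" "j \<in> I" "i \<noteq> j" "q (g i) = q (g j)" "q (h i) = q (h j)"
    unfolding inj_on_def by blast
  have "(\<lambda>a. g i a + g j a) \<in> boundaries" by (rule qD) (use q_self[of "g i"] ij(4) in simp)
  moreover have "(\<lambda>a. h i a + h j a) \<in> boundaries" by (rule qD) (use q_self[of "h i"] ij(5) in simp)
  ultimately show ?thesis using that[OF ij(1-3)] by blast
qed

end

section \<open>Chain representations in embedded graphs\<close>

text \<open>For the tour around a branch vertex of a theta graph: \<open>p1\<close>, \<open>p2\<close>, \<open>p3\<close> indicate the edges of the three
  paths, and \<open>r1\<close>, \<open>r2\<close>, \<open>r3\<close> are the values at the successive corners of face chains bounded by
  the union of the other two paths.\<close>

lemma corner_sum:
  fixes p1 p2 p3 r1 r2 r3 :: "nat \<Rightarrow> bit"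
  assumes r: "\<And>t. t < n \<Longrightarrow> r1 (Suc t) = r1 t + (p2 t + p3 t)" "\<And>t. t < n \<Longrightarrow> r2 (Suc t) = r2 t + (p1 t + p3 t)"
    "\<And>t. t < n \<Longrightarrow> r3 (Suc t) = r3 t + (p1 t + p2 t)"
  defines "n1 \<equiv> \<Sum>t<n. p1 t" and "n2 \<equiv> \<Sum>t<n. p2 t" and "n3 \<equiv> \<Sum>t<n. p3 t"
  shows "(\<Sum>t<n. p1 t * r1 t + p2 t * r2 t + p3 t * r3 t) =
    n1 * r1 0 + n2 * r2 0 + n3 * r3 0 + (n1 * n2 + n1 * n3 + n2 * n3) + (\<Sum>t<n. p1 t * p2 t + p1 t * p3 t + p2 t * p3 t)"
proof -
  define m1 m2 m3 where "m1 s = (\<Sum>t<s. p1 t)" and "m2 s = (\<Sum>t<s. p2 t)" and "m3 s = (\<Sum>t<s. p3 t)" for s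
  \<comment> \<open>Each \<open>r\<close> is its initial value plus the prefix sums of the other two
    paths. So a pair of edges from different paths at different positions is counted once, at the
    later position; the products of totals overcount by the pairs at equal positions.\<close>
  have "r1 s = r1 0 + m2 s + m3 s \<and> r2 s = r2 0 + m1 s + m3 s \<and> r3 s = r3 0 + m1 s + m2 s \<and>
    (\<Sum>t<s. p1 t * r1 t + p2 t * r2 t + p3 t * r3 t) =
    m1 s * r1 0 + m2 s * r2 0 + m3 s * r3 0 + (m1 s * m2 s + m1 s * m3 s + m2 s * m3 s) +
    (\<Sum>t<s. p1 t * p2 t + p1 t * p3 t + p2 t * p3 t)" if "s \<le> n" for s
    using that
  proof (induction s)
    case 0
    then show ?case by (simp add: m1_def m2_def m3_def)
  next
    case (Suc s)
    then have IH: "r1 s = r1 0 + m2 s + m3 s" "r2 s = r2 0 + m1 s + m3 s" "r3 s = r3 0 + m1 s + m2 s"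
      "(\<Sum>t<s. p1 t * r1 t + p2 t * r2 t + p3 t * r3 t) =
      m1 s * r1 0 + m2 s * r2 0 + m3 s * r3 0 + (m1 s * m2 s + m1 s * m3 s + m2 s * m3 s) +
      (\<Sum>t<s. p1 t * p2 t + p1 t * p3 t + p2 t * p3 t)" by auto
    have m: "m1 (Suc s) = m1 s + p1 s" "m2 (Suc s) = m2 s + p2 s" "m3 (Suc s) = m3 s + p3 s"
      by (simp_all add: m1_def m2_def m3_def)
    have r: "r1 (Suc s) = r1 s + (p2 s + p3 s)" "r2 (Suc s) = r2 s + (p1 s + p3 s)" "r3 (Suc s) = r3 s + (p1 s + p2 s)"
      using r[of s] Suc.prems by auto
    have "(\<Sum>t<Suc s. p1 t * r1 t + p2 t * r2 t + p3 t * r3 t) =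
      m1 (Suc s) * r1 0 + m2 (Suc s) * r2 0 + m3 (Suc s) * r3 0 +
      (m1 (Suc s) * m2 (Suc s) + m1 (Suc s) * m3 (Suc s) + m2 (Suc s) * m3 (Suc s)) +
      (\<Sum>t<Suc s. p1 t * p2 t + p1 t * p3 t + p2 t * p3 t)"
      unfolding sum.lessThan_Suc IH m by (simp add: algebra_simps)
    then show ?case unfolding r m IH by (simp add: algebra_simps)
  qed
  from this[of n] show ?thesis by (simp add: n1_def n2_def n3_def m1_def m2_def m3_def)
qed

context embedded_graph
begin

text \<open>Only meaningful if \<open>w\<close> does not meet the boundary of \<open>R\<close>, so that all its corners have the same value.\<close>

definition side :: "(('a \<times> 'a) \<times> bool \<Rightarrow> bit) \<Rightarrow> 'a \<Rightarrow> bit" where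
  "side R w = (if \<exists>b. (w, b) \<in> E then R ((w, SOME b. (w, b) \<in> E), True) else 0)"

lemma side_add: "side (\<lambda>x. R x + R' x) w = side R w + side R' w"
  by (simp add: side_def)

text \<open>Turning at \<open>w\<close> never changes the value by \<open>face_chains_pi\<close>,
  and neither does crossing an arc that is not in the boundary.\<close>

lemma side_eq:
  assumes R: "R \<in> face_chains" and free: "\<And>b. bdry R (w, b) = 0" and wb: "(w, b) \<in> E"
  shows "R ((w, b), s) = side R w"
proof -
  have TF: "R ((w, b), s) = R ((w, b), t)" for b s t
    using free[of b] by (cases s; cases t) (simp_all add: bdry_def)
  define c where "c = (SOME b. (w, b) \<in> E)"
  have wc: "(w, c) \<in> E" unfolding c_def using wb by (rule someI)
  have orb: "orbit \<pi> (w, c) = {e\<in>E. fst e = w}"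
    using wc in_arcsD1[OF wc] by (intro orbit_cyclic_eq3[OF cyc]) auto
  have "e \<in> E \<and> fst e = w \<and> R (e, True) = R ((w, c), True)" if "e \<in> orbit \<pi> (w, c)" for e
    using that
  proof induction
    case base
    then show ?case using wc face_chains_pi[OF R wc] TF[of c False True] by simp
  next
    case (step e)
    then have "R (\<pi> e, True) = R (e, False)" using face_chains_pi[OF R] by simp
    also have "\<dots> = R (e, True)" using TF[of "snd e" False True] step.IH by (cases e) simp
    finally show ?case using step.IH by simp
  qed
  then have "R ((w, b), True) = R ((w, c), True)" using wb orb by auto
  then show ?thesis using TF[of b s True] wb by (auto simp: side_def c_def)
qed

lemma side_edge:
  assumes R: "R \<in> face_chains" and free: "\<And>c. bdry R (w, c) = 0" "\<And>c. bdry R (b, c) = 0" and wb: "(w, b) \<in> E"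
  shows "side R w = side R b"
proof -
  have "(b, w) \<in> E" using wb by (rule arcs_symmetric)
  then have "side R b = R ((b, w), True)" using side_eq[OF R free(2)] by simp
  also have "\<dots> = R ((w, b), if (w, b) \<in> N then True else \<not> True)"
    using face_chains_reversal[OF R wb, of True] by simp
  also have "\<dots> = side R w" by (rule side_eq[OF R free(1) wb])
  finally show ?thesis by simp
qed

text \<open>Let \<open>T R u\<close> be the value of \<open>R\<close> on the chain over \<open>u\<close>.  The sum of \<open>T R1 a1\<close>, \<open>T R2 a2\<close>, \<open>T R3 a3\<close> vanishes,
  since each \<open>ai\<close> is joined to \<open>b3\<close> without meeting the boundary of \<open>Ri\<close>, and it is \<open>1\<close> when
  evaluated at the corners around the fibre over \<open>b1\<close>.  Edges within that fibre contribute twice.\<close>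

lemma chain_rep_theta:
  assumes rep: "chain_rep A B G \<phi> y s" and AB: "A \<inter> B = {}"
    and a: "a1 \<in> A" "a2 \<in> A" "a3 \<in> A" "a1 \<noteq> a2" "a1 \<noteq> a3" "a2 \<noteq> a3"
    and b: "b1 \<in> B" "b2 \<in> B" "b3 \<in> B" "b1 \<noteq> b2" "b1 \<noteq> b3" "b2 \<noteq> b3"
    and R2: "R2 \<in> face_chains" "\<And>v w. bdry R2 (v, w) = s a1 b1 v w + s a1 b2 v w + (s a3 b1 v w + s a3 b2 v w)"
    and R3: "R3 \<in> face_chains" "\<And>v w. bdry R3 (v, w) = s a1 b1 v w + s a1 b2 v w + (s a2 b1 v w + s a2 b2 v w)"
  shows False
proof -
  note sym = chain_repD(1)[OF rep] and supp = chain_repD(2)[OF rep] and bd = chain_repD(3)[OF rep]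
    and fib = chain_repD(4)[OF rep]
  note fin [simp] = pair_finite_verts
  have ab: "u \<noteq> v" if "u \<in> A" "v \<in> B" for u v using AB that by auto
  have s0: "s u v c d = 0" if "u \<in> A" "v \<in> B" "\<not> ((c, d) \<in> E \<and> \<phi> c \<in> {u, v} \<and> \<phi> d \<in> {u, v})" for u v c d
    using supp[OF that(1,2), of c d] that(3) by (cases "s u v c d") auto
  have diag: "s u v c c = 0" if "u \<in> A" "v \<in> B" for u v c
    using s0[OF that, of c c] pair_no_loops[of "(c, c)"] by auto
  \<comment> \<open>The edges at \<open>a1\<close> cancel, so each \<open>Ri\<close> is bounded by
    the two paths that avoid \<open>ai\<close>.\<close>
  define R1 where "R1 = (\<lambda>x. R2 x + R3 x)"
  have R1: "R1 \<in> face_chains" "\<And>v w. bdry R1 (v, w) = s a2 b1 v w + s a2 b2 v w + (s a3 b1 v w + s a3 b2 v w)"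
    unfolding R1_def using face_chains_add[OF R2(1) R3(1)]
    by (auto simp: bdry_add R2(2) R3(2) algebra_simps)
  define Fib where "Fib u = {w\<in>V. \<phi> w = u}" for u
  have finFib [simp]: "finite (Fib u)" for u by (simp add: Fib_def)
  define T where "T R u = (\<Sum>w\<in>Fib u. y w * side R w)" for R u
  \<comment> \<open>The values \<open>side R\<close> agree at the ends of each edge of the chain
    over \<open>uv\<close>; replacing \<open>y\<close> by the boundary of that chain counts every
    edge twice.\<close>
  have T_eq: "T R u = T R v"
    if u: "u \<in> A" and v: "v \<in> B" and R: "R \<in> face_chains"
      and free: "\<And>w c. \<phi> w \<in> {u, v} \<Longrightarrow> bdry R (w, c) = 0" for R u v
  proof -
    define M where "M = Fib u \<union> Fib v"
    have finM: "finite M" by (simp add: M_def)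
    have inM: "\<phi> w \<in> {u, v}" "w \<in> V" if "w \<in> M" for w using that by (auto simp: M_def Fib_def)
    have yw: "y w = (\<Sum>c\<in>M. s u v w c)" if w: "w \<in> M" for w
    proof -
      have "(\<Sum>c\<in>M. s u v w c) = (\<Sum>c\<in>V. s u v w c)"
        using s0[OF u v] by (intro sum.mono_neutral_left) (auto simp: M_def Fib_def)
      then show ?thesis using bd[OF u v inM(2)[OF w] inM(1)[OF w]] by simp
    qed
    have "T R u + T R v = (\<Sum>w\<in>M. y w * side R w)"
      unfolding T_def M_def using ab[OF u v] by (subst sum.union_disjoint) (auto simp: Fib_def)
    also have "\<dots> = (\<Sum>w\<in>M. \<Sum>c\<in>M. s u v w c * side R w)"
      by (intro sum.cong) (simp_all add: yw sum_distrib_right)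
    also have "\<dots> = 0"
    proof (rule sum_sym_bit_eq_0[OF finM])
      fix w c
      show "s u v w c * side R w = s u v c w * side R c"
      proof (cases "s u v w c = 1")
        case False
        then show ?thesis using sym[OF u v, of w c] by simp
      next
        case True
        from supp[OF u v this] have "side R w = side R c"
          by (intro side_edge[OF R]) (auto intro: free)
        then show ?thesis using sym[OF u v, of w c] by simp
      qed
      show "s u v w w * side R w = 0" by (simp add: diag[OF u v])
    qed
    finally show ?thesis by simp
  qed
  note a_b = ab[OF a(1) b(1)] ab[OF a(1) b(2)] ab[OF a(1) b(3)] ab[OF a(2) b(1)] ab[OF a(2) b(2)] ab[OF a(2) b(3)]
    ab[OF a(3) b(1)] ab[OF a(3) b(2)] ab[OF a(3) b(3)]
  have "T R1 a1 = T R1 b3"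
    by (rule T_eq[OF a(1) b(3) R1(1)]) (use a b a_b in \<open>auto simp: R1(2) s0\<close>)
  moreover have "T R2 a2 = T R2 b3"
    by (rule T_eq[OF a(2) b(3) R2(1)]) (use a b a_b in \<open>auto simp: R2(2) s0\<close>)
  moreover have "T R3 a3 = T R3 b3"
    by (rule T_eq[OF a(3) b(3) R3(1)]) (use a b a_b in \<open>auto simp: R3(2) s0\<close>)
  moreover have "T R1 b3 = T R2 b3 + T R3 b3"
    by (simp add: T_def R1_def side_add distrib_left sum.distrib)
  \<comment> \<open>All three terms have been moved to \<open>b3\<close>, where they add up because
    \<open>R1 + R2 + R3 = 0\<close>.\<close>
  ultimately have zero: "T R1 a1 + T R2 a2 + T R3 a3 = 0" by (simp add: add_ac)

  define x where "x v w = s a1 b1 v w * R1 ((v, w), True) + s a2 b1 v w * R2 ((v, w), True) + s a3 b1 v w * R3 ((v, w), True)" for v w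
  \<comment> \<open>As in \<open>T_eq\<close>, edges inside the fibre over \<open>u\<close> cancel.
    The edges to the fibre over \<open>b1\<close> are left, and reversal reads their values from the
    end over \<open>b1\<close>.\<close>
  have T_b1: "T R u = (\<Sum>v\<in>Fib b1. \<Sum>w\<in>Fib u. s u b1 v w * R ((v, w), True))"
    if u: "u \<in> A" and R: "R \<in> face_chains" and free: "\<And>w c. \<phi> w = u \<Longrightarrow> bdry R (w, c) = 0" for R u
  proof -
    have yw: "y w = (\<Sum>c\<in>Fib u. s u b1 w c) + (\<Sum>c\<in>Fib b1. s u b1 w c)" if w: "w \<in> Fib u" for w
    proof -
      have "(\<Sum>c\<in>Fib u. s u b1 w c) + (\<Sum>c\<in>Fib b1. s u b1 w c) = (\<Sum>c\<in>Fib u \<union> Fib b1. s u b1 w c)"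
        using ab[OF u b(1)] by (subst sum.union_disjoint) (auto simp: Fib_def)
      also have "\<dots> = (\<Sum>c\<in>V. s u b1 w c)"
        using s0[OF u b(1)] by (intro sum.mono_neutral_left) (auto simp: Fib_def)
      finally show ?thesis using bd[OF u b(1), of w] w by (simp add: Fib_def)
    qed
    have "T R u = (\<Sum>w\<in>Fib u. \<Sum>c\<in>Fib u. s u b1 w c * side R w) + (\<Sum>w\<in>Fib u. \<Sum>v\<in>Fib b1. s u b1 w v * side R w)"
      unfolding T_def by (simp add: yw distrib_right sum.distrib sum_distrib_right)
    also have "(\<Sum>w\<in>Fib u. \<Sum>c\<in>Fib u. s u b1 w c * side R w) = (\<Sum>w\<in>Fib u. \<Sum>c\<in>Fib u. of_bool (\<phi> w = u \<and> \<phi> c = u) * (s u b1 w c * side R w))"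
      by (intro sum.cong) (auto simp: Fib_def)
    also have "\<dots> = 0"
    proof (rule sum_sym_bit_eq_0[OF finFib])
      fix w c
      show "of_bool (\<phi> w = u \<and> \<phi> c = u) * (s u b1 w c * side R w) = of_bool (\<phi> c = u \<and> \<phi> w = u) * (s u b1 c w * side R c)"
      proof (cases "s u b1 w c = 1 \<and> \<phi> w = u \<and> \<phi> c = u")
        case False
        then show ?thesis using sym[OF u b(1), of w c] by auto
      next
        case True
        then have "(w, c) \<in> E" using supp[OF u b(1)] by blast
        then have "side R w = side R c" using True by (intro side_edge[OF R]) (auto intro: free)
        then show ?thesis using sym[OF u b(1), of w c] True by simp
      qed
      show "of_bool (\<phi> w = u \<and> \<phi> w = u) * (s u b1 w w * side R w) = 0"
        by (simp add: diag[OF u b(1)])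
    qed
    also have "(\<Sum>w\<in>Fib u. \<Sum>v\<in>Fib b1. s u b1 w v * side R w) = (\<Sum>v\<in>Fib b1. \<Sum>w\<in>Fib u. s u b1 v w * R ((v, w), True))"
    proof (subst sum.swap, intro sum.cong refl)
      fix v w assume vw: "v \<in> Fib b1" "w \<in> Fib u"
      show "s u b1 w v * side R w = s u b1 v w * R ((v, w), True)"
      proof (cases "s u b1 v w = 1")
        case False
        then show ?thesis using sym[OF u b(1), of v w] by simp
      next
        case True
        then have "(v, w) \<in> E" using supp[OF u b(1)] by blast
        then have wv: "(w, v) \<in> E" by (rule arcs_symmetric)
        have "R ((v, w), True) = R ((w, v), if (w, v) \<in> N then True else \<not> True)"
          using face_chains_reversal[OF R wv, of True] by simp
        also have "\<dots> = side R w" using vw by (intro side_eq[OF R _ wv]) (simp add: free Fib_def)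
        finally show ?thesis using sym[OF u b(1), of v w] by simp
      qed
    qed
    finally show ?thesis by simp
  qed
  have bR: "bdry R1 (v, w) = s a2 b1 v w + s a3 b1 v w" "bdry R2 (v, w) = s a1 b1 v w + s a3 b1 v w"
    "bdry R3 (v, w) = s a1 b1 v w + s a2 b1 v w" if "\<phi> v = b1" for v w
    using that a b a_b by (simp_all add: R1(2) R2(2) R3(2) s0)
  have internal: "(\<Sum>v\<in>Fib b1. \<Sum>w\<in>Fib b1. x v w) = 0"
  proof -
    define x' where "x' v w = of_bool (\<phi> v = b1 \<and> \<phi> w = b1) * x v w" for v w
    have "(\<Sum>v\<in>Fib b1. \<Sum>w\<in>Fib b1. x v w) = (\<Sum>v\<in>Fib b1. \<Sum>w\<in>Fib b1. x' v w)"
      by (intro sum.cong) (auto simp: Fib_def x'_def)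
    also have "\<dots> = 0"
    proof (rule sum_sym_bit_eq_0[OF finFib])
      fix v w
      show "x' v w = x' w v"
      proof (cases "(v, w) \<in> E \<and> \<phi> v = b1 \<and> \<phi> w = b1")
        case False
        then consider "\<not> (\<phi> v = b1 \<and> \<phi> w = b1)" | "(v, w) \<notin> E" "(w, v) \<notin> E" using arcs_symmetric by blast
        then show ?thesis using s0 a b by cases (auto simp: x'_def x_def)
      next
        case True
        have rev: "R ((w, v), True) = R ((v, w), True) + of_bool ((v, w) \<notin> N) * bdry R (v, w)" if "R \<in> face_chains" for R
          using face_chains_reversal[OF that, of "(v, w)" True] True by (auto simp: bdry_def)
        have sy: "s a1 b1 w v = s a1 b1 v w" "s a2 b1 w v = s a2 b1 v w" "s a3 b1 w v = s a3 b1 v w"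
          using sym a b by blast+
        \<comment> \<open>Reversing an edge outside \<open>N\<close> changes each \<open>Ri\<close>
          by its boundary. By \<open>bR\<close> every product of two chains then occurs twice in the
          total change.\<close>
        have "x w v = x v w" 
          unfolding x_def rev[OF R1(1)] rev[OF R2(1)] rev[OF R3(1)] sy bR[OF conjunct1[OF conjunct2[OF True]]]
          by (cases "(v, w) \<in> N") (simp_all add: algebra_simps)
        then show ?thesis using True by (simp add: x'_def)
      qed
      show "x' v v = 0" using a b by (simp add: x'_def x_def diag)
    qed
    finally show ?thesis .
  qed
  have x_split: "(\<Sum>w\<in>V. x v w) = (\<Sum>w\<in>Fib a1. s a1 b1 v w * R1 ((v, w), True)) + (\<Sum>w\<in>Fib a2. s a2 b1 v w * R2 ((v, w), True))
      + (\<Sum>w\<in>Fib a3. s a3 b1 v w * R3 ((v, w), True)) + (\<Sum>w\<in>Fib b1. x v w)" if v: "v \<in> Fib b1" for v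
  proof -
    have "(\<Sum>w\<in>V. x v w) = (\<Sum>w\<in>Fib a1 \<union> Fib a2 \<union> Fib a3 \<union> Fib b1. x v w)"
      using s0 a b by (intro sum.mono_neutral_right) (auto simp: Fib_def x_def)
    also have "\<dots> = (\<Sum>w\<in>Fib a1. x v w) + (\<Sum>w\<in>Fib a2. x v w) + (\<Sum>w\<in>Fib a3. x v w) + (\<Sum>w\<in>Fib b1. x v w)"
    proof -
      have "(Fib a1 \<union> Fib a2 \<union> Fib a3) \<inter> Fib b1 = {}" "(Fib a1 \<union> Fib a2) \<inter> Fib a3 = {}" "Fib a1 \<inter> Fib a2 = {}"
        using a a_b by (auto simp: Fib_def)
      then show ?thesis by (simp add: sum.union_disjoint)
    qed
    also have "(\<Sum>w\<in>Fib a1. x v w) = (\<Sum>w\<in>Fib a1. s a1 b1 v w * R1 ((v, w), True))"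
      using s0 a b a_b by (intro sum.cong) (auto simp: Fib_def x_def)
    also have "(\<Sum>w\<in>Fib a2. x v w) = (\<Sum>w\<in>Fib a2. s a2 b1 v w * R2 ((v, w), True))"
      using s0 a b a_b by (intro sum.cong) (auto simp: Fib_def x_def)
    also have "(\<Sum>w\<in>Fib a3. x v w) = (\<Sum>w\<in>Fib a3. s a3 b1 v w * R3 ((v, w), True))"
      using s0 a b a_b by (intro sum.cong) (auto simp: Fib_def x_def)
    finally show ?thesis .
  qed
  have "T R1 a1 = (\<Sum>v\<in>Fib b1. \<Sum>w\<in>Fib a1. s a1 b1 v w * R1 ((v, w), True))"
    by (rule T_b1[OF a(1) R1(1)]) (use a b a_b in \<open>simp add: R1(2) s0\<close>)
  moreover have "T R2 a2 = (\<Sum>v\<in>Fib b1. \<Sum>w\<in>Fib a2. s a2 b1 v w * R2 ((v, w), True))"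
    by (rule T_b1[OF a(2) R2(1)]) (use a b a_b in \<open>simp add: R2(2) s0\<close>)
  moreover have "T R3 a3 = (\<Sum>v\<in>Fib b1. \<Sum>w\<in>Fib a3. s a3 b1 v w * R3 ((v, w), True))"
    by (rule T_b1[OF a(3) R3(1)]) (use a b a_b in \<open>simp add: R3(2) s0\<close>)
  ultimately have sum_x: "(\<Sum>v\<in>Fib b1. \<Sum>w\<in>V. x v w) = T R1 a1 + T R2 a2 + T R3 a3"
    by (simp add: x_split sum.distrib internal)

  define Q where "Q v w = s a1 b1 v w * s a2 b1 v w + s a1 b1 v w * s a3 b1 v w + s a2 b1 v w * s a3 b1 v w" for v w
  \<comment> \<open>A full tour around \<open>v\<close>, where all three paths arrive with the same
    parity \<open>y v\<close>. \<open>Q\<close> accounts for edges used by two of the paths.\<close>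
  have corner: "(\<Sum>w\<in>V. x v w) = y v + (\<Sum>w\<in>V. Q v w)" if v: "v \<in> Fib b1" for v
  proof (cases "\<exists>w. (v, w) \<in> E")
    case False
    have "s u b1 v w = 0" if "u \<in> A" for u w using s0[OF that b(1)] False by blast
    moreover have "y v = (\<Sum>w\<in>V. s a1 b1 v w)" using bd[OF a(1) b(1), of v] v by (simp add: Fib_def)
    ultimately show ?thesis using a by (simp add: x_def Q_def)
  next
    case True
    then obtain w0 where e0: "(v, w0) \<in> E" by blast
    have \<phi>v: "\<phi> v = b1" and vV: "v \<in> V" using v by (auto simp: Fib_def)
    define Out where "Out = {e\<in>E. fst e = v}"
    have cycO: "cyclic_on \<pi> Out" unfolding Out_def using e0 vV by (intro cyc) auto
    have e0O: "(v, w0) \<in> Out" using e0 by (simp add: Out_def)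
    define n where "n = funpow_dist1 \<pi> (v, w0) (v, w0)"
    define e where "e t = (\<pi> ^^ t) (v, w0)" for t
    have orb: "orbit \<pi> (v, w0) = Out" by (rule orbit_cyclic_eq3[OF cycO e0O])
    then have self: "(v, w0) \<in> orbit \<pi> (v, w0)" using e0O by simp
    have eO: "e ` {..<n} = Out"
      using orbit_conv_funpow_dist1[OF self] orb by (simp add: e_def[abs_def] n_def lessThan_atLeast0)
    have inj: "inj_on e {..<n}"
      using inj_on_funpow_dist1[OF self] by (simp add: e_def[abs_def] n_def lessThan_atLeast0)
    have et: "e t \<in> E" "fst (e t) = v" for t
      using cyclic_on_funpow_in[OF cycO e0O, of t] by (auto simp: Out_def e_def)
    have sumO: "(\<Sum>w\<in>V. g v w) = (\<Sum>t<n. g v (snd (e t)))"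
      if g: "\<And>w. (v, w) \<notin> E \<Longrightarrow> g v w = 0" for g :: "'a \<Rightarrow> 'a \<Rightarrow> bit"
    proof -
      have "(\<Sum>w\<in>V. g v w) = (\<Sum>w\<in>V. (\<lambda>(a, b). of_bool ((a, b) \<in> E) * g a b) (v, w))"
      proof (intro sum.cong refl)
        fix w
        show "g v w = (\<lambda>(a, b). of_bool ((a, b) \<in> E) * g a b) (v, w)"
          using g[of w] by (cases "(v, w) \<in> E") simp_all
      qed
      also have "\<dots> = (\<Sum>e\<in>{e\<in>E. fst e = v}. (\<lambda>(a, b). of_bool ((a, b) \<in> E) * g a b) e)"
        by (rule sum_out) auto
      also have "\<dots> = (\<Sum>t<n. (\<lambda>(a, b). of_bool ((a, b) \<in> E) * g a b) (e t))"
        unfolding Out_def[symmetric] eO[symmetric] by (rule sum.reindex_cong[OF inj]) auto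
      also have "\<dots> = (\<Sum>t<n. g v (snd (e t)))"
      proof (intro sum.cong refl)
        fix t
        show "(\<lambda>(a, b). of_bool ((a, b) \<in> E) * g a b) (e t) = g v (snd (e t))"
          using et[of t] by (cases "e t") simp
      qed
      finally show ?thesis .
    qed
    have et_eq: "e t = (v, snd (e t))" for t using et(2)[of t] by (metis prod.collapse)
    have step: "R (e (Suc t), True) = R (e t, True) + bdry R (e t)" if "R \<in> face_chains" for R t
      using face_chains_pi[OF that et(1)[of t]] by (simp add: e_def bdry_def)
    define p where "p u t = s u b1 v (snd (e t))" for u t
    have N: "(\<Sum>t<n. p u t) = y v" if "u \<in> A" for u
    proof -
      have "(\<Sum>t<n. p u t) = (\<Sum>w\<in>V. s u b1 v w)"
        unfolding p_def using s0[OF that b(1)] by (intro sumO[symmetric]) blast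
      also have "\<dots> = y v" using bd[OF that b(1) vV] \<phi>v by simp
      finally show ?thesis .
    qed
    have "(\<Sum>t<n. p a1 t * R1 (e t, True) + p a2 t * R2 (e t, True) + p a3 t * R3 (e t, True)) =
        (\<Sum>t<n. p a1 t) * R1 (e 0, True) + (\<Sum>t<n. p a2 t) * R2 (e 0, True) + (\<Sum>t<n. p a3 t) * R3 (e 0, True) +
        ((\<Sum>t<n. p a1 t) * (\<Sum>t<n. p a2 t) + (\<Sum>t<n. p a1 t) * (\<Sum>t<n. p a3 t) + (\<Sum>t<n. p a2 t) * (\<Sum>t<n. p a3 t)) +
        (\<Sum>t<n. p a1 t * p a2 t + p a1 t * p a3 t + p a2 t * p a3 t)"
    proof (rule corner_sum)
      fix t
      have et': "bdry R (e t) = bdry R (v, snd (e t))" for R using et_eq[of t] by simp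
      show "R1 (e (Suc t), True) = R1 (e t, True) + (p a2 t + p a3 t)"
        "R2 (e (Suc t), True) = R2 (e t, True) + (p a1 t + p a3 t)"
        "R3 (e (Suc t), True) = R3 (e t, True) + (p a1 t + p a2 t)"
        unfolding step[OF R1(1)] step[OF R2(1)] step[OF R3(1)] et' bR[OF \<phi>v] p_def by simp_all
    qed
    \<comment> \<open>All three counts equal \<open>y v\<close>: the initial values cancel because
      \<open>R1 = R2 + R3\<close>, and the three products of counts add up to
      \<open>y v\<close>.\<close>
    also have "\<dots> = y v + (\<Sum>t<n. p a1 t * p a2 t + p a1 t * p a3 t + p a2 t * p a3 t)"
      unfolding N[OF a(1)] N[OF a(2)] N[OF a(3)] R1_def
      by (cases "y v"; cases "R2 (e 0, True)"; cases "R3 (e 0, True)") simp_all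
    also have "(\<Sum>t<n. p a1 t * p a2 t + p a1 t * p a3 t + p a2 t * p a3 t) = (\<Sum>w\<in>V. Q v w)"
      unfolding p_def Q_def[symmetric] using s0[OF _ b(1)] a by (intro sumO[symmetric]) (simp add: Q_def)
    also have "(\<Sum>t<n. p a1 t * R1 (e t, True) + p a2 t * R2 (e t, True) + p a3 t * R3 (e t, True)) = (\<Sum>t<n. x v (snd (e t)))"
      by (intro sum.cong) (simp_all add: x_def p_def et_eq[symmetric])
    also have "\<dots> = (\<Sum>w\<in>V. x v w)"
      using s0[OF _ b(1)] a by (intro sumO[symmetric]) (simp add: x_def)
    finally show ?thesis .
  qed
  \<comment> \<open>An edge leaving the fibre over \<open>b1\<close> lies in at most one of the
    three chains, so \<open>Q\<close> lives inside that fibre, where it is symmetric.\<close>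
  have Qsum: "(\<Sum>v\<in>Fib b1. \<Sum>w\<in>V. Q v w) = 0"
  proof -
    have Q0: "Q v w = 0" if "\<phi> w \<noteq> b1" for v w
    proof -
      have p0: "s u b1 v w = 0" if "u \<in> A" "\<phi> w \<noteq> u" for u using s0[OF that(1) b(1)] that \<open>\<phi> w \<noteq> b1\<close> by blast
      consider "\<phi> w \<noteq> a1" "\<phi> w \<noteq> a2" | "\<phi> w \<noteq> a1" "\<phi> w \<noteq> a3" | "\<phi> w \<noteq> a2" "\<phi> w \<noteq> a3" using a by auto
      then show ?thesis using a by cases (simp_all add: Q_def p0)
    qed
    have "(\<Sum>w\<in>V. Q v w) = (\<Sum>w\<in>Fib b1. Q v w)" for v
      by (rule sum.mono_neutral_right) (auto simp: Fib_def Q0)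
    then have "(\<Sum>v\<in>Fib b1. \<Sum>w\<in>V. Q v w) = (\<Sum>v\<in>Fib b1. \<Sum>w\<in>Fib b1. Q v w)" by simp
    also have "\<dots> = 0"
    proof (rule sum_sym_bit_eq_0[OF finFib])
      fix v w
      show "Q v w = Q w v" using sym[OF a(1) b(1), of v w] sym[OF a(2) b(1), of v w] sym[OF a(3) b(1), of v w]
        by (simp add: Q_def)
      show "Q v v = 0" using a b by (simp add: Q_def diag)
    qed
    finally show ?thesis .
  qed
  have "(\<Sum>v\<in>Fib b1. \<Sum>w\<in>V. x v w) = (\<Sum>v\<in>Fib b1. y v)"
    by (simp add: corner sum.distrib Qsum)
  also have "\<dots> = 1" using fib[of b1] b by (simp add: Fib_def)
  finally show False using sum_x zero by simp
qed

theorem no_chain_rep: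
  assumes genus: "scheme_genus G \<pi> N \<le> int k"
    and AB: "A \<inter> B = {}" "3 \<le> card A" "4 ^ k + 2 \<le> card B"
  shows "\<not> chain_rep A B G \<phi> y s"
proof
  assume rep: "chain_rep A B G \<phi> y s"
  note sym = chain_repD(1)[OF rep] and supp = chain_repD(2)[OF rep] and bd = chain_repD(3)[OF rep]
  obtain a1 a2 a3 where a: "a1 \<in> A" "a2 \<in> A" "a3 \<in> A" "a1 \<noteq> a2" "a1 \<noteq> a3" "a2 \<noteq> a3"
  proof -
    obtain A' where "A' \<subseteq> A" "card A' = 3" using AB(2) by (meson obtain_subset_with_card_n)
    then show ?thesis using that by (auto simp: card_3_iff)
  qed
  have ab: "u \<noteq> v" if "u \<in> A" "v \<in> B" for u v using AB that by auto
  have "B \<noteq> {}" using AB(3) by auto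
  then obtain b0 where b0: "b0 \<in> B" by blast
  \<comment> \<open>The image of the 4-cycle through \<open>a1\<close>, \<open>b0\<close>,
    \<open>a'\<close>, \<open>b\<close>. In \<open>g a' b1 + g a' b2\<close> the edges at
    \<open>b0\<close> cancel, which leaves the 4-cycle through \<open>b1\<close> and
    \<open>b2\<close>; for \<open>a2\<close> and \<open>a3\<close> these are two of the three cycles
    of the theta graph, and the third is their sum.\<close>
  define g where "g a' b e = s a1 b0 (fst e) (snd e) + s a' b0 (fst e) (snd e) + (s a1 b (fst e) (snd e) + s a' b (fst e) (snd e))" for a' b e
  have s0: "s u v c d = 0" if "u \<in> A" "v \<in> B" "(c, d) \<notin> E" for u v c d
    using supp[OF that(1,2), of c d] that(3) by (cases "s u v c d") auto
  have bdC: "(\<Sum>w\<in>V. s u v c w) = of_bool (\<phi> c \<in> {u, v}) * y c" if "u \<in> A" "v \<in> B" "c \<in> V" for u v c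
  proof (cases "\<phi> c \<in> {u, v}")
    case True
    then show ?thesis using bd[OF that True] by simp
  next
    case False
    then have "s u v c w = 0" for w using supp[OF that(1,2), of c w] by (cases "s u v c w") auto
    then show ?thesis using False by simp
  qed
  have gZ: "g a' b \<in> cycles" if a': "a' \<in> A" "a' \<noteq> a1" and b: "b \<in> B" for a' b
    unfolding cycles_def edge_chains_def
  proof (intro CollectI conjI allI impI ballI)
    show "g a' b e = 0" if "e \<notin> E" for e
      using that s0 a a' b b0 by (cases e) (simp add: g_def)
    show "g a' b (prod.swap e) = g a' b e" for e
      using sym[OF a(1) b, of "fst e" "snd e"] sym[OF a(1) b0, of "fst e" "snd e"]
        sym[OF a'(1) b, of "fst e" "snd e"] sym[OF a'(1) b0, of "fst e" "snd e"] by (simp add: g_def)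
    fix v assume v: "v \<in> V"
    have "(\<Sum>w\<in>V. g a' b (v, w)) = (of_bool (\<phi> v \<in> {a1, b0}) + of_bool (\<phi> v \<in> {a', b0}) +
        (of_bool (\<phi> v \<in> {a1, b}) + of_bool (\<phi> v \<in> {a', b}))) * y v"
      using a(1) a' b b0 v by (simp add: g_def sum.distrib bdC distrib_right del: insert_iff)
    also have "\<dots> = 0"
      using a'(2) ab[OF a(1) b] ab[OF a(1) b0] ab[OF a'(1) b] ab[OF a'(1) b0] by (cases "b = b0") auto
    finally show "(\<Sum>w\<in>V. g a' b (v, w)) = 0" .
  qed
  obtain b1 b2 where b12: "b1 \<in> B" "b2 \<in> B" "b1 \<noteq> b2"
    "(\<lambda>e. g a2 b1 e + g a2 b2 e) \<in> boundaries" "(\<lambda>e. g a3 b1 e + g a3 b2 e) \<in> boundaries"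
  proof (rule pigeonhole_homology[OF genus, of B "g a2" "g a3"])
    show "g a2 b \<in> cycles" "g a3 b \<in> cycles" if "b \<in> B" for b using gZ[OF _ _ that] a by auto
    show "4 ^ k < card B" using AB(3) by simp
  qed (rule that)
  have "3 \<le> card B" using AB(3) one_le_power[of "4::nat" k] by linarith
  then have "\<not> B \<subseteq> {b1, b2}" using card_mono[of "{b1, b2}" B] card_insert_le_m1[of 2 "{b2}" b1] by auto
  then obtain b3 where b3: "b3 \<in> B" "b3 \<noteq> b1" "b3 \<noteq> b2" by blast
  from b12(4) obtain R3 where R3: "R3 \<in> face_chains" "bdry R3 = (\<lambda>e. g a2 b1 e + g a2 b2 e)"
    by (auto simp: boundaries_def)
  from b12(5) obtain R2 where R2: "R2 \<in> face_chains" "bdry R2 = (\<lambda>e. g a3 b1 e + g a3 b2 e)"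
    by (auto simp: boundaries_def)
  show False
  proof (rule chain_rep_theta[OF rep AB(1) a b12(1,2) b3(1) b12(3) b3(2,3)[symmetric] R2(1) _ R3(1)])
    show "bdry R2 (v, w) = s a1 b1 v w + s a1 b2 v w + (s a3 b1 v w + s a3 b2 v w)" for v w
      by (simp add: R2(2) g_def algebra_simps)
    show "bdry R3 (v, w) = s a1 b1 v w + s a1 b2 v w + (s a2 b1 v w + s a2 b2 v w)" for v w
      by (simp add: R3(2) g_def algebra_simps)
  qed
qed

end

section \<open>Complete bipartite graphs\<close>

definition complete_bipartite :: "nat \<Rightarrow> nat \<Rightarrow> nat pair_pre_digraph" where
  "complete_bipartite m n = \<lparr> pverts = {..<m + n},
     parcs = {..<m} \<times> {m..<m + n} \<union> {m..<m + n} \<times> {..<m} \<rparr>"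

lemma pair_graph_complete_bipartite: "pair_graph (complete_bipartite m n)"
  by unfold_locales (auto simp: complete_bipartite_def symmetric_def sym_def)

lemma clique_sum_closureI:
  assumes G: "G \<in> \<C>" "pair_graph G"
  shows "G \<in> clique_sum_closure \<C> s"
proof -
  define T :: "nat pair_pre_digraph" where "T = \<lparr> pverts = {0}, parcs = {} \<rparr>"
  have T: "pair_graph T" by unfold_locales (auto simp: T_def symmetric_def sym_def)
  interpret T: pair_graph T by (rule T)
  have con: "connected (with_proj \<lparr> pverts = {0::nat}, parcs = {} \<rparr>)"
    by (auto simp: connected_conv)
  have "sym_tree T"
    unfolding sym_tree_def
  proof (intro conjI T notI)
    show "connected (with_proj T)" using con by (simp add: T_def)
    assume "\<exists>p. pre_digraph.cycle (with_proj T) p \<and> 3 \<le> length p"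
    then obtain p where p: "pre_digraph.cycle (with_proj T) p" "3 \<le> length p" by blast
    then obtain u where "T.awalk u p u" unfolding T.cycle_def by blast
    then have "set p \<subseteq> parcs T" by (auto simp: T.awalk_def)
    with p(2) show False by (auto simp: T_def)
  qed
  moreover have "pair_induce T {t. t = 0} = \<lparr> pverts = {0::nat}, parcs = {} \<rparr>"
    by (simp add: T_def pair_induce_def)
  ultimately have "tree_decomposition G T (\<lambda>_. pverts G)"
    using con pair_graph.axioms(1)[OF G(2)]
    by (auto simp: tree_decomposition_def T_def pair_digraph_def pair_fin_digraph_def
         dest: pair_wf_digraph.in_arcsD1 pair_wf_digraph.in_arcsD2)
  moreover have "torso G (pverts G) \<in> \<C>" using G by (simp add: torso_pverts)
  ultimately show ?thesis
    using G(2) unfolding clique_sum_closure_def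
    by (auto simp: T_def intro!: exI[of _ T] exI[of _ "\<lambda>_. pverts G"])
qed

text \<open>A labelling that \<open>f\<close> preserves separates orbits. It yields a lower bound
  for the number of faces without determining the orbits.\<close>

lemma card_orbits_ge:
  assumes "finite S" "\<And>x. x \<in> S \<Longrightarrow> f x \<in> S" "\<And>x. x \<in> S \<Longrightarrow> I (f x) = I x" 
  shows "card (I ` S) \<le> card (orbit f ` S)"
proof -
  have inv: "y \<in> S \<and> I y = I x" if "y \<in> orbit f x" "x \<in> S" for x y
    using that by induction (auto simp: assms)
  have "I ` S \<subseteq> (\<lambda>Q. I (SOME y. y \<in> Q)) ` orbit f ` S"
  proof
    fix c assume "c \<in> I ` S"
    then obtain x where x: "x \<in> S" "c = I x" by blast
    have "(SOME y. y \<in> orbit f x) \<in> orbit f x" by (meson orbit.base someI_ex)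
    with inv x have "c = I (SOME y. y \<in> orbit f x)" by auto
    with x show "c \<in> (\<lambda>Q. I (SOME y. y \<in> Q)) ` orbit f ` S" by blast
  qed
  then show ?thesis
    using assms(1) by (meson card_image_le card_mono finite_imageI order_trans)
qed

text \<open>In the plane, the vertices \<open>0\<close> and \<open>1\<close> see the other side in opposite cyclic orders.\<close>

definition k2n_rot :: "nat \<Rightarrow> nat \<Rightarrow> nat \<times> nat \<Rightarrow> nat \<times> nat" where
  "k2n_rot m n = (\<lambda>(u, v).
     if u = 0 \<and> m \<le> v \<and> v < m + n then (0, m + Suc (v - m) mod n)
     else if u = 1 \<and> m \<le> v \<and> v < m + n then (1, m + (v - m + (n - 1)) mod n)
     else if m \<le> u \<and> u < m + n \<and> v < 2 then (u, 1 - v)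
     else (u, v))"

text \<open>Euler's formula with one component, \<open>n + 2\<close> vertices, \<open>2 * n\<close>
  edges and at least \<open>n\<close> faces: 2 - (n + 2 - 2n + n) = 0.\<close>

lemma euler_genus_K2n:
  assumes m: "2 \<le> m" and n: "1 \<le> n"
  shows "euler_genus (pair_induce (complete_bipartite m n) ({0, 1} \<union> {m..<m + n})) = 0" 
proof -
  define H where "H = pair_induce (complete_bipartite m n) ({0, 1} \<union> {m..<m + n})"
  let ?r = "k2n_rot m n"
  define B where "B = {m..<m + n}"
  have G: "pverts H = {0, 1} \<union> B" "parcs H = {0, 1} \<times> B \<union> B \<times> {0, 1}"
    using m by (auto simp: H_def pair_induce_def complete_bipartite_def B_def)
  have finB: "finite B" and cardB: "card B = n" by (auto simp: B_def)
  have 01: "0 \<notin> B" "1 \<notin> B" "Suc 0 \<notin> B" using m by (auto simp: B_def)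
  \<comment> \<open>The inverse rotation in closed form, with the roles of \<open>0\<close> and
    \<open>1\<close> exchanged.\<close>
  define rinv where "rinv = (\<lambda>(u, v).
     if u = 1 \<and> v \<in> B then (1, m + Suc (v - m) mod n)
     else if u = 0 \<and> v \<in> B then (0, m + (v - m + (n - 1)) mod n)
     else if u \<in> B \<and> v < 2 then (u, 1 - v)
     else (u, v :: nat))"
  have inB: "m + i mod n \<in> B" for i using n by (simp add: B_def)
  have sp: "m + (Suc (v - m) mod n + (n - 1)) mod n = v" if "v \<in> B" for v
  proof -
    have "(Suc (v - m) mod n + (n - 1)) mod n = (Suc (v - m) + (n - 1)) mod n" by (rule mod_add_left_eq)
    also have "Suc (v - m) + (n - 1) = (v - m) + n" using n by simp
    finally show ?thesis using that by (auto simp: B_def)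
  qed
  have ps: "m + Suc ((v - m + (n - 1)) mod n) mod n = v" if "v \<in> B" for v
  proof -
    have "Suc ((v - m + (n - 1)) mod n) mod n = Suc (v - m + (n - 1)) mod n" by (rule mod_Suc_eq)
    also have "Suc (v - m + (n - 1)) = (v - m) + n" using n by simp
    finally show ?thesis using that by (auto simp: B_def)
  qed
  have r: "?r (0, v) = (0, m + Suc (v - m) mod n)" "?r (1, v) = (1, m + (v - m + (n - 1)) mod n)"
     "?r (v, 0) = (v, 1)" "?r (v, 1) = (v, 0)" if "v \<in> B" for v
    using that m by (auto simp: k2n_rot_def B_def)
  have ri: "rinv (0, v) = (0, m + (v - m + (n - 1)) mod n)" "rinv (1, v) = (1, m + Suc (v - m) mod n)"
     "rinv (v, 0) = (v, 1)" "rinv (v, 1) = (v, 0)" if "v \<in> B" for v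
    using that m 01 by (auto simp: rinv_def B_def)
  have arcE: "P e" if "e \<in> parcs H" "\<And>v. v \<in> B \<Longrightarrow> P (0, v)" "\<And>v. v \<in> B \<Longrightarrow> P (1, v)"
      "\<And>v. v \<in> B \<Longrightarrow> P (v, 0)" "\<And>v. v \<in> B \<Longrightarrow> P (v, 1)" for P e
    using that unfolding G by auto
  have outside: "?r e = e" if "e \<notin> parcs H" for e
    using that unfolding G by (cases e) (auto simp: k2n_rot_def B_def less_2_cases_iff)
  have r_in: "?r e \<in> parcs H" if "e \<in> parcs H" for e
    using that by (rule arcE) (auto simp: r G inB simp del: One_nat_def)
  have rinv_in: "rinv e \<in> parcs H" if "e \<in> parcs H" for e
    using that by (rule arcE) (auto simp: ri G inB simp del: One_nat_def)
  have rinv_r: "rinv (?r e) = e" if "e \<in> parcs H" for e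
    using that by (rule arcE) (auto simp: r ri inB sp ps simp del: One_nat_def)
  have r_rinv: "?r (rinv e) = e" if "e \<in> parcs H" for e
    using that by (rule arcE) (auto simp: r ri inB sp ps simp del: One_nat_def)
  have bij: "bij_betw ?r (parcs H) (parcs H)"
    by (rule bij_betw_byWitness[where f' = rinv]) (use r_in rinv_in rinv_r r_rinv in auto)
  then have perm: "?r permutes parcs H"
    by (rule bij_imp_permutes) (use outside in auto)
  have inv_r: "inv ?r e = rinv e" if "e \<in> parcs H" for e
    using r_rinv[OF that] perm by (metis permutes_inverses(2))
  have out: "out_arcs (with_proj H) v = {e \<in> parcs H. fst e = v}" for v
    by (auto simp: out_arcs_def)
  have cyc: "cyclic_on ?r (out_arcs (with_proj H) v)" if v: "v \<in> pverts H" for v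
  proof -
    consider "v = 0" | "v = 1" | "v \<in> B" using v G by auto
    then show ?thesis
    proof cases
      case 1
      have "cyclic_on ?r ((\<lambda>i. (0, m + i)) ` {..<n})"
        by (rule cyclic_on_mod) (use n in \<open>auto simp: r B_def\<close>)
      also have "(\<lambda>i. (0, m + i)) ` {..<n} = {0} \<times> B"
      proof -
        have "(\<lambda>i. m + i) ` {..<n} = B"
        proof (intro equalityI subsetI)
          fix x assume "x \<in> B"
          then have "x = m + (x - m)" "x - m \<in> {..<n}" by (auto simp: B_def)
          then show "x \<in> (\<lambda>i. m + i) ` {..<n}" by (rule image_eqI)
        qed (auto simp: B_def)
        then show ?thesis by auto
      qed
      also have "{0} \<times> B = out_arcs (with_proj H) v" using 1 01 by (auto simp: out G)
      finally show ?thesis .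
    next
      case 2
      have st: "?r (1, m + (n - 1 - i)) = (1, m + (n - 1 - Suc i mod n))" if i: "i < n" for i
      proof (cases "Suc i < n")
        case True
        have "n - 1 - i + (n - 1) = (n - 1 - Suc i) + n" using True by simp
        then have "(n - 1 - i + (n - 1)) mod n = (n - 1 - Suc i) mod n" by (simp only: mod_add_self2)
        also have "\<dots> = n - 1 - Suc i" using True by simp
        finally have "(n - 1 - i + (n - 1)) mod n = n - 1 - Suc i" .
        then show ?thesis using True by (simp add: r B_def del: One_nat_def)
      next
        case False
        then have "i = n - 1" "Suc i = n" using i by auto
        then show ?thesis using n by (simp add: r B_def del: One_nat_def)
      qed
      have "cyclic_on ?r ((\<lambda>i. (1, m + (n - 1 - i))) ` {..<n})"
        by (rule cyclic_on_mod) (use n st in auto)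
      also have "(\<lambda>i. (1::nat, m + (n - 1 - i))) ` {..<n} = {1} \<times> B"
      proof -
        have "(\<lambda>i. m + (n - 1 - i)) ` {..<n} = B"
        proof (intro equalityI subsetI)
          fix x assume "x \<in> B"
          then have "x = m + (n - 1 - (n - 1 - (x - m)))" "n - 1 - (x - m) \<in> {..<n}" by (auto simp: B_def)
          then show "x \<in> (\<lambda>i. m + (n - 1 - i)) ` {..<n}" by (rule image_eqI)
        qed (use n in \<open>auto simp: B_def\<close>)
        then show ?thesis by auto
      qed
      also have "{1} \<times> B = out_arcs (with_proj H) v" using 2 01 by (auto simp: out G)
      finally show ?thesis .
    next
      case 3
      have "cyclic_on ?r ((\<lambda>i. (v, i)) ` {..<2})"
        by (rule cyclic_on_mod) (use r[OF 3] in \<open>auto simp: less_2_cases_iff mod_Suc\<close>)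
      also have "(\<lambda>i. (v, i)) ` {..<2} = out_arcs (with_proj H) v"
        using 3 01 by (auto simp: out G lessThan_nat_numeral lessThan_Suc)
      finally show ?thesis .
    qed
  qed
  have es: "embedding_scheme H ?r {}"
    using perm cyc by (auto simp: embedding_scheme_def)
  define S where "S = parcs H \<times> (UNIV :: bool set)"
  \<comment> \<open>The faces are the 4-cycles through \<open>0\<close>, \<open>1\<close> and two
    cyclically consecutive vertices of \<open>B\<close>. A state is labelled by the later of these
    two vertices and by its direction \<open>s\<close>, which gives two labels per face.\<close>
  define I where "I = (\<lambda>((u, v), s).
     if u = 0 \<and> s \<or> v = 1 \<and> s then ((if u = 0 then v else u), s)
     else if s then (m + Suc ((if u = 1 then v else u) - m) mod n, s)
     else if u = 1 \<or> v = 0 then ((if u = 1 then v else u), s)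
     else (m + Suc ((if u = 0 then v else u) - m) mod n, s))"
  have fs: "face_succ ?r {} (a, s) = (if s then ?r (prod.swap a) else rinv (prod.swap a), s)"
    if "a \<in> parcs H" for a s
    using that inv_r[of "prod.swap a"] by (auto simp: face_succ_def G)
  have swp: "prod.swap a \<in> parcs H" if "a \<in> parcs H" for a using that by (auto simp: G)
  have "card (I ` S) \<le> card (orbit (face_succ ?r {}) ` S)"
  proof (rule card_orbits_ge)
    show "finite S" using finB by (simp add: S_def G)
    show "face_succ ?r {} x \<in> S" if "x \<in> S" for x
      using that r_in[OF swp] rinv_in[OF swp] by (cases x) (auto simp: S_def fs)
    show "I (face_succ ?r {} x) = I x" if x: "x \<in> S" for x
    proof -
      obtain a s where as: "x = (a, s)" by (cases x)
      then have "a \<in> parcs H" using x by (simp add: S_def)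
      then have "I (face_succ ?r {} (a, s)) = I (a, s)"
      proof (rule arcE)
        fix v assume v: "v \<in> B"
        have v01: "v \<noteq> 0" "v \<noteq> 1" using v 01(1,2) by metis+
        have arcs: "(0, v) \<in> parcs H" "(1, v) \<in> parcs H" "(v, 0) \<in> parcs H" "(v, 1) \<in> parcs H"
          using v by (auto simp: G)
        show "I (face_succ ?r {} ((0, v), s)) = I ((0, v), s)"
          using v v01 by (simp add: fs[OF arcs(1)] r ri I_def del: One_nat_def)
        show "I (face_succ ?r {} ((1, v), s)) = I ((1, v), s)"
          using v v01 by (simp add: fs[OF arcs(2)] r ri I_def del: One_nat_def)
        show "I (face_succ ?r {} ((v, 0), s)) = I ((v, 0), s)"
          using v v01 inB m by (simp add: fs[OF arcs(3)] r ri I_def ps del: One_nat_def)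
        show "I (face_succ ?r {} ((v, 1), s)) = I ((v, 1), s)"
          using v v01 inB m by (simp add: fs[OF arcs(4)] r ri I_def ps del: One_nat_def)
      qed
      then show "I (face_succ ?r {} x) = I x" by (simp add: as)
    qed
  qed
  moreover have "B \<times> UNIV \<subseteq> I ` S"
  proof (intro subsetI)
    fix p :: "nat \<times> bool" assume p: "p \<in> B \<times> UNIV"
    then obtain b s where bs: "p = (b, s)" "b \<in> B" by auto
    have "p = I ((if s then 0 else 1, b), s)" using bs 01 by (auto simp: I_def)
    moreover have "((if s then 0 else 1, b), s) \<in> S" using bs by (auto simp: S_def G)
    ultimately show "p \<in> I ` S" by blast
  qed
  then have "card (B \<times> (UNIV :: bool set)) \<le> card (I ` S)"
    using finB by (intro card_mono) (auto simp: S_def G)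
  ultimately have faces: "n \<le> num_faces H ?r {}"
    by (simp add: num_faces_def S_def[symmetric] card_cartesian_product cardB)
  have "pair_graph H"
    unfolding H_def by (rule pair_graph_pair_induce[OF pair_graph_complete_bipartite]) (use m in \<open>auto simp: complete_bipartite_def\<close>)
  note pg = this
  interpret pair_graph H by (rule pg)
  have mB: "m \<in> B" using n by (simp add: B_def)
  have to0: "(u, 0) \<in> (parcs H)\<^sup>*" if "u \<in> pverts H" for u
  proof -
    have bto0: "(b, 0) \<in> (parcs H)\<^sup>*" if "b \<in> B" for b using that by (auto simp: G)
    have "(1, m) \<in> parcs H" using mB by (simp add: G)
    with bto0[OF mB] have "(1, 0) \<in> (parcs H)\<^sup>*" by (meson converse_rtrancl_into_rtrancl)
    with bto0 that show ?thesis unfolding G by auto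
  qed
  have "(u, v) \<in> (parcs H)\<^sup>*" if "u \<in> pverts H" "v \<in> pverts H" for u v
    by (rule rtrancl_trans[OF to0[OF that(1)] sym_rtrancl_parcs[OF to0[OF that(2)]]])
  then have "{v. (u, v) \<in> (parcs H)\<^sup>*} = pverts H" if "u \<in> pverts H" for u
    using rtrancl_in_verts that by blast
  then have "comps H \<subseteq> {pverts H}" unfolding comps_eq[OF pg] by blast
  then have comps1: "card (comps H) \<le> 1"
    by (metis card.empty card_mono finite.emptyI finite.insertI is_singletonI is_singleton_altdef)
  have "card (parcs H) = 4 * n"
  proof -
    have "card (parcs H) = card ({0, 1 :: nat} \<times> B) + card (B \<times> {0, 1 :: nat})"
      unfolding G using finB 01 by (intro card_Un_disjoint) auto
    then show ?thesis by (simp add: card_cartesian_product cardB)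
  qed
  moreover have "card (pverts H) = n + 2"
    unfolding G using finB 01 cardB by (subst card_Un_disjoint) auto
  ultimately have "scheme_genus H ?r {} \<le> int 0"
    using faces comps1 by (simp add: scheme_genus_def)
  then have "euler_genus H \<le> 0"
    unfolding euler_genus_def using es by (intro Least_le) blast
  then show ?thesis by (simp add: H_def)
qed

lemma complete_bipartite_in_vf_hadwiger_class:
  assumes n: "1 \<le> n"
  shows "complete_bipartite (k + 2) n \<in> vf_hadwiger_class k"
proof -
  let ?G = "complete_bipartite (k + 2) n"
  have "pverts ?G - {2..<k + 2} = {0, 1} \<union> {k + 2..<k + 2 + n}"
    by (auto simp: complete_bipartite_def)
  then have "euler_genus (pair_induce ?G (pverts ?G - {2..<k + 2})) = 0"
    using euler_genus_K2n[of "k + 2" n] n by simp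
  moreover have "{2..<k + 2} \<subseteq> pverts ?G" by (auto simp: complete_bipartite_def)
  ultimately have "?G \<in> apex_genus_class k k"
    using pair_graph_complete_bipartite unfolding apex_genus_class_def
    by (intro CollectI conjI exI[of _ "{2..<k + 2}"]) auto
  then show ?thesis
    unfolding vf_hadwiger_class_def by (intro clique_sum_closureI pair_graph_complete_bipartite)
qed

section \<open>From a distinguishing graph to a chain representation\<close>

lemma complete_bipartite_arcs:
  "(u, v) \<in> parcs (complete_bipartite m n) \<longleftrightarrow>
    u \<in> {..<m} \<and> v \<in> {m..<m + n} \<or> u \<in> {m..<m + n} \<and> v \<in> {..<m}"
  by (auto simp: complete_bipartite_def)

text \<open>The chain over \<open>uv\<close> consists of the edges of \<open>z\<close> between the
  two fibres. Summing its boundary counts each edge twice, so adjacent vertices have fibres of equal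
  parity; all are odd because the one over \<open>0\<close> is.\<close>

lemma chain_rep_of_certificate:
  assumes K: "pair_graph K" and \<phi>: "\<phi> \<in> homs K (complete_bipartite m n)" and mn: "1 \<le> m" "1 \<le> n"
    and z: "\<And>a b. z a b = z b a" "\<And>a b. z a b \<noteq> 0 \<Longrightarrow> (a, b) \<in> parcs K"
    and bd: "\<And>a v. a \<in> pverts K \<Longrightarrow> (\<phi> a, v) \<in> parcs (complete_bipartite m n) \<Longrightarrow>
      (\<Sum>b\<in>{b\<in>pverts K. \<phi> b = v}. z a b) = (y a :: bit)"
    and one: "(\<Sum>a\<in>{a\<in>pverts K. \<phi> a = 0}. y a) = 1"
  shows "\<exists>s. chain_rep {..<m} {m..<m + n} K \<phi> y s"
proof -
  interpret K: pair_graph K by (rule K)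
  note fin = K.pair_finite_verts
  define s where "s u v a b = (if \<phi> a = u \<and> \<phi> b = v \<or> \<phi> a = v \<and> \<phi> b = u then z a b else 0)" for u v a b
  have sym: "s u v a b = s u v b a" for u v a b using z(1)[of a b] by (auto simp: s_def)
  have supp: "(a, b) \<in> parcs K \<and> \<phi> a \<in> {u, v} \<and> \<phi> b \<in> {u, v}" if "s u v a b \<noteq> 0" for u v a b
    using that z(2)[of a b] by (auto simp: s_def split: if_splits)
  have bds: "(\<Sum>b\<in>pverts K. s u v a b) = y a"
    if u: "u \<in> {..<m}" and v: "v \<in> {m..<m + n}" and a: "a \<in> pverts K" "\<phi> a \<in> {u, v}" for u v a
  proof -
    define v' where "v' = (if \<phi> a = u then v else u)"
    have uv: "u \<noteq> v" using u v by auto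
    have "(\<Sum>b\<in>pverts K. s u v a b) = (\<Sum>b\<in>pverts K. if \<phi> b = v' then z a b else 0)"
      using a uv by (intro sum.cong) (auto simp: s_def v'_def)
    also have "\<dots> = (\<Sum>b\<in>{b\<in>pverts K. \<phi> b = v'}. z a b)" by (rule sum.inter_filter[OF fin, symmetric])
    also have "\<dots> = y a"
      using a(2) u v by (intro bd[OF a(1)]) (auto simp: v'_def complete_bipartite_arcs)
    finally show ?thesis .
  qed
  define P where "P v = (\<Sum>a\<in>{a\<in>pverts K. \<phi> a = v}. y a)" for v
  have P: "P u = P v" if u: "u \<in> {..<m}" and v: "v \<in> {m..<m + n}" for u v
  proof -
    have uv: "u \<noteq> v" using u v by auto
    define M where "M = {a\<in>pverts K. \<phi> a \<in> {u, v}}"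
    have finM: "finite M" using fin by (simp add: M_def)
    have "P u + P v = (\<Sum>a\<in>M. y a)"
      unfolding P_def using fin uv by (subst sum.union_disjoint[symmetric]) (auto simp: M_def intro!: sum.cong)
    also have "\<dots> = (\<Sum>a\<in>M. \<Sum>b\<in>M. s u v a b)"
    proof (intro sum.cong refl)
      fix a assume a: "a \<in> M"
      have "s u v a b = 0" if "b \<in> pverts K - M" for b
        by (rule ccontr) (use supp[of u v a b] that in \<open>auto simp: M_def\<close>)
      then have "(\<Sum>b\<in>M. s u v a b) = (\<Sum>b\<in>pverts K. s u v a b)"
        using fin by (intro sum.mono_neutral_left) (auto simp: M_def)
      then show "y a = (\<Sum>b\<in>M. s u v a b)" using bds[OF u v, of a] a by (simp add: M_def)
    qed
    also have "\<dots> = 0"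
    proof (rule sum_sym_bit_eq_0[OF finM sym])
      show "s u v a a = 0" for a
        by (rule ccontr) (use supp[of u v a a] K.pair_no_loops[of "(a, a)"] in auto)
    qed
    finally show ?thesis by simp
  qed
  have "P v = 1" if v: "v \<in> {..<m} \<union> {m..<m + n}" for v
  proof -
    have "P m = P 0" using P[of 0 m] mn by simp
    moreover have "P v = P m \<or> P v = P 0"
      using v P[of v m] P[of 0 v] mn by auto
    ultimately show ?thesis using one by (auto simp: P_def)
  qed
  then have "chain_rep {..<m} {m..<m + n} K \<phi> y s"
    unfolding chain_rep_def P_def[symmetric] using sym supp bds by blast
  then show ?thesis by blast
qed

text \<open>Every vertex whose fibre meets \<open>S\<close> is given up; the other fibres and the
  chains between them do not touch \<open>S\<close>. Each deleted vertex costs at most one vertex of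
  the bipartite graph.\<close>

lemma chain_rep_delete:
  assumes rep: "chain_rep A B L \<phi> y s" and L: "pair_graph L"
  shows "chain_rep (A - \<phi> ` S) (B - \<phi> ` S) (pair_induce L (pverts L - S)) \<phi> y s"
  unfolding chain_rep_def
proof (intro conjI ballI allI impI)
  interpret pair_graph L by (rule L)
  fix u v assume u: "u \<in> A - \<phi> ` S" and v: "v \<in> B - \<phi> ` S"
  then have uv: "u \<in> A" "v \<in> B" by auto
  have nS: "a \<notin> S" if "\<phi> a \<in> {u, v}" for a using that u v by auto
  have sp: "(a, b) \<in> parcs L \<and> \<phi> a \<in> {u, v} \<and> \<phi> b \<in> {u, v}" if "s u v a b \<noteq> 0" for a b
    using chain_repD(2)[OF rep uv, of a b] that by simp
  show "s u v a b = s u v b a" for a b by (rule chain_repD(1)[OF rep uv])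
  show "(a, b) \<in> parcs (pair_induce L (pverts L - S))" "\<phi> a \<in> {u, v}" "\<phi> b \<in> {u, v}" if "s u v a b \<noteq> 0" for a b
    using sp[OF that] nS by (auto simp: parcs_pair_induce in_arcsD1 in_arcsD2)
  show "(\<Sum>b\<in>pverts (pair_induce L (pverts L - S)). s u v a b) = y a"
    if "a \<in> pverts (pair_induce L (pverts L - S))" "\<phi> a \<in> {u, v}" for a
  proof -
    have "(\<Sum>b\<in>pverts L - S. s u v a b) = (\<Sum>b\<in>pverts L. s u v a b)"
    proof (rule sum.mono_neutral_left)
      show "\<forall>b\<in>pverts L - (pverts L - S). s u v a b = 0" using sp nS by blast
    qed (use pair_finite_verts in auto)
    then show ?thesis using chain_repD(3)[OF rep uv, of a] that by simp
  qed
next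
  fix v assume v: "v \<in> (A - \<phi> ` S) \<union> (B - \<phi> ` S)"
  then have eq: "{a\<in>pverts L - S. \<phi> a = v} = {a\<in>pverts L. \<phi> a = v}" by auto
  have "v \<in> A \<union> B" using v by blast
  then show "(\<Sum>a\<in>{a\<in>pverts (pair_induce L (pverts L - S)). \<phi> a = v}. y a) = 1"
    unfolding pverts_pair_induce eq by (rule chain_repD(4)[OF rep])
qed

text \<open>After the deletion of \<open>k\<close> vertices, \<open>4 ^ k + 2\<close> are left on the larger side: more than there are pairs
  of homology classes, and at least three.\<close>

theorem hom_indist_cfi_complete_bipartite:
  assumes n: "n = 4 ^ k + 2 + k"
  shows "hom_indist (vf_hadwiger_class k :: nat pair_pre_digraph set)
    (cfi (complete_bipartite (k + 3) n) {0}) (cfi (complete_bipartite (k + 3) n) {})"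
  unfolding hom_indist_def
proof (intro ballI, rule ccontr)
  let ?F = "complete_bipartite (k + 3) n" and ?A = "{..<k + 3}" and ?B = "{k + 3..<k + 3 + n}"
  fix K :: "nat pair_pre_digraph"
  assume KH: "K \<in> vf_hadwiger_class k" and neq: "card (homs K (cfi ?F {0})) \<noteq> card (homs K (cfi ?F {}))"
  from KH obtain T :: "nat pair_pre_digraph" and \<beta> where K: "pair_graph K" and td: "tree_decomposition K T \<beta>"
    and adh: "\<And>t t'. (t, t') \<in> parcs T \<Longrightarrow> card (\<beta> t \<inter> \<beta> t') \<le> k"
    and tor: "\<And>t. t \<in> pverts T \<Longrightarrow> torso K (\<beta> t) \<in> apex_genus_class k k"
    unfolding vf_hadwiger_class_def clique_sum_closure_def by blast
  obtain \<phi> z y where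
    cert: "\<phi> \<in> homs K ?F" "\<And>a b. z a b = z b a" "\<And>a b. z a b \<noteq> 0 \<Longrightarrow> (a, b) \<in> parcs K"
    "\<And>a v. a \<in> pverts K \<Longrightarrow> (\<phi> a, v) \<in> parcs ?F \<Longrightarrow> (\<Sum>b\<in>{b\<in>pverts K. \<phi> b = v}. z a b) = (y a :: bit)"
    "(\<Sum>a\<in>{a\<in>pverts K. \<phi> a = 0}. y a) = 1"
    by (rule cfi_certificate[OF K pair_graph_complete_bipartite neq]) (rule that, assumption+)
  have "\<exists>s. chain_rep ?A ?B K \<phi> y s"
    by (rule chain_rep_of_certificate[OF K cert(1) _ _ cert(2-5)]) (use n in auto)
  then obtain s where s: "chain_rep ?A ?B K \<phi> y s" by blast
  have "\<exists>t\<in>pverts T. \<exists>y' s'. chain_rep ?A ?B (torso K (\<beta> t)) \<phi> y' s'"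
    by (rule chain_rep_tree_decomposition[OF K td _ s]) (use adh n in auto)
  then obtain t y' s' where
    t: "t \<in> pverts T" and rep: "chain_rep ?A ?B (torso K (\<beta> t)) \<phi> y' s'" by blast
  define L where "L = torso K (\<beta> t)"
  from tor[OF t] obtain S where L: "pair_graph L" and S: "S \<subseteq> pverts L" "card S \<le> k"
    and genus: "euler_genus (pair_induce L (pverts L - S)) \<le> k"
    unfolding L_def apex_genus_class_def by blast
  interpret L: pair_graph L by (rule L)
  define L' where "L' = pair_induce L (pverts L - S)"
  have L': "pair_graph L'" unfolding L'_def by (rule pair_graph_pair_induce[OF L]) auto
  from euler_genus_leE[OF L', of k] genus obtain \<pi> N where
    emb: "embedding_scheme L' \<pi> N" "scheme_genus L' \<pi> N \<le> int k" unfolding L'_def by blast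
  interpret L': embedded_graph L' \<pi> N
    using L' emb(1) by (simp add: embedded_graph_def embedded_graph_axioms_def)
  have finS: "finite S" using S(1) L.pair_finite_verts finite_subset by blast
  then have "card (\<phi> ` S) \<le> k" using card_image_le[of S \<phi>] S(2) by simp
  then have "card ?A - k \<le> card (?A - \<phi> ` S)" "card ?B - k \<le> card (?B - \<phi> ` S)"
    using diff_card_le_card_Diff[of "\<phi> ` S" ?A] diff_card_le_card_Diff[of "\<phi> ` S" ?B] finS by simp_all
  then have "3 \<le> card (?A - \<phi> ` S)" "4 ^ k + 2 \<le> card (?B - \<phi> ` S)" using n by simp_all
  moreover have "(?A - \<phi> ` S) \<inter> (?B - \<phi> ` S) = {}" by auto
  ultimately have "\<not> chain_rep (?A - \<phi> ` S) (?B - \<phi> ` S) L' \<phi> y' s'"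
    by (intro L'.no_chain_rep[OF emb(2)])
  then show False using chain_rep_delete[OF rep[folded L_def] L, of S] by (simp add: L'_def)
qed

theorem theorem1p9:
  fixes k :: nat
  shows "\<exists>(G :: nat pair_pre_digraph) (H :: nat pair_pre_digraph). pair_graph G \<and> pair_graph H \<and>
           hom_indist (vf_hadwiger_class k :: nat pair_pre_digraph set) G H \<and>
           \<not> hom_indist (vf_hadwiger_class (k + 1) :: nat pair_pre_digraph set) G H"
proof -
  define n :: nat where "n = 4 ^ k + 2 + k"
  let ?F = "complete_bipartite (k + 3) n"
  have F: "pair_graph ?F" by (rule pair_graph_complete_bipartite)
  have "?F \<in> vf_hadwiger_class (k + 1)"
    using complete_bipartite_in_vf_hadwiger_class[of n "k + 1"] by (simp add: n_def numeral_3_eq_3)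
  moreover have "card (homs ?F (cfi ?F {0})) \<noteq> card (homs ?F (cfi ?F {}))"
    by (rule less_imp_neq[OF card_homs_cfi_self_less[OF F]]) (simp add: complete_bipartite_def)
  ultimately have "\<not> hom_indist (vf_hadwiger_class (k + 1) :: nat pair_pre_digraph set) (cfi ?F {0}) (cfi ?F {})"
    unfolding hom_indist_def by blast
  then show ?thesis
    using hom_indist_cfi_complete_bipartite[OF n_def] pair_graph_cfi[OF F] by blast
qed

end
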